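(* Let $n$ be a nonnegative integer. Then there is an extremal square-free word of length $n$ over the alphabet $\Gamma=\{\mathtt{a},\mathtt{b},\mathtt{c}\}$ if and only if \[ n\in\{25,41,48,50,63,71,72,77,79,81,83,84,85\}\cup\{m\colon m\geq 87\}. \]
   Context: A word is square-free if it contains no factor (contiguous subword) of the form $xx$ with $x$ a nonempty word. For a word $w$ over an alphabet $\Sigma$, an extension of $w$ is any word of the form $w'aw''$ where $a\in\Sigma$ and $w'w''=w$ (so $w'$ or $w''$ may be empty). A word $w$ over $\Sigma$ is extremal square-free if $w$ is square-free and no extension of $w$ over $\Sigma$ is square-free. *)

theory Defs
  imports Main "HOL-Library.Sublist"
begin

datatype letter = La | Lb | Lc

abbreviation \<Gamma> :: "letter set" where
  "\<Gamma> \<equiv> {La, Lb, Lc}"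

text \<open>Words are lists; \<open>sublist\<close> is the library's contiguous-factor relation
  (as opposed to \<open>subseq\<close>).\<close>

definition square_free :: "'a list \<Rightarrow> bool" where
  "square_free w \<longleftrightarrow> (\<nexists>x. x \<noteq> [] \<and> sublist (x @ x) w)"

definition extensions :: "'a set \<Rightarrow> 'a list \<Rightarrow> 'a list set" where
  "extensions \<Sigma> w = {w' @ [a] @ w'' | w' a w''. a \<in> \<Sigma> \<and> w' @ w'' = w}"

definition extremal_square_free :: "'a set \<Rightarrow> 'a list \<Rightarrow> bool" where
  "extremal_square_free \<Sigma> w \<longleftrightarrow>
     w \<in> lists \<Sigma> \<and> square_free w \<and> (\<forall>v \<in> extensions \<Sigma> w. \<not> square_free v)"

end

theory Submission
  imports Defs
begin

text \<open>
  Nonexistence. Let \<open>w\<close> be extremal of length at most 86. Prepending either of the two letters other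
  than the first one creates a square prefix, so \<open>w = v t v y\<close> with \<open>|v| \<le> 42\<close>. For each possible
  length of \<open>v\<close>, a depth-first search chooses the letters of \<open>w\<close> from left to right and abandons a
  partial word once some insertion cannot create a square any more, however the word is continued.

  Existence. For a 41-uniform morphism \<open>h\<close> and a square-free word \<open>u\<close> beginning with \<open>abc\<close>, the word
  \<open>P h(u) S\<close> is extremal when \<open>P\<close> is one of 41 left caps, one for each length modulo 41, and the right
  cap \<open>S\<close> depends on the last letter of \<open>u\<close>. Squares of period less than 58 and the squares created by
  insertions are confined to \<open>P h(abc)\<close>, to the image of four letters, or to the last three blocks with
  \<open>S\<close>. A square of larger period cannot cover the joints, because of factors that occur only there;
  inside \<open>h(u)\<close> its period is a multiple of 41, and it descends to a square of \<open>u\<close>. The remaining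
  lengths are realised by explicit words.
\<close>

text \<open>The search is executed by the simplifier, so it must stay small, and two facts keep it
  so. Each letter chosen for \<open>v\<close> appears in two places of \<open>v t v y\<close>, so
  insertions can be refuted long before the word between the copies is known. Moreover, of the two
  letters that may be prepended, the one with the larger period fixes the length of
  \<open>v\<close>; the other one must get a shorter square, which is a second early condition on
  \<open>v\<close>. The insertion points still in doubt are remembered, so that settled ones are not
  examined again.

  For existence the bound 58 separates two regimes. Below it, a square fits into four blocks. From
  it on, the square contains a window of 20 letters of \<open>h(u)\<close> together with the copy of
  this window one period later, even if the square hangs over each end of \<open>h(u)\<close> by 19
  letters; 20 letters are what synchronisation modulo 41 needs. An overhang of 20 or more letters is
  impossible because the factor around the joint would then be repeated. The factors that mark the
  joints therefore take 20 letters of the cap.\<close>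

section \<open>An exhaustive search for short extremal words\<close>

text \<open>In a pattern, \<open>None\<close> is a letter not yet chosen.\<close>

type_synonym pat = "letter option list"

text \<open>Fate of one insertion into a pattern: \<open>Shut\<close> if it makes a square on the known letters alone,
  \<open>Open\<close> if some choice of the unknown letters might make one, \<open>Dead\<close> if none can.\<close>

datatype verdict = Dead | Open | Shut

text \<open>Words are handled at a cursor: the part on its left is stored reversed.\<close>

fun match_left :: "verdict \<Rightarrow> nat \<Rightarrow> pat \<Rightarrow> pat \<Rightarrow> verdict" where
  "match_left d 0 us vs = d"
| "match_left d (Suc n) (u#us) (v#vs) =
     (if u = None \<or> v = None then match_left Open n us vs else if u = v then match_left d n us vs else Dead)"
| "match_left d (Suc n) us vs = Dead"

text \<open>The match is greedy: it moves right as long as the letters agree and only then turns to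
  the left for the rest of the period. Each agreement on the right saves one on the left, so turning
  at the first mismatch is the best choice.\<close>

fun match_right :: "verdict \<Rightarrow> nat \<Rightarrow> pat \<Rightarrow> pat \<Rightarrow> pat \<Rightarrow> pat \<Rightarrow> verdict" where
  "match_right d (Suc n) (u#us) (v#vs) lf acc =
     (if u = None \<or> v = None then match_right Open n us vs lf acc else if u = v then match_right d n us vs lf acc
      else match_left d (Suc n) lf acc)"
| "match_right d n us vs lf acc = match_left d n lf acc"

text \<open>The list \<open>v # rest\<close> begins one period after the inserted letter, hence
  \<open>v\<close> must be \<open>z\<close>; the remaining \<open>n\<close> agreements are divided
  between right and left.\<close>

fun match_period :: "letter \<Rightarrow> nat \<Rightarrow> pat \<Rightarrow> pat \<Rightarrow> pat \<Rightarrow> pat \<Rightarrow> verdict" where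
  "match_period z n [] rt lf acc = Dead"
| "match_period z n (v#rest) rt lf acc = (if v = None then match_right Open n rt rest lf acc
     else if v = Some z then match_right Shut n rt rest lf acc else Dead)"

text \<open>The period under trial is \<open>n + 1\<close>: \<open>acc\<close> and \<open>rest\<close> are \<open>z\<close> with the first \<open>n\<close> letters on its right,
  reversed, and the letters after these; \<open>accl\<close> and \<open>restl\<close> are the same for the left side.\<close>

fun scan_periods :: "nat \<Rightarrow> nat \<Rightarrow> letter \<Rightarrow> pat \<Rightarrow> pat \<Rightarrow> pat \<Rightarrow> pat \<Rightarrow> pat \<Rightarrow> pat \<Rightarrow> verdict" where
  "scan_periods 0 n z rt lf acc rest accl restl = Dead"
| "scan_periods (Suc k) n z rt lf acc rest accl restl =
    (case match_period z n rest rt lf acc of Dead \<Rightarrow>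
      (case match_period z n restl lf rt accl of Dead \<Rightarrow>
         scan_periods k (Suc n) z rt lf (take 1 rest @ acc) (tl rest) (take 1 restl @ accl) (tl restl)
       | v \<Rightarrow> v)
     | v \<Rightarrow> v)"

fun third_letter :: "letter option \<Rightarrow> letter option \<Rightarrow> letter option" where
  "third_letter (Some La) (Some Lb) = Some Lc"
| "third_letter (Some La) (Some Lc) = Some Lb"
| "third_letter (Some Lb) (Some La) = Some Lc"
| "third_letter (Some Lb) (Some Lc) = Some La"
| "third_letter (Some Lc) (Some La) = Some Lb"
| "third_letter (Some Lc) (Some Lb) = Some La"
| "third_letter a b = None"

definition slot_verdict :: "letter \<Rightarrow> nat \<Rightarrow> pat \<Rightarrow> pat \<Rightarrow> verdict" where
  "slot_verdict z k lf rt = scan_periods k 0 z rt lf [Some z] rt [Some z] lf"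

text \<open>Repeating a neighbour is always a square, so only the letter different from both
  neighbours is examined. An unknown neighbour or an end of the pattern gives \<open>Open\<close>,
  which never prunes.\<close>

fun gap_verdict :: "nat \<Rightarrow> pat \<Rightarrow> pat \<Rightarrow> verdict" where
  "gap_verdict k (x#lf) (y#rt) = (case third_letter x y of None \<Rightarrow> Open | Some z \<Rightarrow> slot_verdict z k (x#lf) (y#rt))"
| "gap_verdict k lf rt = Open"

fun cons_option :: "nat \<Rightarrow> nat list option \<Rightarrow> nat list option" where
  "cons_option a None = None"
| "cons_option a (Some ps) = Some (a#ps)"

text \<open>The last argument lists the insertion points that are not yet \<open>Shut\<close>, from right to left,
  each one given by its distance from the previous one; only these are tested again.\<close>

fun visit :: "nat \<Rightarrow> pat \<Rightarrow> pat \<Rightarrow> nat \<Rightarrow> nat list \<Rightarrow> nat list option" where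
  "visit k l rt acc [] = Some []"
| "visit k [] rt acc (p#ps) = Some []"
| "visit k (x#l) rt acc (Suc g#ps) = visit k l (x#rt) (Suc acc) (g#ps)"
| "visit k (x#l) rt acc (0#ps) = (case gap_verdict k (x#l) rt of Dead \<Rightarrow> None
     | Shut \<Rightarrow> visit k (x#l) rt acc ps | Open \<Rightarrow> cons_option acc (visit k (x#l) rt 0 ps))"

fun skip_visit :: "nat \<Rightarrow> nat \<Rightarrow> pat \<Rightarrow> pat \<Rightarrow> nat list \<Rightarrow> nat list option" where
  "skip_visit 0 k l rt ps = visit k l rt 0 ps"
| "skip_visit (Suc s) k [] rt ps = Some []"
| "skip_visit (Suc s) k (x#l) rt ps = skip_visit s k l (x#rt) ps"

text \<open>The distances in \<open>ps\<close> were measured from an earlier starting point; when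
  new points are put in front, the first old distance must grow.\<close>

fun bump_head :: "nat list \<Rightarrow> nat list" where
  "bump_head [] = []"
| "bump_head (g#gs) = Suc g # gs"

fun agree :: "nat \<Rightarrow> pat \<Rightarrow> pat \<Rightarrow> bool" where
  "agree 0 us vs = True"
| "agree (Suc n) (u#us) (v#vs) = (u = v \<and> agree n us vs)"
| "agree (Suc n) us vs = False"

text \<open>Started with \<open>ys = l\<close> and \<open>n = 0\<close>, it keeps \<open>ys\<close>
  equal to \<open>l\<close> without its first \<open>n\<close> letters and tries the period
  \<open>n + 1\<close>. Since the word so far is square-free, only squares ending in the new letter
  \<open>c\<close> have to be found.\<close>

fun makes_square :: "letter \<Rightarrow> nat \<Rightarrow> nat \<Rightarrow> pat \<Rightarrow> pat \<Rightarrow> bool" where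
  "makes_square c (Suc h) n l (y#ys) = (y = Some c \<and> agree n l ys \<or> makes_square c h (Suc n) l ys)"
| "makes_square c h n l ys = False"

fun some_dead :: "nat \<Rightarrow> pat \<Rightarrow> pat \<Rightarrow> bool" where
  "some_dead k [] rt = False"
| "some_dead k (x#l) rt = (gap_verdict k (x#l) rt = Dead \<or> some_dead k l (x#rt))"

text \<open>The table is indexed by the lengths 0 to 86; each \<open>replicate\<close> fills the
  distance between two consecutive admissible lengths.\<close>

definition allowed_table :: "bool list" where
  "allowed_table = replicate 25 False @ [True] @
    replicate 15 False @ [True] @
    replicate 6 False @ [True] @
    replicate 1 False @ [True] @
    replicate 12 False @ [True] @
    replicate 7 False @ [True] @
    replicate 0 False @ [True] @
    replicate 4 False @ [True] @
    replicate 1 False @ [True] @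
    replicate 1 False @ [True] @
    replicate 1 False @ [True] @
    replicate 0 False @ [True] @
    replicate 0 False @ [True] @ [False]"

lemma allowed_table_code [code]:
  "allowed_table = [False, False, False, False, False, False, False, False, False, False, False,
    False, False, False, False, False, False, False, False, False, False, False, False, False,
    False, True, False, False, False, False, False, False, False, False, False, False, False,
    False, False, False, False, True, False, False, False, False, False, False, True, False,
    True, False, False, False, False, False, False, False, False, False, False, False, False,
    True, False, False, False, False, False, False, False, True, True, False, False, False,
    False, True, False, True, False, True, False, True, True, True, False]"
  by (simp add: allowed_table_def eval_nat_numeral)

fun allowed_length :: "pat \<Rightarrow> bool list \<Rightarrow> bool" where
  "allowed_length (x#l) (f#fs) = allowed_length l fs"
| "allowed_length [] (f#fs) = f"
| "allowed_length l [] = False"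

text \<open>\<open>e\<close> makes the tests take place at every second letter only; \<open>h\<close>, \<open>h'\<close> are the halves of the
  lengths of the prefix and bound the periods of new squares. Gaps among the \<open>s\<close> letters next to the cursor are not tested:
  the letters to come could still close most of them.\<close>

fun search :: "pat \<Rightarrow> bool \<Rightarrow> nat \<Rightarrow> nat \<Rightarrow> nat list \<Rightarrow> pat \<Rightarrow> nat \<Rightarrow> nat \<Rightarrow> bool" where
  "search (Some c#r) e k s ps l h h' = (makes_square c h' 0 l l \<or> search r (\<not> e) k (s-1) ps (Some c#l) h' (Suc h))"
| "search r e k s ps l h h' = (case (if e then skip_visit s k l r (0#Suc 0#Suc 0#Suc 0#bump_head ps) else Some ps) of None \<Rightarrow> True | Some ps \<Rightarrow>
     if makes_square La h' 0 l l \<and> makes_square Lb h' 0 l l \<and> makes_square Lc h' 0 l l then allowed_length l allowed_table \<or> some_dead k l []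
     else case r of [] \<Rightarrow> True | _ # r \<Rightarrow> 
       (makes_square La h' 0 l l \<or> search r (\<not> e) k (s-1) ps (Some La#l) h' (Suc h)) \<and>
       (makes_square Lb h' 0 l l \<or> search r (\<not> e) k (s-1) ps (Some Lb#l) h' (Suc h)) \<and>
       (makes_square Lc h' 0 l l \<or> search r (\<not> e) k (s-1) ps (Some Lc#l) h' (Suc h)))"

fun fill_at :: "nat \<Rightarrow> letter \<Rightarrow> pat \<Rightarrow> pat" where
  "fill_at n c [] = []"
| "fill_at 0 c (x#r) = Some c # r"
| "fill_at (Suc n) c (x#r) = x # fill_at n c r"

text \<open>The counterpart of \<open>s\<close> while the prefix is being chosen. It balances cost
  against pruning, since \<open>skip_visit_alive\<close> holds for any number; the form with
  \<open>Suc\<close> lets evaluation recurse on it.\<close>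

definition near :: nat where "near = Suc (Suc (Suc (Suc (Suc (Suc (Suc (Suc (Suc 0))))))))"

text \<open>Once \<open>v\<close> is complete, the main search starts again from a list of all
  insertion points of a word of length at most 86.\<close>

definition all_gaps :: "nat list" where "all_gaps = 0 # replicate 86 (Suc 0)"

text \<open>The word has the form \<open>v @ t # v @ y\<close> with \<open>length v = f\<close>; while \<open>v\<close> is being chosen from left to
  right, each letter is known in both copies.\<close>

primrec choose_prefix :: "(bool \<times> bool) list \<Rightarrow> bool \<Rightarrow> nat \<Rightarrow> nat \<Rightarrow> letter \<Rightarrow> nat \<Rightarrow> nat list \<Rightarrow> pat \<Rightarrow> pat \<Rightarrow> pat \<Rightarrow> nat \<Rightarrow> nat \<Rightarrow> bool" where
  "choose_prefix [] = (\<lambda>e0 k f z s ps l lb r h h'. search r e0 k s all_gaps l h h')"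
| "choose_prefix (ue#us) = (\<lambda>e0 k f z s ps l lb r h h'. \<forall>c. makes_square c (Suc h) 0 lb lb \<or>
     (fst ue \<and> slot_verdict z f [] (rev (Some c # l) @ fill_at f c (tl r)) = Dead) \<or>
     (case (if snd ue then skip_visit near k (Some c # l) (fill_at f c (tl r)) (0#Suc 0#bump_head ps) else Some ps) of None \<Rightarrow> True
      | Some ps \<Rightarrow> choose_prefix us e0 k f z (s-1) ps (Some c # l) (Some c # lb) (fill_at f c (tl r)) h' (Suc h)))"

text \<open>One branch of \<open>choose_prefix\<close>, with the outcome \<open>b\<close> of the
  square test as an argument; thereby the quantifier over letters becomes a conjunction of three
  branches that can be evaluated.\<close>

definition choose_with :: "bool \<Rightarrow> letter \<Rightarrow> bool \<Rightarrow> bool \<Rightarrow> (bool \<times> bool) list \<Rightarrow> bool \<Rightarrow> nat \<Rightarrow> nat \<Rightarrow> letter \<Rightarrow> nat \<Rightarrow> nat list \<Rightarrow> pat \<Rightarrow> pat \<Rightarrow> pat \<Rightarrow> nat \<Rightarrow> nat \<Rightarrow> bool" where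
  "choose_with b c u e us e0 k f z s ps l lb r h h' = (b \<or> 
     (u \<and> slot_verdict z f [] (rev (Some c#l) @ r) = Dead) \<or>
     (case (if e then skip_visit near k (Some c#l) r (0#Suc 0#bump_head ps) else Some ps) of None \<Rightarrow> True
      | Some ps \<Rightarrow> choose_prefix us e0 k f z (s-1) ps (Some c#l) (Some c#lb) r h' (Suc h)))"

lemma all_letter: "(\<forall>c. P c) \<longleftrightarrow> P La \<and> P Lb \<and> P Lc"
  by (metis letter.exhaust)

lemma choose_prefix_simps:
  "choose_prefix [] e0 k f z s ps l lb r h h' = search r e0 k s all_gaps l h h'"
  "choose_prefix ((u,e)#us) e0 k f z s ps l lb r h h' =
    (choose_with (makes_square La (Suc h) 0 lb lb) La u e us e0 k f z s ps l lb (fill_at f La (tl r)) h h' \<and>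
     choose_with (makes_square Lb (Suc h) 0 lb lb) Lb u e us e0 k f z s ps l lb (fill_at f Lb (tl r)) h h' \<and>
     choose_with (makes_square Lc (Suc h) 0 lb lb) Lc u e us e0 k f z s ps l lb (fill_at f Lc (tl r)) h h')"
  by (simp_all only: choose_prefix.simps choose_with_def all_letter fst_conv snd_conv)

declare choose_prefix.simps [simp del]

section \<open>Soundness of the search\<close>

definition square_at :: "'a list \<Rightarrow> nat \<Rightarrow> nat \<Rightarrow> bool" where
  "square_at w s p \<longleftrightarrow> 0 < p \<and> s + 2 * p \<le> length w \<and> (\<forall>j<p. w ! (s + j) = w ! (s + p + j))"

lemma square_free_iff: "square_free w \<longleftrightarrow> (\<forall>s p. \<not> square_at w s p)"
proof
  assume sf: "square_free w"
  show "\<forall>s p. \<not> square_at w s p"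
  proof (intro allI notI)
    fix s p assume a: "square_at w s p"
    define x where "x = take p (drop s w)"
    have x2: "x = take p (drop (s + p) w)"
      using a by (intro nth_equalityI) (auto simp: x_def square_at_def)
    have "drop s w = x @ drop (s + p) w"
      unfolding x_def by (metis append_take_drop_id drop_drop add.commute)
    also have "drop (s + p) w = x @ drop p (drop (s + p) w)"
      using x2 by (metis append_take_drop_id)
    finally have "w = take s w @ (x @ x) @ drop p (drop (s + p) w)"
      by (metis append.assoc append_take_drop_id)
    then have "sublist (x @ x) w" by (metis sublist_appendI)
    moreover have "x \<noteq> []" using a by (auto simp: x_def square_at_def)
    ultimately show False using sf by (auto simp: square_free_def)
  qed
next
  assume a: "\<forall>s p. \<not> square_at w s p"
  show "square_free w"
    unfolding square_free_def
  proof (intro notI, elim exE conjE)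
    fix x assume "x \<noteq> []" "sublist (x @ x) w"
    then obtain u v where w: "w = u @ (x @ x) @ v" by (auto simp: sublist_def)
    have "square_at w (length u) (length x)"
      using \<open>x \<noteq> []\<close> by (auto simp: square_at_def w nth_append)
    then show False using a by blast
  qed
qed

lemma square_free_sublist: "sublist u w \<Longrightarrow> square_free w \<Longrightarrow> square_free u"
  by (meson square_free_def sublist_order.order.trans)

lemma square_free_rev [simp]: "square_free (rev w) = square_free w"
proof -
  have "square_free (rev w) \<Longrightarrow> square_free w" for w :: "'a list"
    unfolding square_free_def
    by (metis rev_append rev_is_Nil_conv sublist_rev)
  from this[of w] this[of "rev w"] show ?thesis by auto
qed

text \<open>Inserting \<open>z\<close> between \<open>rev L\<close> and \<open>R\<close> creates a square of period \<open>p\<close> whose first half contains the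
  new letter: \<open>a\<close> letters of this half, including \<open>z\<close>, are on the right and \<open>b\<close> on the left.\<close>

definition half_square :: "'a \<Rightarrow> nat \<Rightarrow> 'a list \<Rightarrow> 'a list \<Rightarrow> bool" where
  "half_square z p L R \<longleftrightarrow> (\<exists>a b. 0 < a \<and> a + b = p \<and> p + a \<le> Suc (length R) \<and> b \<le> length L \<and>
     (\<forall>t<a. (z # R) ! t = (z # R) ! (p + t)) \<and> (\<forall>t<b. L ! t = (z # R) ! (p - 1 - t)))"

lemma nth_ins: "(rev L @ z # R) ! j = (if j < length L then L ! (length L - 1 - j) else (z # R) ! (j - length L))"
  by (auto simp: nth_append rev_nth)

lemma half_square_imp_square:
  assumes "half_square z p L R" shows "\<not> square_free (rev L @ z # R)"
proof -
  obtain a b where ab: "0 < a" "a + b = p" "p + a \<le> Suc (length R)" "b \<le> length L"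
    "\<And>t. t < a \<Longrightarrow> (z # R) ! t = (z # R) ! (p + t)" "\<And>t. t < b \<Longrightarrow> L ! t = (z # R) ! (p - 1 - t)"
    using assms unfolding half_square_def by blast
  have "square_at (rev L @ z # R) (length L - b) p"
    unfolding square_at_def
  proof (intro conjI allI impI)
    fix j assume j: "j < p"
    show "(rev L @ z # R) ! (length L - b + j) = (rev L @ z # R) ! (length L - b + p + j)"
    proof (cases "j < b")
      case True
      have "L ! (b - 1 - j) = (z # R) ! (p - 1 - (b - 1 - j))" using True by (intro ab(6)) simp
      moreover have "length L - 1 - (length L - b + j) = b - 1 - j" using True ab by simp
      moreover have "p - 1 - (b - 1 - j) = length L - b + p + j - length L" using True ab j by simp
      moreover have "length L - b + j < length L" "\<not> length L - b + p + j < length L" using True ab by auto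
      ultimately show ?thesis by (simp only: nth_ins if_True if_False)
    next
      case False
      have "(z # R) ! (j - b) = (z # R) ! (p + (j - b))" using False j ab by (intro ab(5)) simp
      moreover have "length L - b + j - length L = j - b" "length L - b + p + j - length L = p + (j - b)"
        using False ab by auto
      moreover have "\<not> length L - b + j < length L" "\<not> length L - b + p + j < length L" using False ab by auto
      ultimately show ?thesis by (simp only: nth_ins if_False)
    qed
  qed (use ab in auto)
  then show ?thesis by (auto simp: square_free_iff)
qed

text \<open>A square without the new letter would already give one in \<open>rev L @ R\<close>. So
  \<open>z\<close> lies in the first half of the square or in the second, and the second case is the
  mirror image with \<open>L\<close> and \<open>R\<close> exchanged.\<close>

lemma square_imp_half_square:
  assumes "square_free (rev L @ R)" "\<not> square_free (rev L @ z # R)"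
  shows "\<exists>p>0. 2 * p \<le> Suc (length L + length R) \<and> (half_square z p L R \<or> half_square z p R L)"
proof -
  define i where "i = length L"
  let ?y = "rev L @ z # R" and ?w = "rev L @ R"
  obtain s p where sq: "square_at ?y s p" using assms(2) by (auto simp: square_free_iff)
  have yw: "?y ! j = (if j < i then ?w ! j else if j = i then z else ?w ! (j - 1))" for j
    by (auto simp: nth_append i_def nth_Cons')
  have p: "0 < p" "s + 2 * p \<le> Suc (length L + length R)" and
    eq: "\<And>j. j < p \<Longrightarrow> ?y ! (s + j) = ?y ! (s + p + j)"
    using sq by (auto simp: square_at_def)
  have si: "s \<le> i"
  proof (rule ccontr)
    assume "\<not> s \<le> i"
    then have "square_at ?w (s - 1) p"
      using p eq by (auto simp: square_at_def yw)
    then show False using assms(1) by (auto simp: square_free_iff)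
  qed
  have is2: "i < s + 2 * p"
  proof (rule ccontr)
    assume "\<not> i < s + 2 * p"
    then have "square_at ?w s p"
      using p eq by (auto simp: square_at_def yw i_def)
    then show False using assms(1) by (auto simp: square_free_iff)
  qed
  have "half_square z p L R \<or> half_square z p R L"
  proof (cases "i < s + p")
    case True
    have "half_square z p L R"
      unfolding half_square_def
    proof (intro exI conjI allI impI)
      show "0 < s + p - i" "(s + p - i) + (i - s) = p" using True si by auto
      show "p + (s + p - i) \<le> Suc (length R)" "i - s \<le> length L" using p True si by (auto simp: i_def)
      fix t assume t: "t < s + p - i"
      have "?y ! (i + t) = ?y ! (i + p + t)"
        using eq[of "i - s + t"] t si by (simp add: algebra_simps)
      then show "(z # R) ! t = (z # R) ! (p + t)" by (simp add: nth_ins i_def)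
    next
      fix t assume t: "t < i - s"
      have "?y ! (i - 1 - t) = ?y ! (i - 1 - t + p)"
        using eq[of "i - 1 - t - s"] t si True by (simp add: algebra_simps)
      moreover have "i - 1 - t + p - i = p - 1 - t" "i - 1 - (i - 1 - t) = t" "i - 1 - t < i" "\<not> i - 1 - t + p < i"
        using t True by auto
      ultimately show "L ! t = (z # R) ! (p - 1 - t)" by (simp add: nth_ins i_def)
    qed
    then show ?thesis ..
  next
    case False
    have zL: "(z # L) ! t = ?y ! (i - t)" if "t \<le> i" for t
      using that by (cases t) (auto simp: nth_ins i_def)
    have "half_square z p R L"
      unfolding half_square_def
    proof (intro exI conjI allI impI)
      show "0 < i + 1 - (s + p)" "(i + 1 - (s + p)) + (s + 2 * p - i - 1) = p" using False is2 by auto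
      show "p + (i + 1 - (s + p)) \<le> Suc (length L)" "s + 2 * p - i - 1 \<le> length R"
        using p False si by (auto simp: i_def)
      fix t assume t: "t < i + 1 - (s + p)"
      have "?y ! (i - p - t) = ?y ! (i - t)"
        using eq[of "i - p - t - s"] t False is2 by (simp add: algebra_simps)
      then show "(z # L) ! t = (z # L) ! (p + t)" using zL[of t] zL[of "p + t"] t False by (simp add: algebra_simps)
    next
      fix t assume t: "t < s + 2 * p - i - 1"
      have "?y ! (i + 1 + t - p) = ?y ! (i + 1 + t)"
        using eq[of "i + 1 + t - p - s"] t False by (simp add: algebra_simps)
      moreover have "?y ! (i + 1 + t) = R ! t" by (simp add: nth_ins i_def)
      moreover have "i - (p - 1 - t) = i + 1 + t - p" "p - 1 - t \<le> i" using t False si by auto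
      ultimately show "R ! t = (z # L) ! (p - 1 - t)" using zL[of "p - 1 - t"] by simp
    qed
    then show ?thesis ..
  qed
  then show ?thesis using p by (intro exI[of _ p]) auto
qed

section \<open>Patterns and the words they may still become\<close>

definition compat :: "'a option \<Rightarrow> 'a option \<Rightarrow> bool" where
  "compat u v \<longleftrightarrow> u = None \<or> v = None \<or> u = v"

text \<open>The pattern may be longer than the word: the length of the word is not known during the
  search.\<close>

definition covers :: "'a option list \<Rightarrow> 'a list \<Rightarrow> bool" where
  "covers r R \<longleftrightarrow> length R \<le> length r \<and> (\<forall>j<length R. r ! j = None \<or> r ! j = Some (R ! j))"

lemma covers_Nil [simp]: "covers [] []"
  by (simp add: covers_def)

lemma covers_map [simp]: "covers (map Some L) L"
  by (simp add: covers_def)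

lemma covers_Cons [simp]: "covers (u # r) (x # R) \<longleftrightarrow> (u = None \<or> u = Some x) \<and> covers r R"
  by (auto simp: covers_def nth_Cons split: nat.splits)

lemma match_left_alive:
  assumes "d \<noteq> Dead" "n \<le> length us" "n \<le> length vs" "\<forall>t<n. compat (us ! t) (vs ! t)"
  shows "match_left d n us vs \<noteq> Dead"
  using assms
proof (induction d n us vs rule: match_left.induct)
  case (2 d n u us v vs)
  have "\<forall>t<n. compat (us ! t) (vs ! t)" "compat u v" using "2.prems"(4) by force+
  then show ?case using 2 by (auto simp: compat_def)
qed auto

text \<open>Here \<open>a\<close> is the split of a real square. If the greedy run goes on to the
  right beyond \<open>a\<close>, the induction hypothesis is used with split 0 and a smaller
  \<open>n\<close>, for which fewer letters on the left are required.\<close>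

lemma match_right_alive:
  assumes "d \<noteq> Dead" "a \<le> n" "a \<le> length us" "a \<le> length vs" "\<forall>t<a. compat (us ! t) (vs ! t)"
    "n - a \<le> length lf" "n - a \<le> length acc" "\<forall>t<n-a. compat (lf ! t) (acc ! t)"
  shows "match_right d n us vs lf acc \<noteq> Dead"
  using assms
proof (induction d n us vs lf acc arbitrary: a rule: match_right.induct)
  case (1 d n u us v vs lf acc)
  note prems = "1.prems"
  show ?case
  proof (cases a)
    case 0
    have b: "match_left d (Suc n) lf acc \<noteq> Dead" using prems 0 by (intro match_left_alive) auto
    have r: "u = None \<or> v = None \<Longrightarrow> match_right Open n us vs lf acc \<noteq> Dead"
      by (rule "1.IH"(1)[of 0]) (use prems 0 in auto)
    have r2: "\<not> (u = None \<or> v = None) \<Longrightarrow> u = v \<Longrightarrow> match_right d n us vs lf acc \<noteq> Dead"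
      by (rule "1.IH"(2)[of 0]) (use prems 0 in auto)
    show ?thesis using b r r2 by simp
  next
    case (Suc a')
    have c: "compat u v" "\<forall>t<a'. compat (us ! t) (vs ! t)" using prems(5) Suc by force+
    have r: "u = None \<or> v = None \<Longrightarrow> match_right Open n us vs lf acc \<noteq> Dead"
      by (rule "1.IH"(1)[of a']) (use prems Suc c in auto)
    have r2: "\<not> (u = None \<or> v = None) \<Longrightarrow> u = v \<Longrightarrow> match_right d n us vs lf acc \<noteq> Dead"
      by (rule "1.IH"(2)[of a']) (use prems Suc c in auto)
    show ?thesis using c r r2 by (auto simp: compat_def)
  qed
qed (simp_all add: match_left_alive)

lemma match_period_alive:
  assumes "half_square z (Suc n) L R" "covers lf L" "covers rt R"
  shows "match_period z n (drop n rt) rt lf (rev (take (Suc n) (Some z # rt))) \<noteq> Dead"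
proof -
  obtain a b where ab: "0 < a" "a + b = Suc n" "Suc n + a \<le> Suc (length R)" "b \<le> length L"
    "\<And>t. t < a \<Longrightarrow> (z # R) ! t = (z # R) ! (Suc n + t)" "\<And>t. t < b \<Longrightarrow> L ! t = (z # R) ! (Suc n - 1 - t)"
    using assms(1) unfolding half_square_def by blast
  have len: "length R \<le> length rt" "length L \<le> length lf"
    and R: "\<And>j. j < length R \<Longrightarrow> rt ! j = None \<or> rt ! j = Some (R ! j)"
    and L: "\<And>j. j < length L \<Longrightarrow> lf ! j = None \<or> lf ! j = Some (L ! j)"
    using assms by (auto simp: covers_def)
  have n: "n < length R" using ab by simp
  obtain v rest where vr: "drop n rt = v # rest" "v = rt ! n" "rest = drop (Suc n) rt"
    using n len by (metis Cons_nth_drop_Suc less_le_trans)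
  have v: "v = None \<or> v = Some z" using R[OF n] ab(5)[of 0] ab(1) vr(2) by auto
  \<comment> \<open>The split is \<open>a - 1\<close> because the agreement of \<open>z\<close>
    itself has been checked by \<open>match_period\<close>.\<close>
  have f: "match_right d n rt rest lf (rev (take (Suc n) (Some z # rt))) \<noteq> Dead" if "d \<noteq> Dead" for d
  proof (rule match_right_alive[OF that, of "a - 1"])
    show "\<forall>t<a - 1. compat (rt ! t) (rest ! t)"
    proof (intro allI impI)
      fix t assume t: "t < a - 1"
      have 1: "t < length R" "Suc n + t < length R" using t ab by auto
      have "R ! t = R ! (Suc n + t)" using ab(5)[of "Suc t"] t by simp
      then show "compat (rt ! t) (rest ! t)" using R[OF 1(1)] R[OF 1(2)] vr(3) len 1 by (auto simp: compat_def)
    qed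
    show "\<forall>t<n - (a - 1). compat (lf ! t) (rev (take (Suc n) (Some z # rt)) ! t)"
    proof (intro allI impI)
      fix t assume "t < n - (a - 1)"
      then have t: "t < b" using ab by simp
      have 1: "t < length L" "n - t < Suc (length R)" "t < Suc n" using t ab n by auto
      have "(Some z # rt) ! (n - t) = None \<or> (Some z # rt) ! (n - t) = Some ((z # R) ! (n - t))"
        using R[of "n - t - 1"] 1(2) by (cases "n - t") auto
      moreover have "rev (take (Suc n) (Some z # rt)) ! t = (Some z # rt) ! (n - t)"
        using n len 1 by (subst rev_nth) (auto simp: min_def nth_Cons')
      ultimately show "compat (lf ! t) (rev (take (Suc n) (Some z # rt)) ! t)"
        using ab(6)[OF t] L[OF 1(1)] by (auto simp: compat_def)
    qed
  qed (use ab len n vr in auto)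
  show ?thesis unfolding vr(1) using v f[of Open] f[of Shut] by auto
qed

lemma take_Suc_drop: "take 1 (drop n xs) @ rev (take (Suc n) (y # xs)) = rev (take (Suc (Suc n)) (y # xs))"
  by (cases "n < length xs") (simp_all add: take_Suc_conv_app_nth Cons_nth_drop_Suc[symmetric])

text \<open>A smaller period with another verdict than \<open>Dead\<close> ends the scan and is
  harmless; otherwise the scan reaches \<open>p\<close>, where the verdict is not
  \<open>Dead\<close>. The long arguments are the accumulators after \<open>n\<close> steps, see
  \<open>take_Suc_drop\<close>.\<close>

lemma scan_periods_alive:
  assumes "covers lf L" "covers rt R" "half_square z p L R \<or> half_square z p R L" "n < p" "p \<le> n + k"
  shows "scan_periods k n z rt lf (rev (take (Suc n) (Some z # rt))) (drop n rt) (rev (take (Suc n) (Some z # lf))) (drop n lf) \<noteq> Dead"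
  using assms(4,5)
proof (induction k arbitrary: n)
  case (Suc k)
  show ?case
  proof (cases "p = Suc n")
    case True
    then show ?thesis using assms(3) match_period_alive[of z n L R lf rt] match_period_alive[of z n R L rt lf] assms(1,2)
      by (auto split: verdict.split)
  next
    case False
    have "scan_periods k (Suc n) z rt lf (take 1 (drop n rt) @ rev (take (Suc n) (Some z # rt))) (tl (drop n rt))
      (take 1 (drop n lf) @ rev (take (Suc n) (Some z # lf))) (tl (drop n lf)) \<noteq> Dead"
      unfolding take_Suc_drop tl_drop drop_Suc[symmetric] by (rule Suc.IH) (use False Suc.prems in auto)
    then show ?thesis by (auto simp del: take_Suc_Cons rev.simps split: verdict.split)
  qed
qed simp


text \<open>The type \<open>letter\<close> has exactly the elements of \<Gamma>, so extremality can
  be stated without an alphabet; see \<open>extremal_iff_stuck\<close>.\<close>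

definition stuck :: "letter list \<Rightarrow> bool" where
  "stuck w \<longleftrightarrow> square_free w \<and> (\<forall>u v z. w = u @ v \<longrightarrow> \<not> square_free (u @ z # v))"

lemma slot_verdict_alive:
  assumes "square_free (rev L @ R)" "\<not> square_free (rev L @ z # R)" "covers lf L" "covers rt R"
    "length L + length R \<le> 2 * k"
  shows "slot_verdict z k lf rt \<noteq> Dead"
proof -
  obtain p where "p > 0" "2 * p \<le> Suc (length L + length R)" "half_square z p L R \<or> half_square z p R L"
    using square_imp_half_square[OF assms(1,2)] by blast
  then show ?thesis
    using scan_periods_alive[OF assms(3,4), of z p 0 k] assms(5) by (simp add: slot_verdict_def)
qed

lemma gap_verdict_alive:
  assumes "stuck (rev L @ R)" "covers lf L" "covers rt R" "length L + length R \<le> 2 * k"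
  shows "gap_verdict k lf rt \<noteq> Dead"
proof -
  have "slot_verdict z k lf rt \<noteq> Dead" for z
    by (rule slot_verdict_alive[of L R]) (use assms in \<open>auto simp: stuck_def\<close>)
  then show ?thesis by (cases lf; cases rt) (auto split: option.split)
qed

text \<open>In a stuck word no insertion point at all can be \<open>Dead\<close>. The lemma
  therefore holds for every list \<open>ps\<close>, and the bookkeeping of open points needs no
  invariant.\<close>

lemma visit_alive:
  assumes "stuck (rev L @ R)" "covers rt R" "length L + length R \<le> 2 * k"
  shows "visit k (map Some L) rt acc ps \<noteq> None"
  using assms
proof (induction k "map Some L" rt acc ps arbitrary: L R rule: visit.induct)
  case (3 k x l rt acc g ps)
  then obtain a L' where L: "L = a # L'" "x = Some a" "l = map Some L'" by auto
  then show ?case using "3.hyps"(1)[of L' "a # R"] "3.prems" by simp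
next
  case (4 k x l rt acc ps)
  have t: "gap_verdict k (map Some L) rt \<noteq> Dead" by (rule gap_verdict_alive[of L R]) (use "4.prems" in auto)
  have e: "map Some L = x # l" using "4.hyps" by simp
  show ?case
  proof (cases "gap_verdict k (x # l) rt")
    case Dead
    then show ?thesis using t e by simp
  next
    case Open
    have "visit k (x # l) rt 0 ps \<noteq> None"
      by (rule "4.hyps"(1)[OF Open e[symmetric], unfolded e]) (use "4.prems" in auto)
    then show ?thesis using Open unfolding e by (cases "visit k (x # l) rt 0 ps") auto
  next
    case Shut
    have "visit k (x # l) rt acc ps \<noteq> None"
      by (rule "4.hyps"(2)[OF Shut e[symmetric], unfolded e]) (use "4.prems" in auto)
    then show ?thesis using Shut unfolding e by auto
  qed
qed auto

lemma skip_visit_alive: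
  assumes "stuck (rev L @ R)" "covers rt R" "length L + length R \<le> 2 * k"
  shows "skip_visit s k (map Some L) rt ps \<noteq> None"
  using assms
proof (induction s arbitrary: L R rt)
  case 0
  then show ?case using visit_alive by simp
next
  case (Suc s)
  then show ?case using Suc.IH[of "tl L" "hd L # R" "Some (hd L) # rt"] by (cases L) auto
qed

lemma some_dead_alive:
  assumes "stuck (rev L @ R)" "covers rt R" "length L + length R \<le> 2 * k"
  shows "\<not> some_dead k (map Some L) rt"
  using assms
proof (induction L arbitrary: R rt)
  case (Cons a L)
  have "gap_verdict k (map Some (a # L)) rt \<noteq> Dead" by (rule gap_verdict_alive[of "a # L" R]) (use Cons.prems in auto)
  then show ?case using Cons.IH[of "a # R" "Some a # rt"] Cons.prems by auto
qed simp

section \<open>Squares created by appending a letter to a reversed word\<close>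

lemma agree_iff: "agree n us vs \<longleftrightarrow> n \<le> length us \<and> n \<le> length vs \<and> take n us = take n vs"
  by (induction n us vs rule: agree.induct) auto

lemma makes_square_iff: "makes_square c h n l ys \<longleftrightarrow> (\<exists>k<h. k < length ys \<and> ys ! k = Some c \<and> agree (n + k) l (drop (Suc k) ys))"
proof (induction c h n l ys rule: makes_square.induct)
  case (1 c h n l y ys)
  show ?case
    unfolding makes_square.simps 1 by (auto simp: less_Suc_eq_0_disj)
qed auto

lemma makes_square_square: "makes_square c h 0 (map Some l) (map Some l) \<Longrightarrow> \<not> square_free (c # l)"
proof -
  assume "makes_square c h 0 (map Some l) (map Some l)"
  then obtain k where k: "k < length l" "l ! k = c" "agree k (map Some l) (drop (Suc k) (map Some l))"
    by (auto simp: makes_square_iff)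
  have le: "k \<le> length l - Suc k" and "take k (map Some l) = take k (drop (Suc k) (map Some l))"
    using k(3) by (auto simp: agree_iff)
  then have t: "take k l = take k (drop (Suc k) l)"
    by (metis drop_map inj_Some map_injective take_map)
  have n: "l ! j = l ! (Suc k + j)" if "j < k" for j
    using arg_cong[OF t, of "\<lambda>x. x ! j"] that k(1) le by simp
  have "square_at (c # l) 0 (Suc k)"
    using k le n by (auto simp: square_at_def nth_Cons split: nat.split)
  then show ?thesis by (auto simp: square_free_iff)
qed

text \<open>As \<open>l\<close> is square-free, a square in \<open>c # l\<close> starts with
  \<open>c\<close>; its period is at most half of the new length, which is what the bound on
  \<open>h\<close> provides.\<close>

lemma not_sqr_square_free:
  assumes "square_free l" "\<not> makes_square c h 0 (map Some l) (map Some l)" "Suc (length l) div 2 \<le> h"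
  shows "square_free (c # l)"
proof (rule ccontr)
  assume "\<not> square_free (c # l)"
  then obtain s p where sq: "square_at (c # l) s p" by (auto simp: square_free_iff)
  have "s = 0"
  proof (rule ccontr)
    assume "s \<noteq> 0"
    then have "square_at l (s - 1) p" using sq by (auto simp: square_at_def nth_Cons')
    then show False using assms(1) by (auto simp: square_free_iff)
  qed
  with sq have p: "0 < p" "2 * p \<le> Suc (length l)" and e: "\<And>j. j < p \<Longrightarrow> (c # l) ! j = (c # l) ! (p + j)"
    by (auto simp: square_at_def)
  obtain k where k: "p = Suc k" using p by (cases p) auto
  have "take k l = take k (drop (Suc k) l)"
  proof (rule nth_equalityI)
    fix j assume "j < length (take k l)"
    then show "take k l ! j = take k (drop (Suc k) l) ! j" using e[of "Suc j"] k p by auto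
  qed (use k p in auto)
  then have "agree k (map Some l) (drop (Suc k) (map Some l))"
    using k p by (simp add: agree_iff take_map drop_map)
  moreover have "l ! k = c" using e[of 0] k by simp
  ultimately have "makes_square c h 0 (map Some l) (map Some l)"
    using k p assms(3) by (auto simp: makes_square_iff intro!: exI[of _ k])
  then show False using assms(2) by simp
qed

lemma allowed_length_iff: "allowed_length l fs \<longleftrightarrow> length l < length fs \<and> fs ! length l"
  by (induction l fs rule: allowed_length.induct) auto

definition allowed :: "nat set" where
  "allowed = {25, 41, 48, 50, 63, 71, 72, 77, 79, 81, 83, 84, 85}"

lemma allowed_length_okl: "allowed_length l allowed_table \<Longrightarrow> length l \<in> allowed"
  by (auto simp: allowed_length_iff allowed_table_def allowed_def nth_append nth_Cons' split: if_splits)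

text \<open>In addition to \<open>covers\<close>, every known letter must be present in the word:
  the second copy of \<open>v\<close> cannot be cut off.\<close>

definition fits :: "pat \<Rightarrow> letter list \<Rightarrow> bool" where
  "fits r R \<longleftrightarrow> covers r R \<and> (\<forall>j<length r. r ! j \<noteq> None \<longrightarrow> j < length R)"

lemma fits_covers: "fits r R \<Longrightarrow> covers r R" by (simp add: fits_def)
lemma fits_Some: "fits (Some c # r) R \<longleftrightarrow> (\<exists>R'. R = c # R' \<and> fits r R')"
  by (cases R) (auto simp: fits_def nth_Cons split: nat.splits)
lemma fits_None: "fits (u # r) (c # R) \<Longrightarrow> fits r R"
  by (auto simp: fits_def nth_Cons split: nat.splits)
lemma fits_Nil: "fits [] R \<longleftrightarrow> R = []"
  by (auto simp: fits_def covers_def)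

lemma stuck_square_free: "stuck w \<Longrightarrow> square_free w" by (simp add: stuck_def)

lemma square_free_prefix_rev:
  assumes "square_free (rev L @ c # R)" shows "square_free (c # L)"
proof -
  have "sublist (rev (c # L)) (rev L @ c # R)" unfolding sublist_def by (intro exI[of _ "[]"] exI[of _ R]) simp
  then have "square_free (rev (c # L))" using assms square_free_sublist by blast
  then show ?thesis by (simp only: square_free_rev)
qed

lemma search_NoneD:
  assumes "search (None # r) e k s ps l h h'"
    "(if e then skip_visit s k l (None # r) (0#Suc 0#Suc 0#Suc 0#bump_head ps) else Some ps) = Some ps'"
  shows "\<forall>c. makes_square c h' 0 l l \<Longrightarrow> allowed_length l allowed_table \<or> some_dead k l []"
    and "\<not> makes_square c h' 0 l l \<Longrightarrow> search r (\<not> e) k (s - 1) ps' (Some c # l) h' (Suc h)"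
proof -
  have "if \<forall>c. makes_square c h' 0 l l then allowed_length l allowed_table \<or> some_dead k l [] else
    (\<forall>c. makes_square c h' 0 l l \<or> search r (\<not> e) k (s - 1) ps' (Some c # l) h' (Suc h))"
  proof -
    have all: "(\<forall>c. P c) \<longleftrightarrow> P La \<and> P Lb \<and> P Lc" for P by (metis letter.exhaust)
    show ?thesis using assms unfolding all by (cases e; auto)
  qed
  then show "\<forall>c. makes_square c h' 0 l l \<Longrightarrow> allowed_length l allowed_table \<or> some_dead k l []"
    and "\<not> makes_square c h' 0 l l \<Longrightarrow> search r (\<not> e) k (s - 1) ps' (Some c # l) h' (Suc h)"
    by (auto split: if_splits)
qed

text \<open>The word itself is a path in the search tree that is never pruned. At its end all three
  letters would complete a square, so the search claims an admissible length or a dead insertion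
  point, and both are excluded.\<close>

lemma search_sound:
  assumes "search r e k s ps (map Some L) h h'" "stuck (rev L @ R)" "fits r R" "length L + length R \<notin> allowed"
    "length L + length r \<le> 2 * k" "length L div 2 \<le> h" "Suc (length L) div 2 \<le> h'"
  shows False
  using assms
proof (induction r arbitrary: e s ps L R h h')
  case (Cons u r)
  note prems = Cons.prems
  have sf: "square_free (rev L @ R)" using prems(2) by (rule stuck_square_free)
  have lr: "length L + length R \<le> 2 * k" using prems(3,5) by (auto simp: fits_def covers_def)
  have step: False if R: "R = c # R'" and d: "makes_square c h' 0 (map Some L) (map Some L) \<or> search r e' k s' ps' (Some c # map Some L) h' (Suc h)" for c R' e' s' ps'
  proof -
    have "\<not> makes_square c h' 0 (map Some L) (map Some L)"
      using makes_square_square square_free_prefix_rev[of L c R'] sf R by blast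
    then have d: "search r e' k s' ps' (map Some (c # L)) h' (Suc h)" using d by simp
    show False
      by (rule Cons.IH[OF d, of R']) (use prems R in \<open>auto intro: fits_None\<close>)
  qed
  show ?case
  proof (cases u)
    case (Some c)
    then obtain R' where "R = c # R'" using prems(3) by (auto simp: fits_Some)
    then show ?thesis using step[of c R'] prems(1) Some by auto
  next
    case None
    have "skip_visit s k (map Some L) (None # r) (0#Suc 0#Suc 0#Suc 0#bump_head ps) \<noteq> None"
      by (rule skip_visit_alive[OF prems(2) fits_covers[OF prems(3)] lr, unfolded None])
    then obtain ps' where g: "(if e then skip_visit s k (map Some L) (None # r) (0#Suc 0#Suc 0#Suc 0#bump_head ps) else Some ps) = Some ps'"
      by (cases e) auto
    note D = search_NoneD[OF prems(1)[unfolded None] g]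
    show ?thesis
    proof (cases R)
      case Nil
      have c: "makes_square c h' 0 (map Some L) (map Some L)" for c
      proof (rule ccontr)
        assume "\<not> ?thesis"
        then have "square_free (c # L)"
          using not_sqr_square_free[of L c h'] sf Nil prems(7) by simp
        then have "square_free (rev (c # L))" by (simp only: square_free_rev)
        moreover have "\<not> square_free (rev L @ c # [])" using prems(2) Nil unfolding stuck_def by blast
        ultimately show False by simp
      qed
      have "allowed_length (map Some L) allowed_table \<or> some_dead k (map Some L) []"
        using D(1) c by blast
      moreover have "\<not> some_dead k (map Some L) []"
        by (rule some_dead_alive[of L "[]"]) (use prems Nil in \<open>auto simp: covers_def\<close>)
      ultimately show False using allowed_length_okl[of "map Some L"] prems(4) Nil by simp
    next
      case (Cons c R')
      have n: "\<not> makes_square c h' 0 (map Some L) (map Some L)"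
        using makes_square_square square_free_prefix_rev[of L c R'] sf Cons by blast
      show False by (rule step[OF Cons, of "\<not> e" "s - 1" ps']) (use D(2)[OF n] in blast)
    qed
  qed
next
  case Nil
  note prems = Nil.prems
  have R: "R = []" using prems(3) by (simp add: fits_Nil)
  have sf: "square_free (rev L @ R)" using prems(2) by (rule stuck_square_free)
  let ?g = "if e then skip_visit s k (map Some L) [] (0#Suc 0#Suc 0#Suc 0#bump_head ps) else Some ps"
  have "skip_visit s k (map Some L) [] (0#Suc 0#Suc 0#Suc 0#bump_head ps) \<noteq> None"
    by (rule skip_visit_alive[OF prems(2) fits_covers[OF prems(3)]]) (use prems R in auto)
  then obtain ps' where g: "?g = Some ps'" by (cases e) auto
  have c: "makes_square c h' 0 (map Some L) (map Some L)" for c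
  proof (rule ccontr)
    assume "\<not> ?thesis"
    then have "square_free (c # L)"
      using not_sqr_square_free[of L c h'] sf R prems(7) by simp
    then have "square_free (rev (c # L))" by (simp only: square_free_rev)
    moreover have "\<not> square_free (rev L @ c # [])" using prems(2) R unfolding stuck_def by blast
    ultimately show False by simp
  qed
  have "allowed_length (map Some L) allowed_table \<or> some_dead k (map Some L) []"
    using prems(1) g c by simp
  moreover have "\<not> some_dead k (map Some L) []"
    by (rule some_dead_alive[of L "[]"]) (use prems R in \<open>auto simp: covers_def\<close>)
  ultimately show False using allowed_length_okl[of "map Some L"] prems(4) R by simp
qed


section \<open>Soundness of the choice of the repeated prefix\<close>

lemma fill_at_append: "length xs = n \<Longrightarrow> fill_at n c (xs @ y # ys) = xs @ Some c # ys"
  by (induction xs arbitrary: n) auto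

lemma covers_append: "covers r x \<Longrightarrow> length r = length x \<Longrightarrow> covers r' y \<Longrightarrow> covers (r @ r') (x @ y)"
  by (auto simp: covers_def nth_append)

lemma covers_replicate [simp]: "covers (replicate n None) y \<longleftrightarrow> length y \<le> n"
  by (auto simp: covers_def)

lemma fits_map: "length y \<le> m \<Longrightarrow> fits (map Some x @ replicate m None) (x @ y)"
  by (auto simp: fits_def nth_append intro!: covers_append)

text \<open>Besides the chosen part \<open>rev L\<close> of \<open>v\<close>, the search carries
  \<open>t # rev L\<close>, the same letters as they stand in the second copy. A square that passes
  through \<open>t\<close> is thus noticed while \<open>v\<close> is being chosen.\<close>

lemma choose_prefix_sound:
  assumes "choose_prefix us e0 k f z s ps (map Some L) (map Some (L @ [t]))
     (replicate (length us) None @ Some t # map Some (rev L) @ replicate (length us) None @ replicate m None) h h'"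
   "stuck w" "w = v @ t # v @ y" "take (length L) v = rev L" "length v = length L + length us" "length v = f"
   "half_square z p [] w" "p \<le> f" "length w \<notin> allowed" "2 * f + 1 + m \<le> 2 * k" "length y \<le> m" 
   "length L div 2 \<le> h" "Suc (length L) div 2 \<le> h'"
  shows False
  using assms
proof (induction us arbitrary: L s ps h h')
  case Nil
  note prems = Nil.prems
  have v: "v = rev L" using prems(4,5) by simp
  have d: "search (map Some (t # rev L) @ replicate m None) e0 k s all_gaps (map Some L) h h'" using prems(1) by (simp add: choose_prefix_simps)
  show False
    by (rule search_sound[OF d, of "t # v @ y"]) (use prems v fits_map[of y m "t # v"] in auto)
next
  case (Cons ue us)
  note prems = Cons.prems
  obtain u e where ue: "ue = (u, e)" by (cases ue)
  obtain c v2 where v: "v = rev (c # L) @ v2" "length v2 = length us"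
  proof -
    have "v = rev L @ drop (length L) v" "drop (length L) v \<noteq> []"
      using prems(4,5) append_take_drop_id[of "length L" v] by auto
    then show thesis using that[of "hd (drop (length L) v)" "tl (drop (length L) v)"] prems(5) by auto
  qed
  define r where "r = replicate (length us) None @ Some t # map Some (rev (c # L)) @ replicate (length us) None @ replicate m None"
  have up: "fill_at f c (replicate (length us) None @ Some t # map Some (rev L) @ None # replicate (length us) None @ replicate m None) = r"
  proof -
    have "fill_at f c ((replicate (length us) None @ Some t # map Some (rev L)) @ None # replicate (length us) None @ replicate m None) =
      (replicate (length us) None @ Some t # map Some (rev L)) @ Some c # replicate (length us) None @ replicate m None"
      by (rule fill_at_append) (use prems(5,6) in simp)
    then show ?thesis by (simp add: r_def)
  qed
  have "choose_with (makes_square c (Suc h) 0 (map Some (L @ [t])) (map Some (L @ [t]))) c u e us e0 k f z s ps (map Some L) (map Some (L @ [t])) r h h'"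
    using prems(1) up unfolding ue choose_prefix_simps by (cases c) simp_all
  moreover have "\<not> makes_square c (Suc h) 0 (map Some (L @ [t])) (map Some (L @ [t]))"
  proof
    assume "makes_square c (Suc h) 0 (map Some (L @ [t])) (map Some (L @ [t]))"
    then have "\<not> square_free (rev (c # L @ [t]))" using makes_square_square unfolding square_free_rev by blast
    moreover have "sublist (rev (c # L @ [t])) w"
      unfolding sublist_def prems(3) by (intro exI[of _ v] exI[of _ "v2 @ y"]) (simp add: v)
    ultimately show False using prems(2) square_free_sublist stuck_square_free by blast
  qed
  moreover have "slot_verdict z f [] (rev (Some c # map Some L) @ r) \<noteq> Dead"
  proof -
    have "w = rev (c # L) @ v2 @ (t # rev (c # L)) @ v2 @ y" unfolding prems(3) by (simp add: v)
    moreover have "covers (rev (Some c # map Some L) @ r) (rev (c # L) @ v2 @ (t # rev (c # L)) @ v2 @ y)"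
    proof -
      have "rev (Some c # map Some L) @ r = map Some (rev (c # L)) @ replicate (length us) None @
        map Some (t # rev (c # L)) @ replicate (length us) None @ replicate m None"
        by (simp add: r_def rev_map)
      then show ?thesis using v(2) prems(11) by (simp only:) (intro covers_append covers_map; simp)
    qed
    ultimately have "covers (rev (Some c # map Some L) @ r) w" by simp
    moreover have "0 < p" using prems(7) by (auto simp: half_square_def)
    ultimately show ?thesis
      using scan_periods_alive[of "[]" "[]" "rev (Some c # map Some L) @ r" w z p 0 f] prems(7,8) by (simp add: slot_verdict_def)
  qed
  moreover have "skip_visit near k (map Some (c # L)) r (0 # Suc 0 # bump_head ps) \<noteq> None"
  proof (rule skip_visit_alive[of "c # L" "v2 @ (t # rev (c # L)) @ v2 @ y"])
    show "stuck (rev (c # L) @ v2 @ (t # rev (c # L)) @ v2 @ y)" using prems(2,3) by (simp add: v)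
    show "covers r (v2 @ (t # rev (c # L)) @ v2 @ y)"
    proof -
      have "r = replicate (length us) None @ map Some (t # rev (c # L)) @ replicate (length us) None @ replicate m None"
        by (simp add: r_def)
      then show ?thesis using v(2) prems(11) by (simp only:) (intro covers_append covers_map; simp)
    qed
    show "length (c # L) + length (v2 @ (t # rev (c # L)) @ v2 @ y) \<le> 2 * k"
      using prems(5,6,10,11) v(2) by simp
  qed
  ultimately obtain ps' where p: "choose_prefix us e0 k f z (s - 1) ps' (map Some (c # L)) (map Some ((c # L) @ [t])) r h' (Suc h)"
    unfolding choose_with_def by (cases e) auto
  show False
    by (rule Cons.IH[OF p[unfolded r_def]]) (use prems v in auto)
qed

text \<open>The index \<open>i\<close> counts the letters of \<open>v\<close> chosen so far: two are
  given and \<open>v\<close> has \<open>F - 1\<close>. The first flag orders the test for prepending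
  \<open>z\<close>, the second the test of the inner insertion points; their spacing balances the
  cost of tests against pruning.\<close>

definition schedule :: "nat \<Rightarrow> (bool \<times> bool) list" where
  "schedule F = map (\<lambda>i. (4 < i \<and> i mod 4 = 0 \<or> i = F-2, odd i)) [2..<F-1]"
text \<open>Up to a permutation of the letters, the word begins with \<open>La, Lb\<close>. Prepending \<open>Lb\<close> and prepending
  \<open>Lc\<close> create square prefixes of different periods, the larger of which is \<open>F\<close>; \<open>t\<close> is the letter that
  creates it and \<open>z\<close> the other one. Hence the word is \<open>v @ t # v @ y\<close> with \<open>length v = F - 1\<close>, and \<open>v\<close>
  must allow a square of period less than \<open>F\<close> in front of which \<open>z\<close> stands.\<close>

definition search_run :: "nat \<Rightarrow> letter \<Rightarrow> letter \<Rightarrow> bool" where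
 "search_run F t z = choose_prefix (schedule F) (even F) 43 (F-1) z 85 [] [Some Lb, Some La] [Some Lb, Some La, Some t]
    (replicate (F-3) None @ Some t # Some La # Some Lb # replicate (F-3) None @ replicate (87-2*F) None) 1 1"


lemma length_schedule [simp]: "length (schedule F) = F - 3"
  by (simp add: schedule_def)

lemma half_square_front:
  assumes "half_square c p [] w"
  shows "0 < p" "2 * p \<le> Suc (length w)" "\<And>j. j < p \<Longrightarrow> (c # w) ! j = (c # w) ! (p + j)"
proof -
  obtain a b where ab: "0 < a" "a + b = p" "p + a \<le> Suc (length w)" "b \<le> 0"
    and e: "\<forall>t<a. (c # w) ! t = (c # w) ! (p + t)"
    using assms unfolding half_square_def list.size by metis
  have "a = p" using ab by simp
  show "0 < p" using ab \<open>a = p\<close> by simp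
  show "2 * p \<le> Suc (length w)" using ab \<open>a = p\<close> by simp
  show "(c # w) ! j = (c # w) ! (p + j)" if "j < p" for j using e \<open>a = p\<close> that by blast
qed

text \<open>The parameters of \<open>search_run\<close> come from the bound 86. The pattern has
  \<open>(2*F - 1) + (87 - 2*F)\<close> letters, a square created by an insertion has period at most
  43, and \<open>F - 1\<close> bounds the smaller of the two periods. The number \<open>s\<close>
  starts at 85 with two letters known, so \<open>s\<close> and the length of the prefix always add
  up to 87.\<close>

lemma search_run_sound:
  assumes "search_run F t z" "stuck w" "length w \<le> 86" "length w \<notin> allowed" "take 2 w = [La, Lb]"
    "half_square t F [] w" "half_square z p [] w" "p < F" "4 \<le> F"
  shows False
proof -
  note F = half_square_front[OF assms(6)]
  define v where "v = take (F - 1) w"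
  have lv: "length v = F - 1" using F(2) assms(9) by (simp add: v_def)
  have t: "w ! (F - 1) = t" using F(3)[of 0] F(1) by (simp add: nth_Cons')
  have v2: "take (F - 1) (drop F w) = v"
  proof (rule nth_equalityI)
    fix j assume "j < length (take (F - 1) (drop F w))"
    then have "j < F - 1" by simp
    then show "take (F - 1) (drop F w) ! j = v ! j"
      using F(3)[of "Suc j"] F(2) by (simp add: v_def)
  qed (use F(2) lv assms(9) in simp)
  have "w = v @ drop (F - 1) w" by (simp add: v_def)
  also have "drop (F - 1) w = t # drop F w"
    using Cons_nth_drop_Suc[of "F - 1" w] t F(1,2) assms(9) by simp
  also have "drop F w = v @ drop (F - 1) (drop F w)" using v2 append_take_drop_id by metis
  finally have w: "w = v @ t # v @ drop (F - 1) (drop F w)" .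
  have choose_prefix: "choose_prefix (schedule F) (even F) 43 (F-1) z 85 [] (map Some [Lb, La]) (map Some ([Lb, La] @ [t]))
    (replicate (length (schedule F)) None @ Some t # map Some (rev [Lb, La]) @ replicate (length (schedule F)) None @ replicate (87-2*F) None) 1 1"
    using assms(1) by (simp add: search_run_def)
  have v3: "take 2 v = [La, Lb]" using assms(5,9) by (simp add: v_def min_def)
  show False
    by (rule choose_prefix_sound[OF choose_prefix assms(2) w]) (use v3[unfolded numeral_2_eq_2] lv assms F in auto)
qed

section \<open>Renaming letters, and reduction of short extremal words to the runs\<close>

lemma square_free_map: "inj f \<Longrightarrow> square_free (map f w) = square_free w"
  by (simp add: square_free_iff square_at_def inj_eq cong: conj_cong)

lemma stuck_map:
  assumes "bij f" "stuck w" shows "stuck (map f w)"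
  unfolding stuck_def
proof (intro conjI allI impI)
  have inj: "inj f" using assms(1) by (rule bij_is_inj)
  show "square_free (map f w)" using assms(2) inj by (simp add: stuck_def square_free_map)
  fix u v z assume "map f w = u @ v"
  then obtain u' v' where w: "w = u' @ v'" "u = map f u'" "v = map f v'" by (auto simp: map_eq_append_conv)
  obtain z' where "z = f z'" using assms(1) by (metis bij_pointE)
  then have "u @ z # v = map f (u' @ z' # v')" using w by simp
  then show "\<not> square_free (u @ z # v)" using assms(2) w inj by (simp only: square_free_map stuck_def) blast
qed

lemma letter_bij:
  assumes "a \<noteq> b" obtains f :: "letter \<Rightarrow> letter" where "bij f" "f a = La" "f b = Lb"
proof
  let ?f = "\<lambda>x. if x = a then La else if x = b then Lb else Lc"
  show "bij ?f"
  proof (rule bijI)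
    show "inj ?f" 
    proof (rule injI)
      fix x y assume "?f x = ?f y"
      then show "x = y" using assms by (cases x; cases y; cases a; cases b; simp)
    qed
    show "surj ?f" unfolding surj_def
    proof
      fix y
      show "\<exists>x. y = ?f x"
      proof (cases y)
        case Lc
        have "\<exists>x. x \<noteq> a \<and> x \<noteq> b" by (cases a; cases b) auto
        then show ?thesis using Lc by auto
      qed (use assms in auto)
    qed
  qed
qed (use assms in auto)

lemma stuck_length:
  assumes runs: "\<And>F. 4 \<le> F \<Longrightarrow> F \<le> 43 \<Longrightarrow> search_run F Lb Lc \<and> search_run F Lc Lb"
    and w: "stuck w" "length w \<le> 86"
  shows "length w \<in> allowed"
proof (rule ccontr)
  assume n: "length w \<notin> allowed"
  have sq1: "square_free [x]" for x :: letter
    by (auto simp: square_free_iff square_at_def)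
  have sq2: "square_free [x, y]" if "x \<noteq> y" for x y :: letter
    unfolding square_free_iff
  proof (intro allI notI)
    fix s p assume q: "square_at [x, y] s p"
    then have "p = 1" "s = 0" by (auto simp: square_at_def)
    then show False using q that by (auto simp: square_at_def)
  qed
  obtain a b w' where wab: "w = a # b # w'"
  proof (cases w)
    case Nil
    then show ?thesis using w(1) sq1[of La] by (auto simp: stuck_def)
  next
    case (Cons a w1)
    show ?thesis
    proof (cases w1)
      case Nil
      have "\<exists>y. a \<noteq> y" by (cases a) auto
      then obtain y where "a \<noteq> y" by blast
      moreover have "w = [a] @ []" using Cons Nil by simp
      then have "\<not> square_free ([a] @ y # [])" using w(1) unfolding stuck_def by blast
      ultimately show ?thesis using sq2[of a y] by simp
    qed (use Cons that in auto)
  qed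
  have "a \<noteq> b"
  proof
    assume "a = b"
    then have "square_at w 0 1" by (simp add: wab square_at_def)
    then show False using w(1) by (auto simp: stuck_def square_free_iff)
  qed
  then obtain f where f: "bij f" "f a = La" "f b = Lb" by (rule letter_bij)
  define x where "x = map f w"
  have x: "stuck x" "length x \<le> 86" "length x \<notin> allowed" "take 2 x = [La, Lb]"
    using stuck_map[OF f(1) w(1)] w(2) n by (auto simp: x_def wab f)
  \<comment> \<open>Period 1 would make \<open>c\<close> equal to the first letter of
    \<open>x\<close>, which is \<open>La\<close>.\<close>
  have front: "\<exists>p\<ge>2. half_square c p [] x \<and> x ! (p - 1) = c" if "c \<noteq> La" for c
  proof -
    have "x = [] @ x" by simp
    then have "\<not> square_free ([] @ c # x)" using x(1) unfolding stuck_def by blast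
    then have "\<not> square_free (rev [] @ c # x)" by simp
    then obtain p where p: "p > 0" "half_square c p [] x \<or> half_square c p x []"
      using square_imp_half_square[of "[]" x c] x(1) by (auto simp: stuck_def)
    have "\<not> half_square c p x []" using p(1) by (auto simp: half_square_def)
    then have h: "half_square c p [] x" using p by simp
    have e: "(c # x) ! 0 = (c # x) ! p" using half_square_front(3)[OF h, of 0] p(1) by simp
    moreover have "x ! 0 = La" using x(4) by (cases x) auto
    ultimately have "p \<noteq> 1" using that by auto
    then show ?thesis using h e p(1) by (intro exI[of _ p]) (auto simp: nth_Cons')
  qed
  obtain p where p: "p \<ge> 2" "half_square Lb p [] x" "x ! (p - 1) = Lb" using front[of Lb] by auto
  obtain q where q: "q \<ge> 2" "half_square Lc q [] x" "x ! (q - 1) = Lc" using front[of Lc] by auto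
  \<comment> \<open>Period 2 forces the third letter of \<open>x\<close> to be \<open>La\<close>,
    period 3 forces it to be \<open>c\<close>.\<close>
  have n32: "\<not> (half_square c 3 [] x \<and> half_square d 2 [] x)" if "c \<noteq> La" for c d
  proof
    assume a: "half_square c 3 [] x \<and> half_square d 2 [] x"
    have "(c # x) ! 0 = (c # x) ! (3 + 0)" "(d # x) ! 1 = (d # x) ! (2 + 1)"
      using a by (intro half_square_front(3); simp)+
    then have "x ! 0 = c" by simp
    then show False using x(4) that by (cases x) auto
  qed
  \<comment> \<open>The periods differ because \<open>x\<close> has \<open>Lb\<close> at
    \<open>p - 1\<close> and \<open>Lc\<close> at \<open>q - 1\<close>. Being at least 2 and not the
    pair 2 and 3, they leave at least 4 for the larger one.\<close>
  have "p \<noteq> q" using p q by auto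
  moreover have "p \<noteq> 3 \<or> q \<noteq> 2" "q \<noteq> 3 \<or> p \<noteq> 2" using n32 p(2) q(2) by blast+
  moreover have "p \<le> 43" "q \<le> 43" using half_square_front(2)[OF p(2)] half_square_front(2)[OF q(2)] x(2) by auto
  ultimately consider "p < q" "q \<le> 43" "4 \<le> q" | "q < p" "p \<le> 43" "4 \<le> p"
    using p(1) q(1) by linarith
  then show False
  proof cases
    case 1
    then show False using search_run_sound[of q Lc Lb x p] runs[of q] p q x by simp
  next
    case 2
    then show False using search_run_sound[of p Lb Lc x q] runs[of p] p q x by simp
  qed
qed

section \<open>Evaluation of the search\<close>

text \<open>The simplifier evaluates the search. It needs far fewer steps when every letter of a pattern has
  its own constructor and every case distinction is an equation, so the functions above are restated
  in this form.\<close>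

datatype cells = E | A cells | B cells | C cells | U cells

fun of_cells :: "cells \<Rightarrow> pat" where
  "of_cells E = []" | "of_cells (A x) = Some La # of_cells x" | "of_cells (B x) = Some Lb # of_cells x" | "of_cells (C x) = Some Lc # of_cells x" | "of_cells (U x) = None # of_cells x"

definition "match_left' d n us vs = match_left d n (of_cells us) (of_cells vs)"
definition "match_right' d n us vs w = match_right d n (of_cells us) (of_cells vs) (of_cells (fst w)) (of_cells (snd w))"
definition "agree' n us vs = agree n (of_cells us) (of_cells vs)"

lemma match_left'_code [code]:
  "match_left' d 0 us vs = d"
  "match_left' d (Suc n) E vs = Dead"
  "match_left' d (Suc n) (A us) E = Dead"
  "match_left' d (Suc n) (A us) (A vs) = match_left' d n us vs"
  "match_left' d (Suc n) (A us) (B vs) = Dead"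
  "match_left' d (Suc n) (A us) (C vs) = Dead"
  "match_left' d (Suc n) (A us) (U vs) = match_left' Open n us vs"
  "match_left' d (Suc n) (B us) E = Dead"
  "match_left' d (Suc n) (B us) (A vs) = Dead"
  "match_left' d (Suc n) (B us) (B vs) = match_left' d n us vs"
  "match_left' d (Suc n) (B us) (C vs) = Dead"
  "match_left' d (Suc n) (B us) (U vs) = match_left' Open n us vs"
  "match_left' d (Suc n) (C us) E = Dead"
  "match_left' d (Suc n) (C us) (A vs) = Dead"
  "match_left' d (Suc n) (C us) (B vs) = Dead"
  "match_left' d (Suc n) (C us) (C vs) = match_left' d n us vs"
  "match_left' d (Suc n) (C us) (U vs) = match_left' Open n us vs"
  "match_left' d (Suc n) (U us) E = Dead"
  "match_left' d (Suc n) (U us) (A vs) = match_left' Open n us vs"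
  "match_left' d (Suc n) (U us) (B vs) = match_left' Open n us vs"
  "match_left' d (Suc n) (U us) (C vs) = match_left' Open n us vs"
  "match_left' d (Suc n) (U us) (U vs) = match_left' Open n us vs"
  by (simp_all add: match_left'_def)

lemma match_right'_code [code]:
  "match_right' d 0 us vs w = d"
  "match_right' d (Suc n) E vs (lf,acc) = match_left' d (Suc n) lf acc"
  "match_right' d (Suc n) (A us) E (lf,acc) = match_left' d (Suc n) lf acc"
  "match_right' d (Suc n) (A us) (A vs) w = match_right' d n us vs w"
  "match_right' d (Suc n) (A us) (B vs) (lf,acc) = match_left' d (Suc n) lf acc"
  "match_right' d (Suc n) (A us) (C vs) (lf,acc) = match_left' d (Suc n) lf acc"
  "match_right' d (Suc n) (A us) (U vs) w = match_right' Open n us vs w"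
  "match_right' d (Suc n) (B us) E (lf,acc) = match_left' d (Suc n) lf acc"
  "match_right' d (Suc n) (B us) (A vs) (lf,acc) = match_left' d (Suc n) lf acc"
  "match_right' d (Suc n) (B us) (B vs) w = match_right' d n us vs w"
  "match_right' d (Suc n) (B us) (C vs) (lf,acc) = match_left' d (Suc n) lf acc"
  "match_right' d (Suc n) (B us) (U vs) w = match_right' Open n us vs w"
  "match_right' d (Suc n) (C us) E (lf,acc) = match_left' d (Suc n) lf acc"
  "match_right' d (Suc n) (C us) (A vs) (lf,acc) = match_left' d (Suc n) lf acc"
  "match_right' d (Suc n) (C us) (B vs) (lf,acc) = match_left' d (Suc n) lf acc"
  "match_right' d (Suc n) (C us) (C vs) w = match_right' d n us vs w"
  "match_right' d (Suc n) (C us) (U vs) w = match_right' Open n us vs w"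
  "match_right' d (Suc n) (U us) E (lf,acc) = match_left' d (Suc n) lf acc"
  "match_right' d (Suc n) (U us) (A vs) w = match_right' Open n us vs w"
  "match_right' d (Suc n) (U us) (B vs) w = match_right' Open n us vs w"
  "match_right' d (Suc n) (U us) (C vs) w = match_right' Open n us vs w"
  "match_right' d (Suc n) (U us) (U vs) w = match_right' Open n us vs w"
  by (simp_all add: match_right'_def match_left'_def)

lemma agree'_code [code]:
  "agree' 0 us vs = True"
  "agree' (Suc n) E vs = False"
  "agree' (Suc n) (A us) E = False"
  "agree' (Suc n) (A us) (A vs) = agree' n us vs"
  "agree' (Suc n) (A us) (B vs) = False"
  "agree' (Suc n) (A us) (C vs) = False"
  "agree' (Suc n) (A us) (U vs) = False"
  "agree' (Suc n) (B us) E = False"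
  "agree' (Suc n) (B us) (A vs) = False"
  "agree' (Suc n) (B us) (B vs) = agree' n us vs"
  "agree' (Suc n) (B us) (C vs) = False"
  "agree' (Suc n) (B us) (U vs) = False"
  "agree' (Suc n) (C us) E = False"
  "agree' (Suc n) (C us) (A vs) = False"
  "agree' (Suc n) (C us) (B vs) = False"
  "agree' (Suc n) (C us) (C vs) = agree' n us vs"
  "agree' (Suc n) (C us) (U vs) = False"
  "agree' (Suc n) (U us) E = False"
  "agree' (Suc n) (U us) (A vs) = False"
  "agree' (Suc n) (U us) (B vs) = False"
  "agree' (Suc n) (U us) (C vs) = False"
  "agree' (Suc n) (U us) (U vs) = agree' n us vs"
  by (simp_all add: agree'_def)

text \<open>There is one scan for each inserted letter, so that comparison with this letter becomes
  a constructor case. The \<open>_left\<close> function is the second half of a step, entered when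
  the square cannot lie towards the right; the \<open>_verdict\<close> functions branch on a verdict
  once it is computed.\<close>

definition "scanA k n acc accl restl rest q = scan_periods k n La (of_cells (fst q)) (of_cells (snd q)) (of_cells acc) (of_cells rest) (of_cells accl) (of_cells restl)"
definition "scanA_left k n acc accl restl rest q = (case match_period La n (of_cells restl) (of_cells (snd q)) (of_cells (fst q)) (of_cells accl) of Dead \<Rightarrow>
         scan_periods k (Suc n) La (of_cells (fst q)) (of_cells (snd q)) (of_cells acc) (of_cells rest) (take 1 (of_cells restl) @ of_cells accl) (tl (of_cells restl)) | v \<Rightarrow> v)"
definition "scanA_right_verdict v k n acc accl restl rest q = (case v of Dead \<Rightarrow> scanA_left k n acc accl restl rest q | v \<Rightarrow> v)"
definition "scanA_left_verdict v k n acc accl restl rest q = (case v of Dead \<Rightarrow> scanA k (Suc n) acc accl restl rest q | v \<Rightarrow> v)"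
lemma scanA_code [code]:
  "scanA 0 n acc accl restl rest q = Dead"
  "scanA (Suc k) n acc accl restl (A r) (rt,lf) = scanA_right_verdict (match_right' Shut n rt r (lf,acc)) k n (A acc) accl restl r (rt,lf)"
  "scanA (Suc k) n acc accl restl (U r) (rt,lf) = scanA_right_verdict (match_right' Open n rt r (lf,acc)) k n (U acc) accl restl r (rt,lf)"
  "scanA (Suc k) n acc accl (B rl) (B r) q = scanA k (Suc n) (B acc) (B accl) rl r q"
  "scanA (Suc k) n acc accl (C rl) (B r) q = scanA k (Suc n) (B acc) (C accl) rl r q"
  "scanA (Suc k) n acc accl E (B r) q = scanA k (Suc n) (B acc) accl E r q"
  "scanA (Suc k) n acc accl (A rl) (B r) (rt,lf) = scanA_left_verdict (match_right' Shut n lf rl (rt,accl)) k n (B acc) (A accl) rl r (rt,lf)"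
  "scanA (Suc k) n acc accl (B rl) (C r) q = scanA k (Suc n) (C acc) (B accl) rl r q"
  "scanA (Suc k) n acc accl (C rl) (C r) q = scanA k (Suc n) (C acc) (C accl) rl r q"
  "scanA (Suc k) n acc accl E (C r) q = scanA k (Suc n) (C acc) accl E r q"
  "scanA (Suc k) n acc accl (A rl) (C r) (rt,lf) = scanA_left_verdict (match_right' Shut n lf rl (rt,accl)) k n (C acc) (A accl) rl r (rt,lf)"
  "scanA (Suc k) n acc accl (B rl) E q = scanA k (Suc n) acc (B accl) rl E q"
  "scanA (Suc k) n acc accl (C rl) E q = scanA k (Suc n) acc (C accl) rl E q"
  "scanA (Suc k) n acc accl E E q = scanA k (Suc n) acc accl E E q"
  "scanA (Suc k) n acc accl (A rl) E (rt,lf) = scanA_left_verdict (match_right' Shut n lf rl (rt,accl)) k n acc (A accl) rl E (rt,lf)"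
  by (simp_all add: scanA_def scanA_left_def scanA_right_verdict_def scanA_left_verdict_def match_right'_def split: verdict.split)
lemma scanA_left_code [code]:
  "scanA_left k n acc accl (B rl) rest q = scanA k (Suc n) acc (B accl) rl rest q"
  "scanA_left k n acc accl (C rl) rest q = scanA k (Suc n) acc (C accl) rl rest q"
  "scanA_left k n acc accl E rest q = scanA k (Suc n) acc accl E rest q"
  "scanA_left k n acc accl (A rl) rest (rt,lf) = scanA_left_verdict (match_right' Shut n lf rl (rt,accl)) k n acc (A accl) rl rest (rt,lf)"
  by (simp_all add: scanA_def scanA_left_def scanA_left_verdict_def match_right'_def split: verdict.split)
lemma scanA_right_verdict_code [code]:
  "scanA_right_verdict Open k n acc accl restl rest q = Open"
  "scanA_right_verdict Shut k n acc accl restl rest q = Shut"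
  "scanA_right_verdict Dead k n acc accl restl rest q = scanA_left k n acc accl restl rest q"
  by (simp_all add: scanA_right_verdict_def)
lemma scanA_left_verdict_code [code]:
  "scanA_left_verdict Open k n acc accl restl rest q = Open"
  "scanA_left_verdict Shut k n acc accl restl rest q = Shut"
  "scanA_left_verdict Dead k n acc accl restl rest q = scanA k (Suc n) acc accl restl rest q"
  by (simp_all add: scanA_left_verdict_def)
definition "scanB k n acc accl restl rest q = scan_periods k n Lb (of_cells (fst q)) (of_cells (snd q)) (of_cells acc) (of_cells rest) (of_cells accl) (of_cells restl)"
definition "scanB_left k n acc accl restl rest q = (case match_period Lb n (of_cells restl) (of_cells (snd q)) (of_cells (fst q)) (of_cells accl) of Dead \<Rightarrow>
         scan_periods k (Suc n) Lb (of_cells (fst q)) (of_cells (snd q)) (of_cells acc) (of_cells rest) (take 1 (of_cells restl) @ of_cells accl) (tl (of_cells restl)) | v \<Rightarrow> v)"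
definition "scanB_right_verdict v k n acc accl restl rest q = (case v of Dead \<Rightarrow> scanB_left k n acc accl restl rest q | v \<Rightarrow> v)"
definition "scanB_left_verdict v k n acc accl restl rest q = (case v of Dead \<Rightarrow> scanB k (Suc n) acc accl restl rest q | v \<Rightarrow> v)"
lemma scanB_code [code]:
  "scanB 0 n acc accl restl rest q = Dead"
  "scanB (Suc k) n acc accl restl (B r) (rt,lf) = scanB_right_verdict (match_right' Shut n rt r (lf,acc)) k n (B acc) accl restl r (rt,lf)"
  "scanB (Suc k) n acc accl restl (U r) (rt,lf) = scanB_right_verdict (match_right' Open n rt r (lf,acc)) k n (U acc) accl restl r (rt,lf)"
  "scanB (Suc k) n acc accl (A rl) (A r) q = scanB k (Suc n) (A acc) (A accl) rl r q"
  "scanB (Suc k) n acc accl (C rl) (A r) q = scanB k (Suc n) (A acc) (C accl) rl r q"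
  "scanB (Suc k) n acc accl E (A r) q = scanB k (Suc n) (A acc) accl E r q"
  "scanB (Suc k) n acc accl (B rl) (A r) (rt,lf) = scanB_left_verdict (match_right' Shut n lf rl (rt,accl)) k n (A acc) (B accl) rl r (rt,lf)"
  "scanB (Suc k) n acc accl (A rl) (C r) q = scanB k (Suc n) (C acc) (A accl) rl r q"
  "scanB (Suc k) n acc accl (C rl) (C r) q = scanB k (Suc n) (C acc) (C accl) rl r q"
  "scanB (Suc k) n acc accl E (C r) q = scanB k (Suc n) (C acc) accl E r q"
  "scanB (Suc k) n acc accl (B rl) (C r) (rt,lf) = scanB_left_verdict (match_right' Shut n lf rl (rt,accl)) k n (C acc) (B accl) rl r (rt,lf)"
  "scanB (Suc k) n acc accl (A rl) E q = scanB k (Suc n) acc (A accl) rl E q"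
  "scanB (Suc k) n acc accl (C rl) E q = scanB k (Suc n) acc (C accl) rl E q"
  "scanB (Suc k) n acc accl E E q = scanB k (Suc n) acc accl E E q"
  "scanB (Suc k) n acc accl (B rl) E (rt,lf) = scanB_left_verdict (match_right' Shut n lf rl (rt,accl)) k n acc (B accl) rl E (rt,lf)"
  by (simp_all add: scanB_def scanB_left_def scanB_right_verdict_def scanB_left_verdict_def match_right'_def split: verdict.split)
lemma scanB_left_code [code]:
  "scanB_left k n acc accl (A rl) rest q = scanB k (Suc n) acc (A accl) rl rest q"
  "scanB_left k n acc accl (C rl) rest q = scanB k (Suc n) acc (C accl) rl rest q"
  "scanB_left k n acc accl E rest q = scanB k (Suc n) acc accl E rest q"
  "scanB_left k n acc accl (B rl) rest (rt,lf) = scanB_left_verdict (match_right' Shut n lf rl (rt,accl)) k n acc (B accl) rl rest (rt,lf)"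
  by (simp_all add: scanB_def scanB_left_def scanB_left_verdict_def match_right'_def split: verdict.split)
lemma scanB_right_verdict_code [code]:
  "scanB_right_verdict Open k n acc accl restl rest q = Open"
  "scanB_right_verdict Shut k n acc accl restl rest q = Shut"
  "scanB_right_verdict Dead k n acc accl restl rest q = scanB_left k n acc accl restl rest q"
  by (simp_all add: scanB_right_verdict_def)
lemma scanB_left_verdict_code [code]:
  "scanB_left_verdict Open k n acc accl restl rest q = Open"
  "scanB_left_verdict Shut k n acc accl restl rest q = Shut"
  "scanB_left_verdict Dead k n acc accl restl rest q = scanB k (Suc n) acc accl restl rest q"
  by (simp_all add: scanB_left_verdict_def)
definition "scanC k n acc accl restl rest q = scan_periods k n Lc (of_cells (fst q)) (of_cells (snd q)) (of_cells acc) (of_cells rest) (of_cells accl) (of_cells restl)"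
definition "scanC_left k n acc accl restl rest q = (case match_period Lc n (of_cells restl) (of_cells (snd q)) (of_cells (fst q)) (of_cells accl) of Dead \<Rightarrow>
         scan_periods k (Suc n) Lc (of_cells (fst q)) (of_cells (snd q)) (of_cells acc) (of_cells rest) (take 1 (of_cells restl) @ of_cells accl) (tl (of_cells restl)) | v \<Rightarrow> v)"
definition "scanC_right_verdict v k n acc accl restl rest q = (case v of Dead \<Rightarrow> scanC_left k n acc accl restl rest q | v \<Rightarrow> v)"
definition "scanC_left_verdict v k n acc accl restl rest q = (case v of Dead \<Rightarrow> scanC k (Suc n) acc accl restl rest q | v \<Rightarrow> v)"
lemma scanC_code [code]:
  "scanC 0 n acc accl restl rest q = Dead"
  "scanC (Suc k) n acc accl restl (C r) (rt,lf) = scanC_right_verdict (match_right' Shut n rt r (lf,acc)) k n (C acc) accl restl r (rt,lf)"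
  "scanC (Suc k) n acc accl restl (U r) (rt,lf) = scanC_right_verdict (match_right' Open n rt r (lf,acc)) k n (U acc) accl restl r (rt,lf)"
  "scanC (Suc k) n acc accl (A rl) (A r) q = scanC k (Suc n) (A acc) (A accl) rl r q"
  "scanC (Suc k) n acc accl (B rl) (A r) q = scanC k (Suc n) (A acc) (B accl) rl r q"
  "scanC (Suc k) n acc accl E (A r) q = scanC k (Suc n) (A acc) accl E r q"
  "scanC (Suc k) n acc accl (C rl) (A r) (rt,lf) = scanC_left_verdict (match_right' Shut n lf rl (rt,accl)) k n (A acc) (C accl) rl r (rt,lf)"
  "scanC (Suc k) n acc accl (A rl) (B r) q = scanC k (Suc n) (B acc) (A accl) rl r q"
  "scanC (Suc k) n acc accl (B rl) (B r) q = scanC k (Suc n) (B acc) (B accl) rl r q"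
  "scanC (Suc k) n acc accl E (B r) q = scanC k (Suc n) (B acc) accl E r q"
  "scanC (Suc k) n acc accl (C rl) (B r) (rt,lf) = scanC_left_verdict (match_right' Shut n lf rl (rt,accl)) k n (B acc) (C accl) rl r (rt,lf)"
  "scanC (Suc k) n acc accl (A rl) E q = scanC k (Suc n) acc (A accl) rl E q"
  "scanC (Suc k) n acc accl (B rl) E q = scanC k (Suc n) acc (B accl) rl E q"
  "scanC (Suc k) n acc accl E E q = scanC k (Suc n) acc accl E E q"
  "scanC (Suc k) n acc accl (C rl) E (rt,lf) = scanC_left_verdict (match_right' Shut n lf rl (rt,accl)) k n acc (C accl) rl E (rt,lf)"
  by (simp_all add: scanC_def scanC_left_def scanC_right_verdict_def scanC_left_verdict_def match_right'_def split: verdict.split)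
lemma scanC_left_code [code]:
  "scanC_left k n acc accl (A rl) rest q = scanC k (Suc n) acc (A accl) rl rest q"
  "scanC_left k n acc accl (B rl) rest q = scanC k (Suc n) acc (B accl) rl rest q"
  "scanC_left k n acc accl E rest q = scanC k (Suc n) acc accl E rest q"
  "scanC_left k n acc accl (C rl) rest (rt,lf) = scanC_left_verdict (match_right' Shut n lf rl (rt,accl)) k n acc (C accl) rl rest (rt,lf)"
  by (simp_all add: scanC_def scanC_left_def scanC_left_verdict_def match_right'_def split: verdict.split)
lemma scanC_right_verdict_code [code]:
  "scanC_right_verdict Open k n acc accl restl rest q = Open"
  "scanC_right_verdict Shut k n acc accl restl rest q = Shut"
  "scanC_right_verdict Dead k n acc accl restl rest q = scanC_left k n acc accl restl rest q"
  by (simp_all add: scanC_right_verdict_def)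
lemma scanC_left_verdict_code [code]:
  "scanC_left_verdict Open k n acc accl restl rest q = Open"
  "scanC_left_verdict Shut k n acc accl restl rest q = Shut"
  "scanC_left_verdict Dead k n acc accl restl rest q = scanC k (Suc n) acc accl restl rest q"
  by (simp_all add: scanC_left_verdict_def)
definition "gap_verdict' k lf rt = gap_verdict k (of_cells lf) (of_cells rt)"
lemma gap_verdict'_code [code]:
  "gap_verdict' k E rt = Open"
  "gap_verdict' k (A lf) E = Open"
  "gap_verdict' k (A lf) (A rt) = Open"
  "gap_verdict' k (A lf) (B rt) = scanC k 0 (C E) (C E) (A lf) (B rt) (B rt, A lf)"
  "gap_verdict' k (A lf) (C rt) = scanB k 0 (B E) (B E) (A lf) (C rt) (C rt, A lf)"
  "gap_verdict' k (A lf) (U rt) = Open"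
  "gap_verdict' k (B lf) E = Open"
  "gap_verdict' k (B lf) (A rt) = scanC k 0 (C E) (C E) (B lf) (A rt) (A rt, B lf)"
  "gap_verdict' k (B lf) (B rt) = Open"
  "gap_verdict' k (B lf) (C rt) = scanA k 0 (A E) (A E) (B lf) (C rt) (C rt, B lf)"
  "gap_verdict' k (B lf) (U rt) = Open"
  "gap_verdict' k (C lf) E = Open"
  "gap_verdict' k (C lf) (A rt) = scanB k 0 (B E) (B E) (C lf) (A rt) (A rt, C lf)"
  "gap_verdict' k (C lf) (B rt) = scanA k 0 (A E) (A E) (C lf) (B rt) (B rt, C lf)"
  "gap_verdict' k (C lf) (C rt) = Open"
  "gap_verdict' k (C lf) (U rt) = Open"
  "gap_verdict' k (U lf) E = Open"
  "gap_verdict' k (U lf) (A rt) = Open"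
  "gap_verdict' k (U lf) (B rt) = Open"
  "gap_verdict' k (U lf) (C rt) = Open"
  "gap_verdict' k (U lf) (U rt) = Open"
  by (simp_all add: gap_verdict'_def scanA_def scanB_def scanC_def slot_verdict_def)

definition "visit' k l rt acc ps = visit k (of_cells l) (of_cells rt) acc ps"
definition "visit_verdict v k l rt acc ps = (case v of Dead \<Rightarrow> None
     | Shut \<Rightarrow> visit k (of_cells l) (of_cells rt) acc ps | Open \<Rightarrow> cons_option acc (visit k (of_cells l) (of_cells rt) 0 ps))"
lemma visit'_code [code]:
  "visit' k l rt acc [] = Some []"
  "visit' k E rt acc (p#ps) = Some []"
  "visit' k (A l) rt acc (Suc g#ps) = visit' k l (A rt) (Suc acc) (g#ps)"
  "visit' k (A l) rt acc (0#ps) = visit_verdict (gap_verdict' k (A l) rt) k (A l) rt acc ps"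
  "visit' k (B l) rt acc (Suc g#ps) = visit' k l (B rt) (Suc acc) (g#ps)"
  "visit' k (B l) rt acc (0#ps) = visit_verdict (gap_verdict' k (B l) rt) k (B l) rt acc ps"
  "visit' k (C l) rt acc (Suc g#ps) = visit' k l (C rt) (Suc acc) (g#ps)"
  "visit' k (C l) rt acc (0#ps) = visit_verdict (gap_verdict' k (C l) rt) k (C l) rt acc ps"
  "visit' k (U l) rt acc (Suc g#ps) = visit' k l (U rt) (Suc acc) (g#ps)"
  "visit' k (U l) rt acc (0#ps) = visit_verdict (gap_verdict' k (U l) rt) k (U l) rt acc ps"
  by (simp_all add: visit'_def visit_verdict_def gap_verdict'_def split: verdict.split)
lemma visit_verdict_code [code]:
  "visit_verdict Dead k l rt acc ps = None"
  "visit_verdict Shut k l rt acc ps = visit' k l rt acc ps"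
  "visit_verdict Open k l rt acc ps = cons_option acc (visit' k l rt 0 ps)"
  by (simp_all add: visit_verdict_def visit'_def)

definition "skip_visit' s k l rt ps = skip_visit s k (of_cells l) (of_cells rt) ps"
lemma skip_visit'_code [code]:
  "skip_visit' 0 k l rt ps = visit' k l rt 0 ps"
  "skip_visit' (Suc s) k E rt ps = Some []"
  "skip_visit' (Suc s) k (A l) rt ps = skip_visit' s k l (A rt) ps"
  "skip_visit' (Suc s) k (B l) rt ps = skip_visit' s k l (B rt) ps"
  "skip_visit' (Suc s) k (C l) rt ps = skip_visit' s k l (C rt) ps"
  "skip_visit' (Suc s) k (U l) rt ps = skip_visit' s k l (U rt) ps"
  by (simp_all add: skip_visit'_def visit'_def)

text \<open>The three letters are tested in one pass over the word. A flag that is already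
  \<open>True\<close> suppresses the comparisons for its letter; this also allows asking about a
  single letter.\<close>

definition "bans h n l ys a b c = (a \<or> makes_square La h n (of_cells l) (of_cells ys), b \<or> makes_square Lb h n (of_cells l) (of_cells ys), c \<or> makes_square Lc h n (of_cells l) (of_cells ys))"
lemma bans_code [code]:
  "bans 0 n l ys a b c = (a, b, c)"
  "bans h n l E a b c = (a, b, c)"
  "bans (Suc h) n l (A ys) True b c = bans h (Suc n) l ys True b c"
  "bans (Suc h) n l (B ys) a True c = bans h (Suc n) l ys a True c"
  "bans (Suc h) n l (C ys) a b True = bans h (Suc n) l ys a b True"
  "bans (Suc h) n l (A ys) False b c = bans h (Suc n) l ys (agree' n l ys) b c"
  "bans (Suc h) n l (B ys) a False c = bans h (Suc n) l ys a (agree' n l ys) c"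
  "bans (Suc h) n l (C ys) a b False = bans h (Suc n) l ys a b (agree' n l ys)"
  by (cases h, auto simp add: bans_def agree'_def)

definition "some_dead' k l rt = some_dead k (of_cells l) (of_cells rt)"
definition "some_dead_verdict v k l rt = (v = Dead \<or> some_dead' k l rt)"
lemma some_dead'_code [code]:
  "some_dead' k E rt = False"
  "some_dead' k (A l) rt = some_dead_verdict (gap_verdict' k (A l) rt) k l (A rt)"
  "some_dead' k (B l) rt = some_dead_verdict (gap_verdict' k (B l) rt) k l (B rt)"
  "some_dead' k (C l) rt = some_dead_verdict (gap_verdict' k (C l) rt) k l (C rt)"
  "some_dead' k (U l) rt = some_dead_verdict (gap_verdict' k (U l) rt) k l (U rt)"
  by (simp_all add: some_dead'_def some_dead_verdict_def gap_verdict'_def)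
lemma some_dead_verdict_code [code]:
  "some_dead_verdict Dead k l rt = True"
  "some_dead_verdict Open k l rt = some_dead' k l rt"
  "some_dead_verdict Shut k l rt = some_dead' k l rt"
  by (simp_all add: some_dead_verdict_def)

definition "allowed_length' l fs = allowed_length (of_cells l) fs"
lemma allowed_length'_code [code]:
  "allowed_length' E (f#fs) = f"
  "allowed_length' (A l) (f#fs) = allowed_length' l fs"
  "allowed_length' (B l) (f#fs) = allowed_length' l fs"
  "allowed_length' (C l) (f#fs) = allowed_length' l fs"
  "allowed_length' (U l) (f#fs) = allowed_length' l fs"
  by (simp_all add: allowed_length'_def)
definition "ends b k l = (b \<or> some_dead' k l E)"
lemma ends_code [code]:
  "ends True k l = True"
  "ends False k l = some_dead' k l E"
  by (simp_all add: ends_def)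

definition "search' e k s h h' ps l r = search (of_cells r) e k s ps (of_cells l) h h'"
definition "search_bans qs e k s h h' ps l r = (case qs of (qa,qb,qc) \<Rightarrow> if qa \<and> qb \<and> qc then allowed_length (of_cells l) allowed_table \<or> some_dead k (of_cells l) []
     else case of_cells r of [] \<Rightarrow> True | _ # r \<Rightarrow> 
       (qa \<or> search r e k (s-1) ps (Some La#of_cells l) h' (Suc h)) \<and> 
       (qb \<or> search r e k (s-1) ps (Some Lb#of_cells l) h' (Suc h)) \<and> 
       (qc \<or> search r e k (s-1) ps (Some Lc#of_cells l) h' (Suc h)))"
definition "search_gaps ps e k s h h' l r = (case ps of None \<Rightarrow> True | Some ps \<Rightarrow> search_bans (bans h' 0 l l False False False) e k s h h' ps l r)"
definition "branchA qs e k s h h' ps l r = (fst qs \<or> search' e k s h h' ps (A l) r)"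
definition "branchB qs e k s h h' ps l r = (fst (snd qs) \<or> search' e k s h h' ps (B l) r)"
definition "branchC qs e k s h h' ps l r = (snd (snd qs) \<or> search' e k s h h' ps (C l) r)"

lemma neg_code: "(\<not> True) = False" "(\<not> False) = True" by simp_all

lemma search'_code [code]:
  "search' True k (Suc s) h h' ps l (A r) = branchA (bans h' 0 l l False True True) False k s h' (Suc h) ps l r"
  "search' False k (Suc s) h h' ps l (A r) = branchA (bans h' 0 l l False True True) True k s h' (Suc h) ps l r"
  "search' True k (Suc s) h h' ps l (B r) = branchB (bans h' 0 l l True False True) False k s h' (Suc h) ps l r"
  "search' False k (Suc s) h h' ps l (B r) = branchB (bans h' 0 l l True False True) True k s h' (Suc h) ps l r"
  "search' True k (Suc s) h h' ps l (C r) = branchC (bans h' 0 l l True True False) False k s h' (Suc h) ps l r"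
  "search' False k (Suc s) h h' ps l (C r) = branchC (bans h' 0 l l True True False) True k s h' (Suc h) ps l r"
  "search' True k s h h' ps l E = search_gaps (skip_visit' s k l E (0#Suc 0#Suc 0#Suc 0#bump_head ps)) False k s h h' l E"
  "search' False k s h h' ps l E = search_bans (bans h' 0 l l False False False) True k s h h' ps l E"
  "search' True k s h h' ps l (U r) = search_gaps (skip_visit' s k l (U r) (0#Suc 0#Suc 0#Suc 0#bump_head ps)) False k s h h' l (U r)"
  "search' False k s h h' ps l (U r) = search_bans (bans h' 0 l l False False False) True k s h h' ps l (U r)"
  by (simp_all only: search.simps search'_def branchA_def branchB_def branchC_def search_gaps_def search_bans_def skip_visit'_def bans_def of_cells.simps diff_Suc_1
     simp_thms prod.case list.case fst_conv snd_conv option.case if_True if_False neg_code)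

lemma branchA_code [code]: "branchA (True, q) e k s h h' ps l r = True" "branchA (False, q) e k s h h' ps l r = search' e k s h h' ps (A l) r"
  by (simp_all add: branchA_def)
lemma branchB_code [code]: "branchB (p, True, q) e k s h h' ps l r = True" "branchB (p, False, q) e k s h h' ps l r = search' e k s h h' ps (B l) r"
  by (simp_all add: branchB_def)
lemma branchC_code [code]: "branchC (p, q, True) e k s h h' ps l r = True" "branchC (p, q, False) e k s h h' ps l r = search' e k s h h' ps (C l) r"
  by (simp_all add: branchC_def)

lemma search_gaps_code [code]:
  "search_gaps None e k s h h' l r = True"
  "search_gaps (Some ps) e k s h h' l r = search_bans (bans h' 0 l l False False False) e k s h h' ps l r"
  by (simp_all add: search_gaps_def)

lemma search_bans_code [code]:
  "search_bans (True, True, True) e k s h h' ps l r = ends (allowed_length' l allowed_table) k l"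
  "search_bans (True, True, False) e k s h h' ps l E = True"
  "search_bans (True, True, False) e k (Suc s) h h' ps l (U r) = (search' e k s h' (Suc h) ps (C l) r)"
  "search_bans (True, False, True) e k s h h' ps l E = True"
  "search_bans (True, False, True) e k (Suc s) h h' ps l (U r) = (search' e k s h' (Suc h) ps (B l) r)"
  "search_bans (True, False, False) e k s h h' ps l E = True"
  "search_bans (True, False, False) e k (Suc s) h h' ps l (U r) = (search' e k s h' (Suc h) ps (B l) r \<and> search' e k s h' (Suc h) ps (C l) r)"
  "search_bans (False, True, True) e k s h h' ps l E = True"
  "search_bans (False, True, True) e k (Suc s) h h' ps l (U r) = (search' e k s h' (Suc h) ps (A l) r)"
  "search_bans (False, True, False) e k s h h' ps l E = True"
  "search_bans (False, True, False) e k (Suc s) h h' ps l (U r) = (search' e k s h' (Suc h) ps (A l) r \<and> search' e k s h' (Suc h) ps (C l) r)"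
  "search_bans (False, False, True) e k s h h' ps l E = True"
  "search_bans (False, False, True) e k (Suc s) h h' ps l (U r) = (search' e k s h' (Suc h) ps (A l) r \<and> search' e k s h' (Suc h) ps (B l) r)"
  "search_bans (False, False, False) e k s h h' ps l E = True"
  "search_bans (False, False, False) e k (Suc s) h h' ps l (U r) = (search' e k s h' (Suc h) ps (A l) r \<and> search' e k s h' (Suc h) ps (B l) r \<and> search' e k s h' (Suc h) ps (C l) r)"
  by (simp_all add: search_bans_def search'_def ends_def allowed_length'_def some_dead'_def)

fun to_cells :: "pat \<Rightarrow> cells" where
 "to_cells [] = E" | "to_cells (None#x) = U (to_cells x)" | "to_cells (Some La#x) = A (to_cells x)" | "to_cells (Some Lb#x) = B (to_cells x)" | "to_cells (Some Lc#x) = C (to_cells x)"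
lemma of_cells_lc [simp]: "of_cells (to_cells x) = x" by (induction x rule: to_cells.induct) auto
lemma to_cells_cl [simp]: "to_cells (of_cells x) = x" by (induction x) auto
definition "fillA n r = to_cells (fill_at n La (of_cells r))"
definition "fillB n r = to_cells (fill_at n Lb (of_cells r))"
definition "fillC n r = to_cells (fill_at n Lc (of_cells r))"
lemma fillA_code [code]:
  "fillA n E = E"
  "fillA 0 (A r) = A r"
  "fillA (Suc n) (A r) = A (fillA n r)"
  "fillA 0 (B r) = A r"
  "fillA (Suc n) (B r) = B (fillA n r)"
  "fillA 0 (C r) = A r"
  "fillA (Suc n) (C r) = C (fillA n r)"
  "fillA 0 (U r) = A r"
  "fillA (Suc n) (U r) = U (fillA n r)"
  by (simp_all add: fillA_def)
lemma fillB_code [code]: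
  "fillB n E = E"
  "fillB 0 (A r) = B r"
  "fillB (Suc n) (A r) = A (fillB n r)"
  "fillB 0 (B r) = B r"
  "fillB (Suc n) (B r) = B (fillB n r)"
  "fillB 0 (C r) = B r"
  "fillB (Suc n) (C r) = C (fillB n r)"
  "fillB 0 (U r) = B r"
  "fillB (Suc n) (U r) = U (fillB n r)"
  by (simp_all add: fillB_def)
lemma fillC_code [code]:
  "fillC n E = E"
  "fillC 0 (A r) = C r"
  "fillC (Suc n) (A r) = A (fillC n r)"
  "fillC 0 (B r) = C r"
  "fillC (Suc n) (B r) = B (fillC n r)"
  "fillC 0 (C r) = C r"
  "fillC (Suc n) (C r) = C (fillC n r)"
  "fillC 0 (U r) = C r"
  "fillC (Suc n) (U r) = U (fillC n r)"
  by (simp_all add: fillC_def)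

definition "rev_append l r = to_cells (rev (of_cells l) @ of_cells r)"
lemma rev_append_code [code]:
  "rev_append E r = r"
  "rev_append (A l) r = rev_append l (A r)"
  "rev_append (B l) r = rev_append l (B r)"
  "rev_append (C l) r = rev_append l (C r)"
  "rev_append (U l) r = rev_append l (U r)"
  by (simp_all add: rev_append_def)

section \<open>Evaluating the choice of the repeated prefix\<close>

definition "choose_prefix' us e0 k f z s h h' ps l lb r = choose_prefix us e0 k f z s ps (of_cells l) (of_cells lb) (of_cells r) h h'"
definition "choose_with' qs u e us e0 k f z s h h' ps l lb r = (case qs of (a,b,c) \<Rightarrow> 
    (choose_with a La u e us e0 k f z s ps (of_cells l) (of_cells lb) (fill_at f La (of_cells r)) h h' \<and>
     choose_with b Lb u e us e0 k f z s ps (of_cells l) (of_cells lb) (fill_at f Lb (of_cells r)) h h' \<and>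
     choose_with c Lc u e us e0 k f z s ps (of_cells l) (of_cells lb) (fill_at f Lc (of_cells r)) h h'))"
definition "choose_slot' u e us e0 k f z s h h' ps l lb r = 
    ((u \<and> slot_verdict z f [] (rev (of_cells l) @ of_cells r) = Dead) \<or>
     (case (if e then skip_visit near k (of_cells l) (of_cells r) (0#Suc 0#bump_head ps) else Some ps) of None \<Rightarrow> True
      | Some ps \<Rightarrow> choose_prefix us e0 k f z s ps (of_cells l) (of_cells lb) (of_cells r) h' (Suc h)))"
definition "choose_verdict' v e us e0 k f z s h h' ps l lb r = 
    (v = Dead \<or>
     (case (if e then skip_visit near k (of_cells l) (of_cells r) (0#Suc 0#bump_head ps) else Some ps) of None \<Rightarrow> True
      | Some ps \<Rightarrow> choose_prefix us e0 k f z s ps (of_cells l) (of_cells lb) (of_cells r) h' (Suc h)))"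
definition "choose_gaps' x us e0 k f z s h h' l lb r = 
     (case x of None \<Rightarrow> True
      | Some ps \<Rightarrow> choose_prefix us e0 k f z s ps (of_cells l) (of_cells lb) (of_cells r) h' (Suc h))"
definition "front_verdict z f rt = slot_verdict z f [] (of_cells rt)"
lemma front_verdict_code [code]:
  "front_verdict La f rt = scanA f 0 (A E) (A E) E rt (rt,E)"
  "front_verdict Lb f rt = scanB f 0 (B E) (B E) E rt (rt,E)"
  "front_verdict Lc f rt = scanC f 0 (C E) (C E) E rt (rt,E)"
  by (simp_all add: front_verdict_def slot_verdict_def scanA_def scanB_def scanC_def)

lemma choose_prefix'_code [code]:
  "choose_prefix' [] e0 k f z s h h' ps l lb r = search' e0 k s h h' all_gaps l r"
  "choose_prefix' ((u,e)#us) e0 k f z s h h' ps l lb (U r) = choose_with' (bans (Suc h) 0 lb lb False False False) u e us e0 k f z s h h' ps l lb r"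
  by (simp_all add: choose_prefix'_def choose_with'_def search'_def bans_def choose_prefix_simps)

lemma choose_with'_code [code]:
  "choose_with' (True, True, True) u e us e0 k f z s h h' ps l lb r = True"
  "choose_with' (True, True, False) u e us e0 k f z (Suc s) h h' ps l lb r = (choose_slot' u e us e0 k f z s h h' ps (C l) (C lb) (fillC f r))"
  "choose_with' (True, False, True) u e us e0 k f z (Suc s) h h' ps l lb r = (choose_slot' u e us e0 k f z s h h' ps (B l) (B lb) (fillB f r))"
  "choose_with' (True, False, False) u e us e0 k f z (Suc s) h h' ps l lb r = (choose_slot' u e us e0 k f z s h h' ps (B l) (B lb) (fillB f r) \<and> choose_slot' u e us e0 k f z s h h' ps (C l) (C lb) (fillC f r))"
  "choose_with' (False, True, True) u e us e0 k f z (Suc s) h h' ps l lb r = (choose_slot' u e us e0 k f z s h h' ps (A l) (A lb) (fillA f r))"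
  "choose_with' (False, True, False) u e us e0 k f z (Suc s) h h' ps l lb r = (choose_slot' u e us e0 k f z s h h' ps (A l) (A lb) (fillA f r) \<and> choose_slot' u e us e0 k f z s h h' ps (C l) (C lb) (fillC f r))"
  "choose_with' (False, False, True) u e us e0 k f z (Suc s) h h' ps l lb r = (choose_slot' u e us e0 k f z s h h' ps (A l) (A lb) (fillA f r) \<and> choose_slot' u e us e0 k f z s h h' ps (B l) (B lb) (fillB f r))"
  "choose_with' (False, False, False) u e us e0 k f z (Suc s) h h' ps l lb r = (choose_slot' u e us e0 k f z s h h' ps (A l) (A lb) (fillA f r) \<and> choose_slot' u e us e0 k f z s h h' ps (B l) (B lb) (fillB f r) \<and> choose_slot' u e us e0 k f z s h h' ps (C l) (C lb) (fillC f r))"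
  by (simp_all add: choose_with'_def choose_with_def choose_slot'_def fillA_def fillB_def fillC_def split: option.split)

lemma choose_verdict'_code [code]:
  "choose_verdict' Dead e us e0 k f z s h h' ps l lb r = True"
  "choose_verdict' Open False us e0 k f z s h h' ps l lb r = choose_prefix' us e0 k f z s h' (Suc h) ps l lb r"
  "choose_verdict' Shut False us e0 k f z s h h' ps l lb r = choose_prefix' us e0 k f z s h' (Suc h) ps l lb r"
  "choose_verdict' Open True us e0 k f z s h h' ps l lb r = choose_gaps' (skip_visit' near k l r (0#Suc 0#bump_head ps)) us e0 k f z s h h' l lb r"
  "choose_verdict' Shut True us e0 k f z s h h' ps l lb r = choose_gaps' (skip_visit' near k l r (0#Suc 0#bump_head ps)) us e0 k f z s h h' l lb r"
  by (simp_all add: choose_verdict'_def choose_gaps'_def choose_prefix'_def skip_visit'_def)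
lemma choose_slot'_code [code]:
  "choose_slot' False e us e0 k f z s h h' ps l lb r = choose_verdict' Open e us e0 k f z s h h' ps l lb r"
  "choose_slot' True e us e0 k f z s h h' ps l lb r = choose_verdict' (front_verdict z f (rev_append l r)) e us e0 k f z s h h' ps l lb r"
  by (simp_all add: choose_slot'_def choose_verdict'_def front_verdict_def rev_append_def)
lemma choose_gaps'_code [code]:
  "choose_gaps' None us e0 k f z s h h' l lb r = True"
  "choose_gaps' (Some ps) us e0 k f z s h h' l lb r = choose_prefix' us e0 k f z s h' (Suc h) ps l lb r"
  by (simp_all add: choose_gaps'_def choose_prefix'_def)

definition unknowns :: "nat \<Rightarrow> cells \<Rightarrow> cells" where "unknowns n r = (U ^^ n) r"
lemma unknowns_code[code]: "unknowns 0 r = r" "unknowns (Suc n) r = U (unknowns n r)" by (simp_all add: unknowns_def)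
lemma of_cells_unknowns: "of_cells (unknowns n r) = replicate n None @ of_cells r" by (induction n) (simp_all add: unknowns_def)
lemma search_run_code [code]: 
 "search_run F Lb z = choose_prefix' (schedule F) (even F) 43 (F-1) z 85 1 1 [] (B (A E)) (B (A (B E))) (unknowns (F-3) (B (A (B (unknowns (F-3) (unknowns (87-2*F) E))))))"
 "search_run F Lc z = choose_prefix' (schedule F) (even F) 43 (F-1) z 85 1 1 [] (B (A E)) (B (A (C E))) (unknowns (F-3) (C (A (B (unknowns (F-3) (unknowns (87-2*F) E))))))"
  by (simp_all add: search_run_def choose_prefix'_def of_cells_unknowns)

section \<open>The runs for all periods from 4 to 43\<close>

lemma search_run_4: "search_run 4 Lb Lc" "search_run 4 Lc Lb"
  by code_simp+

lemma search_run_5: "search_run 5 Lb Lc" "search_run 5 Lc Lb"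
  by code_simp+

lemma search_run_6: "search_run 6 Lb Lc" "search_run 6 Lc Lb"
  by code_simp+

lemma search_run_7: "search_run 7 Lb Lc" "search_run 7 Lc Lb"
  by code_simp+

lemma search_run_8: "search_run 8 Lb Lc" "search_run 8 Lc Lb"
  by code_simp+

lemma search_run_9: "search_run 9 Lb Lc" "search_run 9 Lc Lb"
  by code_simp+

lemma search_run_10: "search_run 10 Lb Lc" "search_run 10 Lc Lb"
  by code_simp+

lemma search_run_11: "search_run 11 Lb Lc" "search_run 11 Lc Lb"
  by code_simp+

lemma search_run_12: "search_run 12 Lb Lc" "search_run 12 Lc Lb"
  by code_simp+

lemma search_run_13: "search_run 13 Lb Lc" "search_run 13 Lc Lb"
  by code_simp+

lemma search_run_14: "search_run 14 Lb Lc" "search_run 14 Lc Lb"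
  by code_simp+

lemma search_run_15: "search_run 15 Lb Lc" "search_run 15 Lc Lb"
  by code_simp+

lemma search_run_16: "search_run 16 Lb Lc" "search_run 16 Lc Lb"
  by code_simp+

lemma search_run_17: "search_run 17 Lb Lc" "search_run 17 Lc Lb"
  by code_simp+

lemma search_run_18: "search_run 18 Lb Lc" "search_run 18 Lc Lb"
  by code_simp+

lemma search_run_19: "search_run 19 Lb Lc" "search_run 19 Lc Lb"
  by code_simp+

lemma search_run_20: "search_run 20 Lb Lc" "search_run 20 Lc Lb"
  by code_simp+

lemma search_run_21: "search_run 21 Lb Lc" "search_run 21 Lc Lb"
  by code_simp+

lemma search_run_22: "search_run 22 Lb Lc" "search_run 22 Lc Lb"
  by code_simp+

lemma search_run_23: "search_run 23 Lb Lc" "search_run 23 Lc Lb"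
  by code_simp+

lemma search_run_24: "search_run 24 Lb Lc" "search_run 24 Lc Lb"
  by code_simp+

lemma search_run_25: "search_run 25 Lb Lc" "search_run 25 Lc Lb"
  by code_simp+

lemma search_run_26: "search_run 26 Lb Lc" "search_run 26 Lc Lb"
  by code_simp+

lemma search_run_27: "search_run 27 Lb Lc" "search_run 27 Lc Lb"
  by code_simp+

lemma search_run_28: "search_run 28 Lb Lc" "search_run 28 Lc Lb"
  by code_simp+

lemma search_run_29: "search_run 29 Lb Lc" "search_run 29 Lc Lb"
  by code_simp+

lemma search_run_30: "search_run 30 Lb Lc" "search_run 30 Lc Lb"
  by code_simp+

lemma search_run_31: "search_run 31 Lb Lc" "search_run 31 Lc Lb"
  by code_simp+

lemma search_run_32: "search_run 32 Lb Lc" "search_run 32 Lc Lb"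
  by code_simp+

lemma search_run_33: "search_run 33 Lb Lc" "search_run 33 Lc Lb"
  by code_simp+

lemma search_run_34: "search_run 34 Lb Lc" "search_run 34 Lc Lb"
  by code_simp+

lemma search_run_35: "search_run 35 Lb Lc" "search_run 35 Lc Lb"
  by code_simp+

lemma search_run_36: "search_run 36 Lb Lc" "search_run 36 Lc Lb"
  by code_simp+

lemma search_run_37: "search_run 37 Lb Lc" "search_run 37 Lc Lb"
  by code_simp+

lemma search_run_38: "search_run 38 Lb Lc" "search_run 38 Lc Lb"
  by code_simp+

lemma search_run_39: "search_run 39 Lb Lc" "search_run 39 Lc Lb"
  by code_simp+

lemma search_run_40: "search_run 40 Lb Lc" "search_run 40 Lc Lb"
  by code_simp+

lemma search_run_41: "search_run 41 Lb Lc" "search_run 41 Lc Lb"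
  by code_simp+

lemma search_run_42: "search_run 42 Lb Lc" "search_run 42 Lc Lb"
  by code_simp+

lemma search_run_43: "search_run 43 Lb Lc" "search_run 43 Lc Lb"
  by code_simp+

lemma all_search_runs:
  assumes "4 \<le> F" "F \<le> 43" shows "search_run F Lb Lc \<and> search_run F Lc Lb"
proof -
  have "list_all (\<lambda>F. search_run F Lb Lc \<and> search_run F Lc Lb) [4..<44]"
    by (simp add: upt_conv_Cons

      search_run_4 search_run_5 search_run_6 search_run_7 search_run_8 search_run_9 search_run_10 search_run_11
      search_run_12 search_run_13 search_run_14 search_run_15 search_run_16 search_run_17 search_run_18 search_run_19
      search_run_20 search_run_21 search_run_22 search_run_23 search_run_24 search_run_25 search_run_26 search_run_27
      search_run_28 search_run_29 search_run_30 search_run_31 search_run_32 search_run_33 search_run_34 search_run_35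
      search_run_36 search_run_37 search_run_38 search_run_39 search_run_40 search_run_41 search_run_42 search_run_43)
  moreover have "F \<in> set [4..<44]" unfolding set_upt atLeastLessThan_iff using assms by simp
  ultimately show ?thesis unfolding list_all_iff by blast
qed



section \<open>Certificates for explicit words\<close>

lemma match_left_ShutD:
  assumes "match_left d n (map Some xs) (map Some ys) = Shut"
  shows "d = Shut \<and> n \<le> length xs \<and> n \<le> length ys \<and> (\<forall>t<n. xs ! t = ys ! t)"
  using assms
proof (induction n arbitrary: xs ys)
  case (Suc n)
  then show ?case by (cases xs; cases ys) (auto simp: nth_Cons split: if_splits nat.splits)
qed simp

text \<open>On known letters the verdict \<open>Shut\<close> is exact; the witness \<open>a\<close>
  is the number of agreements after which the greedy run turned to the left.\<close>

lemma match_right_ShutD: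
  assumes "match_right d n (map Some xs) (map Some ys) (map Some lf) (map Some acc) = Shut"
  shows "\<exists>a\<le>n. a \<le> length xs \<and> a \<le> length ys \<and> (\<forall>t<a. xs ! t = ys ! t) \<and>
    n - a \<le> length lf \<and> n - a \<le> length acc \<and> (\<forall>t<n-a. lf ! t = acc ! t)"
  using assms
proof (induction n arbitrary: xs ys)
  case (Suc n)
  show ?case
  proof (cases "xs \<noteq> [] \<and> ys \<noteq> [] \<and> hd xs = hd ys")
    case True
    then obtain u xs' ys' where c: "xs = u # xs'" "ys = u # ys'" by (cases xs; cases ys) auto
    then have "match_right d n (map Some xs') (map Some ys') (map Some lf) (map Some acc) = Shut"
      using Suc.prems by simp
    from Suc.IH[OF this] obtain a where "a\<le>n" "a \<le> length xs'" "a \<le> length ys'" "\<forall>t<a. xs' ! t = ys' ! t"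
      "n - a \<le> length lf" "n - a \<le> length acc" "\<forall>t<n-a. lf ! t = acc ! t" by blast
    then show ?thesis by (intro exI[of _ "Suc a"]) (auto simp: c nth_Cons split: nat.splits)
  next
    case False
    then have "match_left d (Suc n) (map Some lf) (map Some acc) = Shut"
      using Suc.prems by (cases xs; cases ys) (auto split: if_splits)
    from match_left_ShutD[OF this] show ?thesis by (intro exI[of _ 0]) auto
  qed
qed (auto dest: match_left_ShutD)

lemma match_period_ShutD:
  assumes "match_period z n (map Some (drop n R)) (map Some R) (map Some L) (map Some (rev (take (Suc n) (z # R)))) = Shut"
  shows "half_square z (Suc n) L R"
proof -
  have n: "n < length R" using assms by (cases "n < length R") auto
  have d: "drop n R = R ! n # drop (Suc n) R" using n by (simp add: Cons_nth_drop_Suc)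
  have z: "R ! n = z" and
    f: "match_right Shut n (map Some R) (map Some (drop (Suc n) R)) (map Some L) (map Some (rev (take (Suc n) (z # R)))) = Shut"
    using assms unfolding d by (auto split: if_splits)
  from match_right_ShutD[OF f] obtain a where a: "a \<le> n" "a \<le> length R - Suc n" "\<forall>t<a. R ! t = drop (Suc n) R ! t"
    "n - a \<le> length L" and e: "\<forall>t<n - a. L ! t = rev (take (Suc n) (z # R)) ! t"
    by auto
  have e: "L ! t = (z # R) ! (n - t)" if "t < n - a" for t
    using e that n by (simp add: rev_nth min_def nth_Cons' del: take_Suc_Cons rev.simps)
  show ?thesis unfolding half_square_def
  proof (intro exI conjI allI impI)
    show "0 < Suc a" "Suc a + (n - a) = Suc n" "Suc n + Suc a \<le> Suc (length R)" "n - a \<le> length L"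
      using a n by auto
    show "(z # R) ! t = (z # R) ! (Suc n + t)" if "t < Suc a" for t
      using that a(2,3) z by (cases t) auto
    show "L ! t = (z # R) ! (Suc n - 1 - t)" if "t < n - a" for t using e[OF that] by simp
  qed
qed

lemma scan_periods_ShutD:
  assumes "scan_periods k n z (map Some R) (map Some L) (map Some (rev (take (Suc n) (z # R)))) (map Some (drop n R))
    (map Some (rev (take (Suc n) (z # L)))) (map Some (drop n L)) = Shut"
  shows "\<exists>p. half_square z p L R \<or> half_square z p R L"
  using assms
proof (induction k arbitrary: n)
  case (Suc k)
  show ?case
  proof (rule ccontr)
    assume n: "\<not> ?thesis"
    have "scan_periods k (Suc n) z (map Some R) (map Some L) (take 1 (map Some (drop n R)) @ map Some (rev (take (Suc n) (z # R)))) (tl (map Some (drop n R)))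
     (take 1 (map Some (drop n L)) @ map Some (rev (take (Suc n) (z # L)))) (tl (map Some (drop n L))) = Shut"
      using Suc.prems match_period_ShutD[of z n R L] match_period_ShutD[of z n L R] n
      by (auto simp del: take_Suc_Cons rev.simps split: verdict.splits)
    then have "scan_periods k (Suc n) z (map Some R) (map Some L) (map Some (rev (take (Suc (Suc n)) (z # R)))) (map Some (drop (Suc n) R))
     (map Some (rev (take (Suc (Suc n)) (z # L)))) (map Some (drop (Suc n) L)) = Shut"
      unfolding take_Suc_drop[symmetric] map_append take_map[symmetric] map_tl[symmetric] tl_drop drop_Suc by simp
    then show False using Suc.IH n by blast
  qed
qed simp

lemma slot_verdict_ShutD:
  assumes "slot_verdict z k (map Some L) (map Some R) = Shut"
  shows "\<not> square_free (rev L @ z # R)"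
proof -
  have "\<exists>p. half_square z p L R \<or> half_square z p R L"
    by (rule scan_periods_ShutD[of k 0]) (use assms in \<open>simp add: slot_verdict_def\<close>)
  then show ?thesis
  proof (elim exE disjE)
    fix p assume "half_square z p R L"
    then have "\<not> square_free (rev R @ z # L)" by (rule half_square_imp_square)
    then have "\<not> square_free (rev (rev R @ z # L))" by (simp only: square_free_rev) simp
    then show ?thesis by simp
  qed (rule half_square_imp_square)
qed

definition blocked :: "'a list \<Rightarrow> nat \<Rightarrow> bool" where
  "blocked w i \<longleftrightarrow> (\<forall>z. \<not> square_free (take i w @ z # drop i w))"

lemma stuck_iff_blocked: "stuck w \<longleftrightarrow> square_free w \<and> (\<forall>i\<le>length w. blocked w i)"
proof -
  have "(\<forall>u v z. w = u @ v \<longrightarrow> \<not> square_free (u @ z # v)) \<longleftrightarrow> (\<forall>i\<le>length w. blocked w i)"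
    unfolding blocked_def
    by (metis append_eq_conv_conj append_take_drop_id length_append le_add1)
  then show ?thesis by (auto simp: stuck_def)
qed

lemma blocked_zipper: "blocked (rev L @ R) (length L) \<longleftrightarrow> (\<forall>z. \<not> square_free (rev L @ z # R))"
  by (simp add: blocked_def)

definition closed_slot :: "nat \<Rightarrow> letter list \<Rightarrow> letter list \<Rightarrow> bool" where
  "closed_slot k L R \<longleftrightarrow> (\<forall>z. take 1 L = [z] \<or> take 1 R = [z] \<or> slot_verdict z k (map Some L) (map Some R) = Shut)"

lemma not_square_free_repeat: "\<not> square_free (u @ z # z # v)"
proof -
  have "square_at (u @ z # z # v) (length u) 1" by (simp add: square_at_def nth_append)
  then show ?thesis by (auto simp: square_free_iff)
qed

lemma closed_slot_blocked: "closed_slot k L R \<Longrightarrow> blocked (rev L @ R) (length L)"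
  unfolding blocked_zipper
proof
  fix z assume a: "closed_slot k L R"
  then consider "take 1 L = [z]" | "take 1 R = [z]" | "slot_verdict z k (map Some L) (map Some R) = Shut"
    by (auto simp: closed_slot_def)
  then show "\<not> square_free (rev L @ z # R)"
  proof cases
    case 1
    then show ?thesis using not_square_free_repeat[of "rev (tl L)" z R] by (cases L) auto
  next
    case 2
    then show ?thesis using not_square_free_repeat[of "rev L" z "tl R"] by (cases R) auto
  qed (rule slot_verdict_ShutD)
qed

fun closed_from :: "nat \<Rightarrow> nat \<Rightarrow> letter list \<Rightarrow> letter list \<Rightarrow> bool" where
  "closed_from k 0 L R = True"
| "closed_from k (Suc n) L [] = closed_slot k L []"
| "closed_from k (Suc n) L (x#R) = (closed_slot k L (x#R) \<and> closed_from k n (x#L) R)"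

lemma closed_from_blocked:
  assumes "closed_from k n L R" "length L \<le> i" "i < length L + n" "i \<le> length L + length R"
  shows "blocked (rev L @ R) i"
  using assms
proof (induction n arbitrary: L R)
  case (Suc n)
  have "blocked (rev L @ R) (length L)" using closed_slot_blocked[of k L R] Suc.prems(1) by (cases R) auto
  moreover have ?case if "i \<noteq> length L"
  proof (cases R)
    case (Cons x R')
    then show ?thesis using Suc.IH[of "x # L" R'] Suc.prems that by simp
  qed (use Suc.prems that in simp)
  ultimately show ?case by blast
qed simp

definition closed_range :: "nat \<Rightarrow> nat \<Rightarrow> letter list \<Rightarrow> bool" where
  "closed_range s n w = closed_from (length w) n (rev (take s w)) (drop s w)"

lemma closed_range_blocked:
  assumes "closed_range s n w" "s \<le> i" "i < s + n" "i \<le> length w" shows "blocked w i"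
  using closed_from_blocked[OF assms(1)[unfolded closed_range_def], of i] assms by simp

text \<open>The word is built letter by letter, so each step has to look only for squares that end
  in the new letter.\<close>

fun free_from :: "letter list \<Rightarrow> letter list \<Rightarrow> nat \<Rightarrow> nat \<Rightarrow> bool" where
  "free_from [] l h h' = True"
| "free_from (c#r) l h h' = (\<not> makes_square c h' 0 (map Some l) (map Some l) \<and> free_from r (c#l) h' (Suc h))"

lemma free_from_square_free:
  assumes "free_from r l h h'" "square_free l" "length l div 2 \<le> h" "Suc (length l) div 2 \<le> h'"
  shows "square_free (rev l @ r)"
  using assms
proof (induction r arbitrary: l h h')
  case (Cons c r)
  have "square_free (c # l)" by (rule not_sqr_square_free[OF Cons.prems(2)]) (use Cons.prems in auto)
  then have "square_free (rev (c # l) @ r)" by (intro Cons.IH[of _ h' "Suc h"]) (use Cons.prems in auto)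
  then show ?case by simp
qed simp

definition squarefree_test :: "letter list \<Rightarrow> bool" where "squarefree_test w = free_from w [] 0 0"

lemma squarefree_test_sound: "squarefree_test w \<Longrightarrow> square_free w"
  using free_from_square_free[of w "[]" 0 0] by (simp add: squarefree_test_def square_free_def)

section \<open>Occurrences of a factor\<close>

fun occurs_in :: "nat \<Rightarrow> pat \<Rightarrow> pat \<Rightarrow> bool" where
  "occurs_in n q [] = agree n q []"
| "occurs_in n q (x#w) = (agree n q (x#w) \<or> occurs_in n q w)"

definition occurs_at :: "'a list \<Rightarrow> 'a list \<Rightarrow> nat \<Rightarrow> bool" where
  "occurs_at q w j \<longleftrightarrow> j + length q \<le> length w \<and> (\<forall>s<length q. w ! (j + s) = q ! s)"

definition avoids :: "letter list \<Rightarrow> letter list \<Rightarrow> bool" where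
  "avoids q w \<longleftrightarrow> \<not> occurs_in (length q) (map Some q) (map Some w)"

lemma occurs_in_iff: "occurs_in (length q) (map Some q) (map Some w) \<longleftrightarrow> (\<exists>j. occurs_at q w j)"
proof (induction w)
  case Nil
  then show ?case by (auto simp: occurs_at_def agree_iff)
next
  case (Cons x w)
  have "occurs_at q (x # w) 0 \<longleftrightarrow> take (length q) (x # w) = q \<and> length q \<le> Suc (length w)"
    by (auto simp: occurs_at_def list_eq_iff_nth_eq simp del: take_Suc_Cons)
  also have "\<dots> \<longleftrightarrow> agree (length q) (map Some q) (map Some (x # w))"
    unfolding agree_iff take_map length_map inj_map_eq_map[OF inj_Some] by auto
  finally have 1: "occurs_at q (x # w) 0 \<longleftrightarrow> agree (length q) (map Some q) (map Some (x # w))" .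
  have 2: "occurs_at q (x # w) (Suc j) \<longleftrightarrow> occurs_at q w j" for j by (auto simp: occurs_at_def)
  have "(\<exists>j. occurs_at q (x # w) j) \<longleftrightarrow> occurs_at q (x # w) 0 \<or> (\<exists>j. occurs_at q (x # w) (Suc j))"
    by (metis not0_implies_Suc)
  then show ?case using Cons.IH 1 2 by simp
qed

lemma avoids_iff: "avoids q w \<longleftrightarrow> (\<forall>j. \<not> occurs_at q w j)"
  by (simp add: avoids_def occurs_in_iff)

section \<open>Evaluation of the certificates\<close>

fun word_cells :: "letter list \<Rightarrow> cells" where
  "word_cells [] = E" | "word_cells (La#w) = A (word_cells w)" | "word_cells (Lb#w) = B (word_cells w)" | "word_cells (Lc#w) = C (word_cells w)"
lemma of_cells_lcs [simp]: "of_cells (word_cells w) = map Some w" by (induction w rule: word_cells.induct) auto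

definition shut :: "verdict \<Rightarrow> bool" where "shut v = (v = Shut)"
lemma shut_code [code]: "shut Shut = True" "shut Dead = False" "shut Open = False" by (simp_all add: shut_def)
definition "closed_slot' k l r = (\<forall>z. take 1 (of_cells l) = [Some z] \<or> take 1 (of_cells r) = [Some z] \<or> slot_verdict z k (of_cells l) (of_cells r) = Shut)"
definition "shutA k l r = shut (scanA k 0 (A E) (A E) l r (r,l))"
definition "shutB k l r = shut (scanB k 0 (B E) (B E) l r (r,l))"
definition "shutC k l r = shut (scanC k 0 (C E) (C E) l r (r,l))"

lemma closed_slot'_code [code]:
  "closed_slot' k E E = (shutA k E E \<and> shutB k E E \<and> shutC k E E)"
  "closed_slot' k E (A r) = (shutB k E (A r) \<and> shutC k E (A r))"
  "closed_slot' k E (B r) = (shutA k E (B r) \<and> shutC k E (B r))"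
  "closed_slot' k E (C r) = (shutA k E (C r) \<and> shutB k E (C r))"
  "closed_slot' k (A l) E = (shutB k (A l) E \<and> shutC k (A l) E)"
  "closed_slot' k (A l) (A r) = (shutB k (A l) (A r) \<and> shutC k (A l) (A r))"
  "closed_slot' k (A l) (B r) = (shutC k (A l) (B r))"
  "closed_slot' k (A l) (C r) = (shutB k (A l) (C r))"
  "closed_slot' k (B l) E = (shutA k (B l) E \<and> shutC k (B l) E)"
  "closed_slot' k (B l) (A r) = (shutC k (B l) (A r))"
  "closed_slot' k (B l) (B r) = (shutA k (B l) (B r) \<and> shutC k (B l) (B r))"
  "closed_slot' k (B l) (C r) = (shutA k (B l) (C r))"
  "closed_slot' k (C l) E = (shutA k (C l) E \<and> shutB k (C l) E)"
  "closed_slot' k (C l) (A r) = (shutB k (C l) (A r))"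
  "closed_slot' k (C l) (B r) = (shutA k (C l) (B r))"
  "closed_slot' k (C l) (C r) = (shutA k (C l) (C r) \<and> shutB k (C l) (C r))"
  by (simp_all add: closed_slot'_def all_letter shutA_def shutB_def shutC_def shut_def scanA_def scanB_def scanC_def slot_verdict_def)

lemma closed_slot_cells: "closed_slot' k (word_cells L) (word_cells R) = closed_slot k L R"
  by (cases L; cases R) (simp_all add: closed_slot'_def closed_slot_def)

fun closed_cells :: "nat \<Rightarrow> nat \<Rightarrow> cells \<Rightarrow> cells \<Rightarrow> bool" where
  "closed_cells k 0 l r = True"
| "closed_cells k (Suc n) l E = closed_slot' k l E"
| "closed_cells k (Suc n) l (A r) = (closed_slot' k l (A r) \<and> closed_cells k n (A l) r)"
| "closed_cells k (Suc n) l (B r) = (closed_slot' k l (B r) \<and> closed_cells k n (B l) r)"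
| "closed_cells k (Suc n) l (C r) = (closed_slot' k l (C r) \<and> closed_cells k n (C l) r)"
| "closed_cells k (Suc n) l (U r) = False"

lemma closed_cells_iff: "closed_cells k n (word_cells L) (word_cells R) = closed_from k n L R"
proof (induction k n L R rule: closed_from.induct)
  case (2 k n L)
  then show ?case using closed_slot_cells[of k L "[]"] by simp
next
  case (3 k n L x R)
  then show ?case using closed_slot_cells[of k L "x # R"] by (cases x) simp_all
qed simp

fun admits :: "bool \<times> bool \<times> bool \<Rightarrow> bool" where "admits (a, b, c) = (\<not> (a \<and> b \<and> c))"
fun free_cells :: "cells \<Rightarrow> cells \<Rightarrow> nat \<Rightarrow> nat \<Rightarrow> bool" where
  "free_cells E l h h' = True"
| "free_cells (A r) l h h' = (admits (bans h' 0 l l False True True) \<and> free_cells r (A l) h' (Suc h))"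
| "free_cells (B r) l h h' = (admits (bans h' 0 l l True False True) \<and> free_cells r (B l) h' (Suc h))"
| "free_cells (C r) l h h' = (admits (bans h' 0 l l True True False) \<and> free_cells r (C l) h' (Suc h))"
| "free_cells (U r) l h h' = False"

lemma free_cells_iff: "free_cells (word_cells r) (word_cells l) h h' = free_from r l h h'"
proof (induction r l h h' rule: free_from.induct)
  case (2 c r l h h')
  then show ?case by (cases c) (simp_all add: bans_def)
qed simp

lemma squarefree_test_code [code]: "squarefree_test w = free_cells (word_cells w) E 0 0"
  using free_cells_iff[of w "[]"] by (simp add: squarefree_test_def)

lemma closed_range_code [code]:
  "closed_range s n w = closed_cells (length w) n (word_cells (rev (take s w))) (word_cells (drop s w))"
  by (simp add: closed_range_def closed_cells_iff)

fun occurs_in' :: "nat \<Rightarrow> cells \<Rightarrow> cells \<Rightarrow> bool" where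
  "occurs_in' n q E = agree' n q E"
| "occurs_in' n q (A w) = (agree' n q (A w) \<or> occurs_in' n q w)"
| "occurs_in' n q (B w) = (agree' n q (B w) \<or> occurs_in' n q w)"
| "occurs_in' n q (C w) = (agree' n q (C w) \<or> occurs_in' n q w)"
| "occurs_in' n q (U w) = (agree' n q (U w) \<or> occurs_in' n q w)"

lemma occurs_in'_cells: "occurs_in' n q w = occurs_in n (of_cells q) (of_cells w)"
  by (induction w) (simp_all add: agree'_def)

lemma avoids_code [code]: "avoids q w = (\<not> occurs_in' (length q) (word_cells q) (word_cells w))"
  by (simp add: avoids_def occurs_in'_cells)

primrec word :: "string \<Rightarrow> letter list" where
  "word [] = []"
| "word (c # s) = (if c = CHR ''a'' then La else if c = CHR ''b'' then Lb else Lc) # word s"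

lemma word_code [code]:
  "word [] = []"
  "word (CHR ''a'' # s) = La # word s" "word (CHR ''b'' # s) = Lb # word s" "word (CHR ''c'' # s) = Lc # word s"
  by simp_all

definition certified :: "letter list \<Rightarrow> bool" where
  "certified w \<longleftrightarrow> squarefree_test w \<and> closed_range 0 (Suc (length w)) w"

lemma certified_stuck: "certified w \<Longrightarrow> stuck w"
  using closed_range_blocked[of 0 "Suc (length w)" w]
  by (auto simp: certified_def stuck_iff_blocked squarefree_test_sound)


section \<open>Words of all large lengths\<close>

text \<open>The words below were found by computer search.\<close>

primrec block :: "letter \<Rightarrow> letter list" where
  "block La = word ''abcacbacabacbcacbabcabacabcbabcabacbcacba''"
| "block Lb = word ''bcabacbabcbacabacbcabcbabcacbcabcbacabacb''"
| "block Lc = word ''cabcbacbcacbabcbacabcacbcabacabcacbabcbac''"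

text \<open>The three caps are one word up to the cyclic permutation \<open>La\<close> to
  \<open>Lb\<close> to \<open>Lc\<close> to \<open>La\<close>; the same holds for the three
  blocks.\<close>

primrec right_cap :: "letter \<Rightarrow> letter list" where
  "right_cap La = word ''bcabacbabcacbacabcacbabcabacbabcacbac''"
| "right_cap Lb = word ''cabcbacbcabacbabcabacbcabcbacbcabacba''"
| "right_cap Lc = word ''abcacbacabcbacbcabcbacabcacbacabcbacb''"

lemma block_code [code]:
  "block La = [La, Lb, Lc, La, Lc, Lb, La, Lc, La, Lb, La, Lc, Lb, Lc, La, Lc, Lb, La, Lb, Lc,
    La, Lb, La, Lc, La, Lb, Lc, Lb, La, Lb, Lc, La, Lb, La, Lc, Lb, Lc, La, Lc, Lb, La]"
  "block Lb = [Lb, Lc, La, Lb, La, Lc, Lb, La, Lb, Lc, Lb, La, Lc, La, Lb, La, Lc, Lb, Lc, La,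
    Lb, Lc, Lb, La, Lb, Lc, La, Lc, Lb, Lc, La, Lb, Lc, Lb, La, Lc, La, Lb, La, Lc, Lb]"
  "block Lc = [Lc, La, Lb, Lc, Lb, La, Lc, Lb, Lc, La, Lc, Lb, La, Lb, Lc, Lb, La, Lc, La, Lb,
    Lc, La, Lc, Lb, Lc, La, Lb, La, Lc, La, Lb, Lc, La, Lc, Lb, La, Lb, Lc, Lb, La, Lc]"
  by simp_all

lemma right_cap_code [code]:
  "right_cap La = [Lb, Lc, La, Lb, La, Lc, Lb, La, Lb, Lc, La, Lc, Lb, La, Lc, La, Lb, Lc, La,
    Lc, Lb, La, Lb, Lc, La, Lb, La, Lc, Lb, La, Lb, Lc, La, Lc, Lb, La, Lc]"
  "right_cap Lb = [Lc, La, Lb, Lc, Lb, La, Lc, Lb, Lc, La, Lb, La, Lc, Lb, La, Lb, Lc, La, Lb,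
    La, Lc, Lb, Lc, La, Lb, Lc, Lb, La, Lc, Lb, Lc, La, Lb, La, Lc, Lb, La]"
  "right_cap Lc = [La, Lb, Lc, La, Lc, Lb, La, Lc, La, Lb, Lc, Lb, La, Lc, Lb, Lc, La, Lb, Lc,
    Lb, La, Lc, La, Lb, Lc, La, Lc, Lb, La, Lc, La, Lb, Lc, Lb, La, Lc, Lb]"
  by simp_all

definition left_caps :: "letter list list" where
  "left_caps = [
    word ''abacbabcacbcabacbabcacbacabcbacbcabacb'',
    word ''cbcabcbacabacbcabcbacabcacbabcabacbcabcbac'',
    word ''babcacbabcabacbcabcbacabacbcacbabcabacbcabcbac'',
    word ''acabcbacbcabacabcbacbcacbabcbacbcabacabcbacbcabcb'',
    word ''cbcabacbabcacbcabacbabcbacabacbabcacbcabacbabcabac'',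
    word ''acabcbacbcabacabcbacbcacbabcbacbcabacabcbacbcabcbac'',
    word ''bcbacbcabacabcbacbcabacbabcacbacabcbacbcabacbabcabac'',
    word ''cacbabcabacbcacbabcabacabcbabcabacbcacbabcabacbabcbac'',
    word ''bcabcbacabcacbacabcbacbcabcbacabcacbacabcbabcacbcabacb'',
    word ''acabcacbabcbacabcacbabcabacbcabcbacabcacbabcabacbabcbac'',
    word ''bcbacbcabacabcbacbcabacbabcacbacabcbacbcabacbabcbacabacb'',
    word ''bcbacbcabacabcbacbcabacbabcacbacabcbacbcabacbabcbacbcabac'',
    word ''babcacbacabcbabcacbacabacbcacbacabcbabcacbacabcacbabcabacb'',
    word ''acbacabcbacbcabacbabcbacabacbcacbacabcbacbcabacbabcbacabacb'',
    word ''abacbcabcbacabacbcabcbabcacbcabcbacabacbcabcbacbcacbabcabacb'',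
    word ''abacbabcacbcabacbabcacbacabcbacbcabacbabcacbacabacbcacbabcbac'',
    word ''bcbacabcbacbcabacbabcacbcabacabcbacbcabacbabcacbacabcbacbcabcb'',
    word ''cabcacbabcabacbcabcbabcacbcabacabcacbabcabacbcabcbabcacbcabcbac'',
    word ''bcbacbcabacabcbacbcabacbabcacbacabcbacbcabacbabcabacabcbacbcabcb'',
    word ''bcbacabcbacbcabacbabcacbcabacabcbacbcabacbabcacbacabacbcacbabcbac'',
    word ''babcacbabcabacbcabcbacabacbcacbabcabacbcabcbacabcacbabcabacbabcbac'',
    word ''bcbacbcabacabcbacbcabacbabcacbacabcbacbcabacbabcbacabacbabcacbcabac'',
    word ''cbcabcbacabacbcabcbacabcacbabcabacbcabcbacabcacbacabacbcabcbacbcabacb'',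
    word ''cacbabcabacbcacbabcabacabcbabcabacbcacbabcabacbabcacbcabacbcacbacabacb'',
    word ''bcbacbcabacabcbacbcabacbabcacbacabcbacbcabacbabcabacabcbacbcabacbabcbac'',
    word ''cacbabcacbacabcbacbcabacabcbabcacbacabcbacbcabacbabcacbacabacbcacbabcbac'',
    word ''cacbabcacbacabcbacbcabacabcbabcacbacabcbacbcabacbabcacbcabacabcbacbcabacb'',
    word ''acabcbacbcabacabcbacbcacbabcbacbcabacabcbacbcabcbacabcacbabcbacabacbcabcbac'',
    word ''abcabacbcabcbabcacbcabacabcbabcabacbcabcbabcacbcabacabcacbabcabacbcacbabcbac'',
    word ''abacbcabcbacabacbcabcbabcacbcabcbacabacbcabcbacbcacbabcacbcabcbacbcacbacabacb'',
    word ''acabcacbabcbacabcacbabcabacbcabcbacabcacbabcabacabcbabcabacbcacbabcabacbabcbac'',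
    word ''cbacbcabacbabcacbacabcbacbcacbabcbacbcabacbabcacbacabcbacbcacbacabcbabcacbcabacb'',
    word ''bcbacabcbacbcabacbabcacbcabacabcbacbcabacbabcacbacabcacbcabacbabcacbacabacbcabcbac'',
    word ''cacbacabcbabcacbacabcbacbcabacbabcacbacabcbacbcacbabcbacbcabacbabcbacabacbabcacbcabac'',
    word ''acabcbacabcacbabcabacbcacbabcbacabcacbabcabacbcabcbacbcabacabcbacbcacbabcbacbcabacabcb'',
    word ''abacbcabcbacabacbcabcbabcacbcabcbacabacbcabcbacbcacbabcabacbcabcbacbcacbacabacbcacbabcbac'',
    word ''abcabacbcabcbacbcabacbabcabacbcabcbacbcabac'',
    word ''acabcbacbcabacabcbacbcacbabcbacbcabacabcbacbcabcbabcabacbabcbacbcabcbabcacbcabacb'',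
    word ''bcbacabcacbabcbacabcacbcabacabcacbabcbacabcacbacabacbabcabacbcabcbacbcabacbabcabacbcabcb'',
    word ''cbcabacbabcacbcabacbabcbacabacbabcacbcabacbabcabacabcbacabacbabcabac'',
    word ''cacbacabcbabcacbacabcbacbcabacbabcacbacabcbacbcacbabcbacbcabacbabcbacabacb'']"

text \<open>Besides the thirteen lengths below 87, these words have the lengths 87 to 127 except
  121, which the left cap of length 43 yields with a single block.\<close>

definition sporadic :: "letter list list" where
  "sporadic = [
    word ''abcabacbcabcbabcabacbcabc'',
    word ''abcabacbcabcbacabcacbabcabacbcabcbacabcac'',
    word ''abacbcabcbacabacbcabcbabcacbcabcbacabacbcabcbaca'',
    word ''abacbcabacbabcacbacabcbabcacbcabacbabcacbacabcbaca'',
    word ''abcabacbcabcbabcacbcabcbacabcacbabcabacbcabcbabcacbcabcbacabcac'',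
    word ''abacbcabacbabcabacbcabcbacabcacbcabacbabcabacbcabcbacabacbabcabacbcabcb'',
    word ''abacbcabacbabcbacabacbabcacbacabcbabcacbcabacbabcbacabacbabcacbacabcbaca'',
    word ''abcabacbcabcbacbcabacbabcabacbcabcbacbcabacabcbacbcacbabcbacbcabacabcbacbcaba'',
    word ''abcabacbcabcbacabcacbacabcbacbcabacbabcabacbcabcbacabcacbacabcbacbcabacabcbacbc'',
    word ''abacbcabacbabcacbacabcbabcacbcabacbabcacbacabcbacbcabacabcbabcacbacabcbacbcabacbc'',
    word ''abcabacbcabcbacbcabacbabcabacbcabcbacbcabacabcbacbcabcbacabcacbacabcbacbcabcbacabca'',
    word ''abacbabcacbcabacbabcacbacabcbacbcacbabcbacbcabacbabcacbacabcbacbcabacbabcacbcabacbab'',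
    word ''abcabacbcabcbacbcabacbabcabacbcabcbacabcacbabcabacbcabcbacbcabacbabcabacbcabcbacabcac'',
    word ''abcabacbcabcbacabcacbacabcbacbcabacbabcabacbcabcbacabcacbacabcbacbcabacabcacbacabcbacbc'',
    word ''abacbcabacbabcacbacabcbabcacbcabacbabcacbacabcbacbcabacbabcacbcabacabcbacbcabacbabcacbab'',
    word ''abacbcabcbacabacbcabcbabcacbcabcbacabacbcabcbacbcabacbabcacbacabcbacbcabacbabcacbcabacbab'',
    word ''abcbacbcabacbabcbacbcabacabcbacabacbabcabacbcabcbacbcabacbabcbacbcabacabcbacabacbabcabacba'',
    word ''abcabacbcabcbacbcabacbabcabacbcabcbacbcabacabcbacabacbcabcbacbcabacbabcabacbcabcbacbcabacba'',
    word ''abcabacbcabcbacbcabacbabcabacbcabcbacbcabacabcacbacabcbacbcabacbabcacbacabcbacbcabacabcbacbc'',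
    word ''abcabacbcabcbacbcabacbabcacbacabcbacbcabacbabcabacbcabcbacbcabacbabcacbacabcbacbcabacabcbacbc'',
    word ''abcbacbcabacbabcbacbcabacabcacbacabacbabcabacbcabcbacbcabacbabcbacbcabacabcacbacabacbabcabacba'',
    word ''abcbabcabacbabcacbacabcacbcabacbabcacbacabcbacbcabcbabcabacbabcacbacabcacbcabacbabcacbacabcbacb'',
    word ''abcabacbcabcbacbcabacbabcabacbcabcbacbcabacabcbacbcabcbabcabacbabcacbacabcbacbcabcbabcabacbabcab'',
    word ''abcabacbcabcbacbcabacbabcabacbcabcbacbcabacabcbacbcacbacabcbacbcabacbabcacbacabcbacbcabacabcbacbc'',
    word ''abcabacbcabcbacbcabacbabcabacbcabcbacbcabacabcbacabacbabcabacbcacbabcabacabcbabcabacbcacbabcabacbc'',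
    word ''abcabacbcabcbacbcabacbabcacbacabcbacbcabcbacabcacbabcabacbcabcbacbcabacbabcacbacabcbacbcabcbacabcac'',
    word ''abcabacbcabcbacbcabacbabcabacbcabcbacbcabacabcbacabacbabcabacbcabcbacabcacbabcabacbcabcbacabacbcabcb'',
    word ''abcbabcabacbabcacbcabacbabcbacabacbabcacbacabcbacbcabcbabcabacbabcacbcabacbabcbacabacbabcacbacabcbacb'',
    word ''abacbabcacbcabacbabcacbacabcbacbcabacbabcacbacabacbabcabacabcacbabcabacbcabcbacabcacbabcabacbcacbabcaba'',
    word ''abacbabcacbcabacbabcacbacabcbacbcabacbabcacbacabacbabcacbcabcbacbcabacabcbacbcacbabcbacbcabacabcbacbcaba'',
    word ''abacbabcacbcabacbabcacbacabcbacbcabacbabcacbacabcacbcabcbabcabacbabcacbcabacbabcbacabacbabcacbcabacbabcac'',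
    word ''abacbabcacbcabacbabcacbacabcbacbcabacbabcacbacabcacbabcabacbabcacbacabcbacbcabacabcbabcacbacabcbacbcabacbc'',
    word ''abacbabcacbcabacbabcacbacabcbacbcabacbabcacbacabacbcabcbabcacbcabcbacabcacbabcabacbcabcbacabcacbabcbacabcac'',
    word ''abacbabcacbcabacbabcacbacabcbacbcabacbabcacbacabcacbcabcbacabacbabcabacbcacbabcabacabcbabcabacbcacbabcabacbc'',
    word ''abacbabcacbcabacbabcacbacabcbacbcabacbabcacbacabcacbabcabacbcacbacabcacbabcbacabcacbcabacabcacbabcbacabcacbab'',
    word ''abacbabcacbcabacbabcacbacabcbacbcabacbabcacbacabcacbcabcbacabacbabcabacbcabcbacabcacbabcabacbcabcbacabacbcabcb'',
    word ''abacbabcacbcabacbabcacbacabcbacbcabacbabcacbacabacbcabcbabcacbcabcbacabacbcabcbacbcabacbabcabacbcabcbacbcabacba'',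
    word ''abacbabcacbcabacbabcacbacabcbacbcabacbabcacbacabacbcacbabcabacabcbabcabacbcabcbacabcacbabcabacbcabcbacabacbcabcb'',
    word ''abacbabcacbcabacbabcacbacabcbacbcabacbabcacbacabcacbabcabacbabcacbcabcbacbcabacabcbacbcacbabcbacbcabacabcbacbcaba'',
    word ''abacbabcacbcabacbabcacbacabcbacbcabacbabcacbacabcacbabcbacabcacbcabacabcacbabcabacbcabcbacabcacbabcabacbcacbabcaba'',
    word ''abacbabcacbcabacbabcacbacabcbacbcabacbabcacbacabcacbabcabacbabcacbcabcbacbcabacbabcacbacabcbacbcabacbabcacbcabacbab'',
    word ''abacbabcacbcabacbabcacbacabcbacbcabacbabcacbacabcacbcabacbcacbabcabacabcacbacabcbabcacbacabacbcacbacabcbabcacbacabcb'',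
    word ''abacbabcacbcabacbabcacbacabcbacbcabacbabcacbacabacbcabcbacbcacbacabcacbcabcbacbcabacabcbacbcacbabcbacbcabacabcbacbcaba'',
    word ''abacbabcacbcabacbabcacbacabcbacbcabacbabcacbacabcacbcabcbabcabacbabcacbcabcbacbcabacbabcacbacabcbacbcabacbabcacbcabacbab'',
    word ''abacbabcacbcabacbabcacbacabcbacbcabacbabcacbacabcacbcabcbabcabacbcabcbacabacbabcabacbcabcbacabcacbabcabacbcabcbacabacbcabcb'',
    word ''abacbabcacbcabacbabcacbacabcbacbcabacbabcacbacabacbcabcbabcacbcabcbacbcabacabcacbacabcbacbcabacbabcacbacabcbacbcabacabcbacbc'',
    word ''abacbabcacbcabacbabcacbacabcbacbcabacbabcacbacabcacbabcabacbabcacbcabacbabcbacabacbabcabacbcacbabcabacabcbabcabacbcacbabcabacbc'',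
    word ''abacbabcacbcabacbabcacbacabcbacbcabacbabcacbacabcacbabcbacbcabcbacabacbabcabacbcabcbacabcacbabcabacbcabcbacabacbcabcb'',
    word ''abacbabcacbcabacbabcacbacabcbacbcabacbabcacbacabcacbcabacbabcbacbcabacabcacbacabcbacbcabacbabcacbacabcbacbcabacabcbacbc'',
    word ''abacbabcacbcabacbabcacbacabcbacbcabacbabcacbacabcacbcabacbcacbabcacbcabacbabcbacbcabacbabcacbacabcbacbcabacbabcacbcabacbab'',
    word ''abacbabcacbcabacbabcacbacabcbacbcabacbabcacbacabcacbcabcbabcacbcabacbabcbacabacbabcacbcabacbabcabacbcabcbacbcabacbabcabacbcabc'',
    word ''abacbabcacbcabacbabcacbacabcbacbcabacbabcacbacabcacbabcabacbabcacbacabcbacbcabacbabcacbacabcbabcacbaca'',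
    word ''abacbabcacbcabacbabcacbacabcbacbcabacbabcacbacabcacbabcabacbabcacbcabacbabcbacabacbabcacbacabcbacbcabacbabcacbacabcbabcacbaca'']"

section \<open>Finite certificates for the morphism and the caps\<close>

definition blocks :: "letter list \<Rightarrow> letter list" where
  "blocks u = concat (map block u)"

definition pairs :: "(letter \<times> letter) list" where
  "pairs = [(La,Lb), (La,Lc), (Lb,La), (Lb,Lc), (Lc,La), (Lc,Lb)]"

definition triples :: "(letter \<times> letter \<times> letter) list" where
  "triples = [(La,Lb,La), (La,Lb,Lc), (La,Lc,La), (La,Lc,Lb), (Lb,La,Lb), (Lb,La,Lc),
    (Lb,Lc,La), (Lb,Lc,Lb), (Lc,La,Lb), (Lc,La,Lc), (Lc,Lb,La), (Lc,Lb,Lc)]"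

text \<open>These factors occur only at the joint between a cap and the image of the morphism, so no square of
  long period can cover a joint together with its surroundings.\<close>

definition right_seam :: "letter \<Rightarrow> letter list" where
  "right_seam z = drop 31 (block z) @ take 20 (right_cap z)"

definition left_seam :: "letter list \<Rightarrow> letter list" where
  "left_seam P = drop (length P - 20) P @ take 10 (block La)"

text \<open>The word with cap has 123 + 37 = 160 letters. Its joint factor occupies the positions
  113 to 142, so the prefix of length 142 misses it by one letter, and 79 insertion points run from
  the start of the last block to the end.\<close>

definition triple_ok :: "letter \<Rightarrow> letter \<Rightarrow> letter \<Rightarrow> bool" where
  "triple_ok x y z \<longleftrightarrow> squarefree_test (blocks [x, y, z] @ right_cap z) \<and>
     closed_range 41 41 (blocks [x, y, z]) \<and> closed_range 82 79 (blocks [x, y, z] @ right_cap z) \<and>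
     avoids (right_seam z) (take 142 (blocks [x, y, z] @ right_cap z)) \<and>
     list_all (\<lambda>t. avoids (right_seam t) (blocks [x, y, z])) [La, Lb, Lc]"

text \<open>Four letters suffice: a square of period at most 57 has at most 114 letters and starts
  at offset at most 40 of a block, while four blocks have 164 letters. The first two alternatives
  cannot occur in a square-free \<open>u\<close>.\<close>

definition quad_ok :: "letter \<Rightarrow> letter \<Rightarrow> letter \<Rightarrow> letter \<Rightarrow> bool" where
  "quad_ok x y z t \<longleftrightarrow> z = t \<or> (x = z \<and> y = t) \<or> squarefree_test (blocks [x, y, z, t])"

text \<open>Factors of length 20 determine their position modulo 41.\<close>

definition sync_ok :: "nat \<Rightarrow> bool" where
  "sync_ok i \<longleftrightarrow> list_all (\<lambda>(a, b). list_all (\<lambda>(c, d).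
     avoids (take 20 (drop i (blocks [a, b]))) (drop (Suc i) (take 60 (blocks [c, d])))) pairs) pairs"

text \<open>Dropping \<open>length P - 19\<close> letters removes just the first letter of the
  expected occurrence of \<open>left_seam P\<close>. The two words at the end have fewer than the
  three blocks that the general argument requires.\<close>

definition left_ok :: "letter list \<Rightarrow> bool" where
  "left_ok P \<longleftrightarrow> squarefree_test (P @ blocks [La, Lb, Lc]) \<and> closed_range 0 (length P + 42) (P @ blocks [La, Lb, Lc]) \<and>
     avoids (left_seam P) (drop (length P - 19) (P @ blocks [La, Lb, Lc])) \<and>
     list_all (\<lambda>(x, y, z). avoids (left_seam P) (blocks [x, y, z] @ right_cap z)) triples \<and>
     list_all (\<lambda>t. avoids (right_seam t) (P @ blocks [La, Lb, Lc])) [La, Lb, Lc] \<and>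
     certified (P @ blocks [La] @ right_cap La) \<and> certified (P @ blocks [La, Lb] @ right_cap Lb)"

lemma sporadic_certified: "list_all certified sporadic" by code_simp
lemma triples_ok: "list_all (\<lambda>(x, y, z). triple_ok x y z) triples" by code_simp
lemma quads_ok: "list_all (\<lambda>(x, y, z). list_all (quad_ok x y z) [La, Lb, Lc]) triples" by code_simp
lemma sync: "list_all sync_ok [0..<41]" by code_simp
lemma left_caps_ok_take: "list_all left_ok (take 20 left_caps)" by code_simp
lemma left_caps_ok_drop: "list_all left_ok (drop 20 left_caps)" by code_simp
lemma left_caps_ok: "list_all left_ok left_caps"
  using left_caps_ok_take left_caps_ok_drop by (metis append_take_drop_id list_all_append)
lemma caps_length: "list_all (\<lambda>P. 20 \<le> length P \<and> length P \<le> 89) left_caps" by code_simp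

section \<open>Positions in images under the morphism, squares and factors\<close>

lemma length_block [simp]: "length (block x) = 41"
  by (cases x) simp_all

lemma blocks_simps [simp]: "blocks [] = []" "blocks (x # u) = block x @ blocks u"
  by (simp_all add: blocks_def)

lemma blocks_append [simp]: "blocks (u @ v) = blocks u @ blocks v"
  by (simp add: blocks_def)

lemma length_morph [simp]: "length (blocks u) = 41 * length u"
  by (induction u) simp_all

lemma blocks_nth: "t < length u \<Longrightarrow> s < 41 \<Longrightarrow> blocks u ! (41 * t + s) = block (u ! t) ! s"
proof (induction u arbitrary: t)
  case (Cons x u)
  then show ?case by (cases t) (auto simp: nth_append)
qed simp

text \<open>The blocks arise from each other by a cyclic permutation of the alphabet, which fixes no
  letter. Hence a single letter at a known offset identifies its block.\<close>

lemma block_nth_neq: "x \<noteq> y \<Longrightarrow> s < 41 \<Longrightarrow> block x ! s \<noteq> block y ! s"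
proof -
  assume "x \<noteq> y" "s < 41"
  have "list_all2 (\<noteq>) (block x) (block y)" using \<open>x \<noteq> y\<close> by (cases x; cases y) simp_all
  then show ?thesis using list_all2_nthD[of "(\<noteq>)" "block x" "block y" s] \<open>s < 41\<close> by simp
qed

lemma square_at_nth: "square_at w i p \<Longrightarrow> i \<le> a \<Longrightarrow> a < i + p \<Longrightarrow> w ! a = w ! (a + p)"
proof -
  assume a: "square_at w i p" "i \<le> a" "a < i + p"
  then have "a - i < p" by linarith
  then have "w ! (i + (a - i)) = w ! (i + p + (a - i))" using a(1) by (simp only: square_at_def)
  then show ?thesis using a by (simp add: algebra_simps)
qed

lemma square_at_mid:
  "length X \<le> i \<Longrightarrow> i + 2 * p \<le> length X + length Y \<Longrightarrow> square_at (X @ Y @ Z) i p \<Longrightarrow> square_at Y (i - length X) p"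
proof -
  assume a: "length X \<le> i" "i + 2 * p \<le> length X + length Y" "square_at (X @ Y @ Z) i p"
  have n: "(X @ Y @ Z) ! (length X + j) = Y ! j" if "j < length Y" for j
    using that by (simp add: nth_append)
  show ?thesis
    unfolding square_at_def
  proof (intro conjI allI impI)
    fix j assume "j < p"
    then have "(X @ Y @ Z) ! (i + j) = (X @ Y @ Z) ! (i + p + j)" using a by (simp add: square_at_def)
    then show "Y ! (i - length X + j) = Y ! (i - length X + p + j)"
      using n[of "i - length X + j"] n[of "i - length X + p + j"] a \<open>j < p\<close> by (simp add: algebra_simps)
  qed (use a in \<open>auto simp: square_at_def\<close>)
qed

lemma occurs_at_mid:
  assumes "length X \<le> i" "i + length q \<le> length X + length Y" "occurs_at q (X @ Y @ Z) i"
  shows "occurs_at q Y (i - length X)"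
  unfolding occurs_at_def
proof (intro conjI allI impI)
  fix s assume s: "s < length q"
  have "(X @ Y @ Z) ! (i + s) = q ! s" using assms s by (simp add: occurs_at_def)
  moreover have "(X @ Y @ Z) ! (i + s) = Y ! (i - length X + s)" using assms s by (auto simp: nth_append algebra_simps)
  ultimately show "Y ! (i - length X + s) = q ! s" by simp
qed (use assms in auto)

lemma occurs_at_append: "occurs_at q (X @ q @ Y) (length X)"
  by (simp add: occurs_at_def nth_append)

lemma blocked_mid:
  assumes "length X \<le> i" "i \<le> length X + length Y" "blocked Y (i - length X)"
  shows "blocked (X @ Y @ Z) i"
  unfolding blocked_def
proof
  fix z
  have "sublist (take (i - length X) Y @ z # drop (i - length X) Y) (take i (X @ Y @ Z) @ z # drop i (X @ Y @ Z))"
    unfolding sublist_def using assms(1,2) by (intro exI[of _ X] exI[of _ Z]) simp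
  then show "\<not> square_free (take i (X @ Y @ Z) @ z # drop i (X @ Y @ Z))"
    using assms(3) square_free_sublist unfolding blocked_def by blast
qed

text \<open>A factor inside the first half of a square occurs again one period later. Together with
  \<open>square_at_shift_back\<close> this is how the unique factors at the joints exclude
  squares.\<close>

lemma square_at_shift:
  assumes "square_at w i p" "occurs_at q w j" "i \<le> j" "j + length q \<le> i + p" shows "occurs_at q w (j + p)"
  unfolding occurs_at_def
proof (intro conjI allI impI)
  fix s assume s: "s < length q"
  have "w ! (j + s) = w ! (j + s + p)" by (rule square_at_nth[OF assms(1)]) (use assms s in auto)
  moreover have "w ! (j + s) = q ! s" using assms s by (simp add: occurs_at_def)
  moreover have "j + p + s = j + s + p" by simp
  ultimately show "w ! (j + p + s) = q ! s" by metis
qed (use assms in \<open>auto simp: square_at_def\<close>)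

lemma square_at_shift_back:
  assumes "square_at w i p" "occurs_at q w j" "i + p \<le> j" "j + length q \<le> i + 2 * p" shows "occurs_at q w (j - p)"
  unfolding occurs_at_def
proof (intro conjI allI impI)
  fix s assume s: "s < length q"
  have "w ! (j - p + s) = w ! (j - p + s + p)" by (rule square_at_nth[OF assms(1)]) (use assms s in auto)
  moreover have "j - p + s + p = j + s" using assms by auto
  ultimately show "w ! (j - p + s) = q ! s" using assms s by (simp add: occurs_at_def)
qed (use assms in \<open>auto simp: occurs_at_def\<close>)

lemma square_free_4: "square_free (u @ [x, y, z, t] @ v) \<Longrightarrow> x \<noteq> y \<and> y \<noteq> z \<and> z \<noteq> t \<and> \<not> (x = z \<and> y = t)"
proof -
  assume s: "square_free (u @ [x, y, z, t] @ v)"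
  have r: "square_free (a @ p # q # b) \<Longrightarrow> p \<noteq> q" for a b and p q :: 'a
    using not_square_free_repeat by metis
  have "x \<noteq> y" using r[of u x y "z # t # v"] s by simp
  moreover have "y \<noteq> z" using r[of "u @ [x]" y z "t # v"] s by simp
  moreover have "z \<noteq> t" using r[of "u @ [x, y]" z t "v"] s by simp
  moreover have "\<not> (x = z \<and> y = t)"
  proof
    assume "x = z \<and> y = t"
    then have "square_at (u @ [x, y, z, t] @ v) (length u) 2" by (auto simp: square_at_def nth_append less_2_cases_iff)
    then show False using s by (auto simp: square_free_iff)
  qed
  ultimately show ?thesis by blast
qed

lemma adjacent_neq: "square_free (u @ x # y # v) \<Longrightarrow> x \<noteq> y"
  using not_square_free_repeat by metis

lemma triples_mem: "x \<noteq> y \<Longrightarrow> y \<noteq> z \<Longrightarrow> (x, y, z) \<in> set triples"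
  by (cases x; cases y; cases z) (simp_all add: triples_def)

lemma pairs_mem: "x \<noteq> y \<Longrightarrow> (x, y) \<in> set pairs"
  by (cases x; cases y) (simp_all add: pairs_def)

lemma triple_okD: "x \<noteq> y \<Longrightarrow> y \<noteq> z \<Longrightarrow> triple_ok x y z"
  using triples_ok triples_mem by (fastforce simp: list_all_iff)

lemma quad_square_free:
  assumes "square_free (u @ [x, y, z, t] @ v)" shows "square_free (blocks [x, y, z, t])"
proof -
  note n = square_free_4[OF assms]
  have "t \<in> set [La, Lb, Lc]" by (cases t) auto
  then have "quad_ok x y z t" using quads_ok triples_mem[of x y z] n by (fastforce simp: list_all_iff)
  then show ?thesis using n squarefree_test_sound by (auto simp: quad_ok_def)
qed

lemma split_at:
  assumes "t + n \<le> length u"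
  obtains v x where "u = take t u @ x @ v" "length x = n"
  using assms by (intro that[of "take n (drop t u)" "drop (t + n) u"]) (simp_all add: append_take_drop_id drop_drop[symmetric] add.commute del: drop_drop)

lemma length_2_3_4:
  "length x = 2 \<longleftrightarrow> (\<exists>a b. x = [a, b])"
  "length x = 3 \<longleftrightarrow> (\<exists>a b c. x = [a, b, c])"
  "length x = 4 \<longleftrightarrow> (\<exists>a b c d. x = [a, b, c, d])"
  by (auto simp: numeral_eq_Suc length_Suc_conv)

text \<open>The certificate compares an offset only with later ones; the other order is obtained by
  exchanging the two pairs.\<close>

lemma sync_pair:
  assumes "a \<noteq> b" "c \<noteq> d" "i < j" "j < 41"
  shows "\<exists>s<20. blocks [a, b] ! (i + s) \<noteq> blocks [c, d] ! (j + s)"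
proof (rule ccontr)
  assume n: "\<not> ?thesis"
  have "i \<in> set [0..<41]" using assms by simp
  then have "sync_ok i" using sync by (simp only: list_all_iff)
  then have "avoids (take 20 (drop i (blocks [a, b]))) (drop (Suc i) (take 60 (blocks [c, d])))"
    using pairs_mem[OF assms(1)] pairs_mem[OF assms(2)] unfolding sync_ok_def by (fastforce simp: list_all_iff)
  moreover have "occurs_at (take 20 (drop i (blocks [a, b]))) (drop (Suc i) (take 60 (blocks [c, d]))) (j - Suc i)"
    unfolding occurs_at_def
  proof (intro conjI allI impI)
    fix s assume s: "s < length (take 20 (drop i (blocks [a, b])))"
    have "blocks [a, b] ! (i + s) = blocks [c, d] ! (j + s)" using n s by auto
    then show "drop (Suc i) (take 60 (blocks [c, d])) ! (j - Suc i + s) = take 20 (drop i (blocks [a, b])) ! s"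
      using s assms(3,4) by (simp del: blocks_simps drop_append take_append)
  qed (use assms in auto)
  ultimately show False by (simp add: avoids_iff)
qed

text \<open>Synchronisation makes the period a multiple of 41, and letters at equal offsets in two blocks are
  equal only if the blocks are, so the square descends to \<open>u\<close>.\<close>

lemma long_square:
  assumes u: "square_free u" and sq: "square_at (X @ blocks u @ Y) i p" and p: "58 \<le> p"
    and left: "length X < i + 20" and right: "i + 2 * p < length X + 41 * length u + 20"
  shows False
proof -
  let ?w = "X @ blocks u @ Y"
  \<comment> \<open>The place in \<open>blocks u\<close> where the square begins, after at most 19
    letters inside \<open>X\<close>.\<close>
  define j where "j = max i (length X) - length X"
  have j: "i \<le> length X + j" "length X + j \<le> i + 19" using left by (auto simp: j_def)
  have w: "?w ! (length X + s) = blocks u ! s" if "s < 41 * length u" for s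
    using that by (simp add: nth_append)
  have per: "blocks u ! (j + s) = blocks u ! (j + s + p)" if "length X + j + s < i + p" "j + s + p < 41 * length u" for s
  proof -
    have "?w ! (length X + (j + s)) = ?w ! (length X + (j + s) + p)"
      by (rule square_at_nth[OF sq]) (use that j in auto)
    moreover have "length X + (j + s) + p = length X + (j + s + p)" by simp
    ultimately show ?thesis using w[of "j + s"] w[of "j + s + p"] that by simp
  qed
  define r t r' t' where "r = j mod 41" "t = j div 41" "r' = (j + p) mod 41" "t' = (j + p) div 41"
  have jt: "j = 41 * t + r" "j + p = 41 * t' + r'" "r < 41" "r' < 41"
    by (auto simp: r_t_r'_t'_def)
  \<comment> \<open>The hypotheses give \<open>j + 20 + p \<le> 41 * length u + 58 - p\<close>, and
    here 58 is needed: 20 letters of window and 19 of overhang on either side.\<close>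
  have jm: "j + 20 + p \<le> 41 * length u" using j p right by linarith
  have pair: "\<exists>a b. a \<noteq> b \<and> (\<forall>s<20. blocks u ! (41 * k + l + s) = blocks [a, b] ! (l + s))"
    if "41 * k + l + 20 \<le> 41 * length u" "l < 41" for k l
  proof (cases "Suc k < length u")
    case True
    then have "k + 2 \<le> length u" by simp
    then obtain v x where v: "u = take k u @ x @ v" "length x = 2" by (rule split_at)
    then obtain a b where x: "x = [a, b]" by (auto simp: length_2_3_4)
    have "a \<noteq> b" using u v x adjacent_neq[of "take k u" a b v] by simp
    moreover have "blocks u ! (41 * k + l + s) = blocks [a, b] ! (l + s)" if "s < 20" for s
    proof -
      have "blocks u = blocks (take k u) @ blocks [a, b] @ blocks v" by (subst v(1)) (simp only: blocks_append x)
      moreover have "length (blocks (take k u)) = 41 * k" using True by simp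
      moreover have "l + s < length (blocks [a, b])" using \<open>l < 41\<close> that by simp
      ultimately show ?thesis by (simp only: nth_append add.assoc) simp
    qed
    ultimately show ?thesis by blast
  next
    case False
    then have k: "k < length u" "k = length u - 1" "l \<le> 21" using that by auto
    \<comment> \<open>The window ends inside the last block, so any letter other than
      \<open>u ! k\<close> may serve as the second one of the pair.\<close>
    obtain b where b: "b \<noteq> u ! k" by (metis letter.distinct(1))
    have "blocks u ! (41 * k + l + s) = blocks [u ! k, b] ! (l + s)" if "s < 20" for s
      using blocks_nth[OF k(1), of "l + s"] that k by (simp add: nth_append algebra_simps)
    then show ?thesis using b by metis
  qed
  have rr: "r = r'"
  proof (rule ccontr)
    assume "r \<noteq> r'"
    obtain a b where ab: "a \<noteq> b" "\<And>s. s < 20 \<Longrightarrow> blocks u ! (41 * t + r + s) = blocks [a, b] ! (r + s)"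
      using pair[of t r] jt jm by auto
    obtain c d where cd: "c \<noteq> d" "\<And>s. s < 20 \<Longrightarrow> blocks u ! (41 * t' + r' + s) = blocks [c, d] ! (r' + s)"
      using pair[of t' r'] jt jm by auto
    have e: "blocks [a, b] ! (r + s) = blocks [c, d] ! (r' + s)" if "s < 20" for s
    proof -
      have "blocks u ! (j + s) = blocks u ! (j + s + p)" by (rule per) (use that j p jm in auto)
      moreover have "j + s = 41 * t + r + s" "j + s + p = 41 * t' + r' + s" using jt by auto
      ultimately show ?thesis using ab(2)[OF that] cd(2)[OF that] by metis
    qed
    show False
      using \<open>r \<noteq> r'\<close> sync_pair[OF ab(1) cd(1), of r r'] sync_pair[OF cd(1) ab(1), of r' r] e jt(3,4)
      by (metis linorder_neqE_nat)
  qed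
  define k where "k = t' - t"
  have k: "p = 41 * k" "t \<le> t'" using jt rr unfolding k_def by auto
  have k0: "0 < k" using k p by auto
  have "square_at u t k"
    unfolding square_at_def
  proof (intro conjI allI impI)
    have "2 * p = 82 * k" "41 * t \<le> j" using k jt by simp_all
    \<comment> \<open>At most 19 letters of the square lie on either side of
      \<open>blocks u\<close>, together less than one block; rounding down to whole blocks keeps the
      square of \<open>u\<close> inside \<open>u\<close>.\<close>
    then have "41 * (t + 2 * k) < 41 * length u + 41" using j(2) right by simp
    then show tk: "t + 2 * k \<le> length u" by simp
    fix l assume l: "l < k"
    have l1: "41 * l + 41 \<le> 41 * k" using l by simp
    have a: "j + 41 * l + p < 41 * length u" using j k right l1 by linarith
    have "blocks u ! (j + 41 * l) = blocks u ! (j + 41 * l + p)"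
      by (rule per) (use j l1 k a in linarith)+
    moreover have "j + 41 * l = 41 * (t + l) + r" "j + 41 * l + p = 41 * (t + k + l) + r" using jt k by auto
    moreover have "t + l < length u" "t + k + l < length u" using tk l by auto
    ultimately have "block (u ! (t + l)) ! r = block (u ! (t + k + l)) ! r"
      using blocks_nth[of "t + l" u r] blocks_nth[of "t + k + l" u r] jt(3) by metis
    then show "u ! (t + l) = u ! (t + k + l)" using block_nth_neq jt(3) by blast
  qed (use k0 in auto)
  then show False using u by (auto simp: square_free_iff)
qed

lemma short_square:
  assumes u: "square_free u" and sq: "square_at (X @ blocks u @ Y) i p" and p: "p < 58"
    and i: "length X \<le> i" "i < length X + 41 * (length u - 3)" "4 \<le> length u"
  shows False
proof -
  define t where "t = (i - length X) div 41"
  have t: "41 * t \<le> i - length X" "i - length X < 41 * t + 41" unfolding t_def by linarith+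
  have "t + 4 \<le> length u" using t i by linarith
  then obtain v x where v: "u = take t u @ x @ v" "length x = 4" by (rule split_at)
  then obtain a b c d where x: "x = [a, b, c, d]" by (auto simp: length_2_3_4)
  have sf: "square_free (blocks x)" using quad_square_free u v x by metis
  have "X @ blocks u @ Y = (X @ blocks (take t u)) @ blocks x @ (blocks v @ Y)"
    by (subst v(1)) (simp only: blocks_append append.assoc)
  moreover have "length (X @ blocks (take t u)) = length X + 41 * t" using \<open>t + 4 \<le> length u\<close> by simp
  ultimately have "square_at (blocks x) (i - (length X + 41 * t)) p"
    using square_at_mid[of "X @ blocks (take t u)" i p "blocks x" "blocks v @ Y"] sq t p i v(2) by simp
  then show False using sf by (auto simp: square_free_iff)
qed

text \<open>With empty caps the two lemmas above leave only squares of small period that start in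
  the last three blocks, and these lie in the image of the last four letters.\<close>

lemma square_free_morph:
  assumes "square_free u" "4 \<le> length u"
  shows "square_free (blocks u)"
proof (rule ccontr)
  assume "\<not> square_free (blocks u)"
  then obtain i p where sq: "square_at (blocks u) i p" by (auto simp: square_free_iff)
  then have sq': "square_at ([] @ blocks u @ []) i p" by simp
  have le: "i + 2 * p \<le> 41 * length u" using sq by (simp add: square_at_def)
  have p: "p < 58"
    using long_square[OF assms(1) sq'] le by fastforce
  show False
  proof (cases "i < 41 * (length u - 3)")
    case True
    then show False using short_square[OF assms(1) sq' p] assms(2) by simp
  next
    case False
    have "length u - 4 + 4 \<le> length u" using assms(2) by simp
    then obtain v x where v: "u = take (length u - 4) u @ x @ v" "length x = 4" by (rule split_at)
    have "length u = length (take (length u - 4) u) + length x + length v" by (subst v(1)) simp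
    then have "v = []" using v(2) assms(2) by simp
    obtain a b c d where x: "x = [a, b, c, d]" using v(2) by (auto simp: length_2_3_4)
    have sf: "square_free (blocks x)" using quad_square_free assms(1) v x by metis
    have e: "blocks u = blocks (take (length u - 4) u) @ blocks x @ []"
      by (subst v(1)) (simp add: \<open>v = []\<close>)
    have "square_at (blocks x) (i - length (blocks (take (length u - 4) u))) p"
      by (rule square_at_mid[where Z = "[]"]) (use sq e False le assms(2) v(2) in auto)
    then show False using sf by (auto simp: square_free_iff)
  qed
qed

lemma blocks_mid:
  assumes "square_free u" "t + 3 \<le> length u"
  obtains x y z v where "u = take t u @ [x, y, z] @ v" "triple_ok x y z" "(x, y, z) \<in> set triples"
    "length v = length u - (t + 3)"
proof -
  obtain v a where v: "u = take t u @ a @ v" "length a = 3" using split_at[OF assms(2)] by metis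
  then obtain x y z where a: "a = [x, y, z]" by (auto simp: length_2_3_4)
  have "x \<noteq> y" using v a assms(1) adjacent_neq[of "take t u" x y "z # v"] by simp
  moreover have "y \<noteq> z" using v a assms(1) adjacent_neq[of "take t u @ [x]" y z v] by simp
  moreover have "length v = length u - (t + 3)"
    using arg_cong[OF v(1), of length] v(2) assms(2) by simp
  ultimately show thesis using v a triple_okD triples_mem by (intro that[of x y z v]) auto
qed

section \<open>Words with a cap at both ends\<close>

context
  fixes P u :: "letter list"
  assumes P: "left_ok P" "20 \<le> length P" "length P \<le> 89"
    and u: "square_free u" "3 \<le> length u" "take 3 u = [La, Lb, Lc]"
begin

private abbreviation "w \<equiv> P @ blocks u @ right_cap (last u)"

private lemma capped_front: "\<exists>Z. w = [] @ (P @ blocks [La, Lb, Lc]) @ Z"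
proof -
  have "u = [La, Lb, Lc] @ drop 3 u" using u(3) append_take_drop_id by metis
  then have "blocks u = blocks [La, Lb, Lc] @ blocks (drop 3 u)" by (metis blocks_append)
  then show ?thesis by simp
qed

private lemma capped_back:
  obtains x y z where "w = (P @ blocks (take (length u - 3) u)) @ (blocks [x, y, z] @ right_cap z) @ []" "triple_ok x y z"
    "(x, y, z) \<in> set triples" "z = last u"
proof -
  have "length u - 3 + 3 \<le> length u" using u(2) by simp
  then obtain x y z v where v: "u = take (length u - 3) u @ [x, y, z] @ v" "triple_ok x y z"
    "(x, y, z) \<in> set triples" "length v = length u - (length u - 3 + 3)"
    by (rule blocks_mid[OF u(1)])
  then have v0: "v = []" using u(2) by simp
  have z: "z = last u" using v0 by (subst v(1)) simp
  have "blocks u = blocks (take (length u - 3) u) @ blocks [x, y, z]"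
    using v0 by (subst v(1)) (simp only: blocks_append append_Nil2)
  then show thesis using that[of x y z] v z by simp
qed

private lemma capped_mid:
  assumes "t + 3 \<le> length u"
  obtains x y z Z where "w = (P @ blocks (take t u)) @ blocks [x, y, z] @ Z" "triple_ok x y z"
    "(x, y, z) \<in> set triples"
proof -
  from blocks_mid[OF u(1) assms] obtain x y z v where v: "u = take t u @ [x, y, z] @ v" "triple_ok x y z"
    "(x, y, z) \<in> set triples" by metis
  have "blocks u = blocks (take t u) @ blocks [x, y, z] @ blocks v"
    by (subst v(1)) (simp only: blocks_append)
  then show thesis using that[of x y z "blocks v @ right_cap (last u)"] v by simp
qed

private lemma length_capped: "length w = length P + 41 * length u + 37"
  by (cases "last u") simp_all

private lemma front_square_free: "square_free (P @ blocks [La, Lb, Lc])"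
  using P(1) squarefree_test_sound by (simp only: left_ok_def)

private lemma front_square:
  assumes "square_at w i p" shows "length P + 123 < i + 2 * p"
proof (rule ccontr)
  assume a: "\<not> ?thesis"
  obtain Z where Z: "w = [] @ (P @ blocks [La, Lb, Lc]) @ Z" using capped_front by blast
  have "square_at (P @ blocks [La, Lb, Lc]) (i - length ([] :: letter list)) p"
    by (rule square_at_mid[OF _ _ assms[unfolded Z]]) (use a in auto)
  then show False using front_square_free by (auto simp: square_free_iff)
qed

private lemma back_square:
  assumes "square_at w i p" shows "i < length P + 41 * (length u - 3)"
proof (rule ccontr)
  assume a: "\<not> ?thesis"
  obtain x y z where Z: "w = (P @ blocks (take (length u - 3) u)) @ (blocks [x, y, z] @ right_cap z) @ []" "triple_ok x y z"
    by (rule capped_back) blast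
  have "i + 2 * p \<le> length w" using assms by (auto simp: square_at_def)
  then have le: "i + 2 * p \<le> length (P @ blocks (take (length u - 3) u)) + length (blocks [x, y, z] @ right_cap z)"
    unfolding Z(1) by simp
  have "square_at (blocks [x, y, z] @ right_cap z) (i - length (P @ blocks (take (length u - 3) u))) p"
    by (rule square_at_mid[OF _ le assms[unfolded Z(1)]]) (use a in auto)
  then show False using Z(2) squarefree_test_sound by (auto simp only: square_free_iff triple_ok_def)
qed

private lemma left_seam_occurs: "occurs_at (left_seam P) w (length P - 20)" and length_left_seam: "length (left_seam P) = 30"
proof -
  show l: "length (left_seam P) = 30" using P(2) by (simp add: left_seam_def)
  obtain Z where Z: "w = [] @ (P @ blocks [La, Lb, Lc]) @ Z" using capped_front by blast
  have "P @ block La = take (length P - 20) P @ left_seam P @ drop 10 (block La)"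
    unfolding left_seam_def by (metis append.assoc append_take_drop_id)
  then have "w = take (length P - 20) P @ left_seam P @ drop 10 (block La) @ blocks [Lb, Lc] @ Z"
    unfolding Z by (simp only: append_Nil blocks_simps) (metis append.assoc)
  moreover have "length (take (length P - 20) P) = length P - 20" by simp
  ultimately show "occurs_at (left_seam P) w (length P - 20)"
    using occurs_at_append by metis
qed

private lemma right_seam_occurs: "occurs_at (right_seam (last u)) w (length P + 41 * length u - 10)"
  and length_right_seam: "length (right_seam z) = 30"
proof -
  show l: "length (right_seam z) = 30" for z by (cases z) (simp_all add: right_seam_def)
  have "u = butlast u @ [last u]" using u(2) by (intro append_butlast_last_id[symmetric]) auto
  then have mu: "blocks u = blocks (butlast u) @ block (last u)" by (metis blocks_append blocks_simps append_Nil2)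
  have "block (last u) @ right_cap (last u) =
      take 31 (block (last u)) @ right_seam (last u) @ drop 20 (right_cap (last u))"
    unfolding right_seam_def by (metis append.assoc append_take_drop_id)
  then have "w = (P @ blocks (butlast u) @ take 31 (block (last u))) @ right_seam (last u) @ drop 20 (right_cap (last u))"
    unfolding mu by (simp only: append_assoc)
  moreover have "length (P @ blocks (butlast u) @ take 31 (block (last u))) = length P + 41 * length u - 10"
    using u(2) by simp
  ultimately show "occurs_at (right_seam (last u)) w (length P + 41 * length u - 10)"
    using occurs_at_append by metis
qed

text \<open>A window of 30 letters meets at most two consecutive blocks. So it lies in the certified
  front, in the certified back, or in the image of three letters of \<open>u\<close>.\<close>

private lemma left_seam_once:
  assumes "occurs_at (left_seam P) w j" shows "j \<le> length P - 20"
proof (rule ccontr)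
  assume j: "\<not> ?thesis"
  note l = length_left_seam
  have le: "j + 30 \<le> length w" using assms l by (simp only: occurs_at_def)
  consider "j + 30 \<le> length P + 123" | "length P + 41 * (length u - 3) \<le> j" | "length P + 93 < j" "j < length P + 41 * (length u - 3)" by linarith
  then show False
  proof cases
    case 1
    obtain Z where Z: "w = [] @ (P @ blocks [La, Lb, Lc]) @ Z" using capped_front by blast
    have a: "occurs_at (left_seam P) (P @ blocks [La, Lb, Lc]) (j - length ([] :: letter list))"
      by (rule occurs_at_mid[OF _ _ assms[unfolded Z]]) (use 1 l in auto)
    define F where "F = P @ blocks [La, Lb, Lc]"
    have F: "F = take (length P - 19) F @ drop (length P - 19) F @ []" "length F = length P + 123" by (simp_all add: F_def)
    have "occurs_at (left_seam P) F j" using a by (simp add: F_def)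
    then have "occurs_at (left_seam P) (take (length P - 19) F @ drop (length P - 19) F @ []) j" using F(1) by simp
    then have "occurs_at (left_seam P) (drop (length P - 19) F) (j - length (take (length P - 19) F))"
      by (rule occurs_at_mid[rotated 2]) (use 1 j l F(2) in auto)
    moreover have "avoids (left_seam P) (drop (length P - 19) F)" using P(1) by (simp only: left_ok_def F_def)
    ultimately show False by (simp add: avoids_iff)
  next
    case 2
    obtain x y z where Z: "w = (P @ blocks (take (length u - 3) u)) @ (blocks [x, y, z] @ right_cap z) @ []" 
      "(x, y, z) \<in> set triples" by (rule capped_back) blast
    have le: "j + length (left_seam P) \<le> length (P @ blocks (take (length u - 3) u)) + length (blocks [x, y, z] @ right_cap z)"
      using le l unfolding Z(1) by simp
    have "occurs_at (left_seam P) (blocks [x, y, z] @ right_cap z) (j - length (P @ blocks (take (length u - 3) u)))"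
      by (rule occurs_at_mid[OF _ le assms[unfolded Z(1)]]) (use 2 in auto)
    moreover have "avoids (left_seam P) (blocks [x, y, z] @ right_cap z)"
      using P(1) Z(2) unfolding left_ok_def list_all_iff by fast
    ultimately show False by (simp add: avoids_iff)
  next
    case 3
    define t where "t = (j - length P) div 41"
    have t: "41 * t \<le> j - length P" "j - length P < 41 * t + 41" unfolding t_def by linarith+
    have tm: "t + 3 \<le> length u" using t 3 by linarith
    obtain x y z Z where Z: "w = (P @ blocks (take t u)) @ blocks [x, y, z] @ Z" "(x, y, z) \<in> set triples"
      by (rule capped_mid[OF tm]) blast
    have lt: "length (P @ blocks (take t u)) = length P + 41 * t" using tm by simp
    have "occurs_at (left_seam P) (blocks [x, y, z]) (j - length (P @ blocks (take t u)))"
      by (rule occurs_at_mid[OF _ _ assms[unfolded Z(1)]]) (use 3 t l lt in auto)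
    \<comment> \<open>The image of three letters is a prefix of the word examined by the
      certificate, which also ends in a cap.\<close>
    then have "occurs_at (left_seam P) (blocks [x, y, z] @ right_cap z) (j - length (P @ blocks (take t u)))"
      by (auto simp: occurs_at_def nth_append simp del: blocks_simps)
    moreover have "avoids (left_seam P) (blocks [x, y, z] @ right_cap z)"
      using P(1) Z(2) unfolding left_ok_def list_all_iff by fast
    ultimately show False by (simp add: avoids_iff)
  qed
qed

private lemma right_seam_once:
  assumes "occurs_at (right_seam (last u)) w j" shows "length P + 41 * length u - 10 \<le> j"
proof (rule ccontr)
  assume j: "\<not> ?thesis"
  note l = length_right_seam
  have L: "last u \<in> set [La, Lb, Lc]" by (cases "last u") auto
  consider "j + 30 \<le> length P + 123" | "length P + 41 * (length u - 3) \<le> j" | "length P + 93 < j" "j < length P + 41 * (length u - 3)" by linarith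
  then show False
  proof cases
    case 1
    obtain Z where Z: "w = [] @ (P @ blocks [La, Lb, Lc]) @ Z" using capped_front by blast
    have "occurs_at (right_seam (last u)) (P @ blocks [La, Lb, Lc]) (j - length ([] :: letter list))"
      by (rule occurs_at_mid[OF _ _ assms[unfolded Z]]) (use 1 l in auto)
    moreover have "avoids (right_seam (last u)) (P @ blocks [La, Lb, Lc])"
      using P(1) L unfolding left_ok_def list_all_iff by fast
    ultimately show False by (simp add: avoids_iff)
  next
    case 2
    obtain x y z where Z: "w = (P @ blocks (take (length u - 3) u)) @ (blocks [x, y, z] @ right_cap z) @ []" 
      "triple_ok x y z" "z = last u" by (rule capped_back) blast
    define F where "F = blocks [x, y, z] @ right_cap z"
    have F: "F = [] @ take 142 F @ drop 142 F" "length F = 160" by (cases z; simp add: F_def)+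
    have lt: "length (P @ blocks (take (length u - 3) u)) = length P + 41 * (length u - 3)" by simp
    have "w = (P @ blocks (take (length u - 3) u)) @ take 142 F @ drop 142 F" using Z(1) F by (simp add: F_def)
    then have "occurs_at (right_seam (last u)) (take 142 F) (j - length (P @ blocks (take (length u - 3) u)))"
      using assms by (intro occurs_at_mid[where Z = "drop 142 F"]) (use 2 l j lt F(2) u(2) in auto)
    moreover have "avoids (right_seam (last u)) (take 142 F)" using Z by (simp only: triple_ok_def F_def)
    ultimately show False by (simp add: avoids_iff)
  next
    case 3
    define t where "t = (j - length P) div 41"
    have t: "41 * t \<le> j - length P" "j - length P < 41 * t + 41" unfolding t_def by linarith+
    have tm: "t + 3 \<le> length u" using t 3 by linarith
    obtain x y z Z where Z: "w = (P @ blocks (take t u)) @ blocks [x, y, z] @ Z" "triple_ok x y z"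
      by (rule capped_mid[OF tm]) blast
    have lt: "length (P @ blocks (take t u)) = length P + 41 * t" using tm by simp
    have "occurs_at (right_seam (last u)) (blocks [x, y, z]) (j - length (P @ blocks (take t u)))"
      by (rule occurs_at_mid[OF _ _ assms[unfolded Z(1)]]) (use 3 t l lt in auto)
    moreover have "avoids (right_seam (last u)) (blocks [x, y, z])"
      using Z(2) L unfolding triple_ok_def list_all_iff by fast
    ultimately show False by (simp add: avoids_iff)
  qed
qed

text \<open>A long square that starts 20 or more letters before \<open>blocks u\<close> has the left
  joint factor in its first half, and shifting it by the period contradicts
  \<open>left_seam_once\<close>; the right end is symmetric. What remains is the situation of
  \<open>long_square\<close>.\<close>

lemma capped_square_free: "square_free w"
proof (rule ccontr)
  assume "\<not> square_free w"
  then obtain i p where sq: "square_at w i p" by (auto simp: square_free_iff)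
  note fr = front_square[OF sq] and bk = back_square[OF sq]
  have le: "i + 2 * p \<le> length P + 41 * length u + 37" "0 < p" using sq length_capped by (simp_all only: square_at_def)
  show False
  proof (cases "p < 58")
    case True
    \<comment> \<open>A square of period at most 57 that leaves the first three blocks starts after
      \<open>P\<close>; one that begins before the last three blocks leaves room for four.\<close>
    show False
      by (rule short_square[OF u(1) sq True]) (use fr bk True in linarith)+
  next
    case False
    have "length P < i + 20"
    proof (rule ccontr)
      assume i: "\<not> ?thesis"
      \<comment> \<open>By \<open>front_square\<close> the square passes the third block; since
        \<open>length P \<le> 89\<close>, its first half already reaches ten letters beyond the
        joint.\<close>
      have ip: "length P + 10 \<le> i + p" using fr i P(3) by linarith
      have "occurs_at (left_seam P) w (length P - 20 + p)"
        by (rule square_at_shift[OF sq left_seam_occurs]) (use i ip P(2) length_left_seam in auto)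
      then have "length P - 20 + p \<le> length P - 20" by (rule left_seam_once)
      then show False using le by simp
    qed
    moreover have "i + 2 * p < length P + 41 * length u + 20"
    proof (rule ccontr)
      assume i: "\<not> ?thesis"
      have "occurs_at (right_seam (last u)) w (length P + 41 * length u - 10 - p)"
        by (rule square_at_shift_back[OF sq right_seam_occurs]) (use i le False length_right_seam[of "last u"] u(2) in auto)
      then have "length P + 41 * length u - 10 \<le> length P + 41 * length u - 10 - p" by (rule right_seam_once)
      then show False using le u(2) by simp
    qed
    ultimately show False using long_square[OF u(1) sq] False by simp
  qed
qed

lemma capped_stuck: "stuck w"
  unfolding stuck_iff_blocked
proof (intro conjI allI impI capped_square_free)
  fix i assume i: "i \<le> length w"
  consider "i \<le> length P + 41" | "length P + 41 * (length u - 3) + 82 \<le> i" | "length P + 41 < i" "i < length P + 41 * (length u - 3) + 82" by linarith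
  then show "blocked w i"
  proof cases
    case 1
    obtain Z where Z: "w = [] @ (P @ blocks [La, Lb, Lc]) @ Z" using capped_front by blast
    have "closed_range 0 (length P + 42) (P @ blocks [La, Lb, Lc])" using P(1) by (simp only: left_ok_def)
    then have "blocked (P @ blocks [La, Lb, Lc]) (i - length ([] :: letter list))"
      by (rule closed_range_blocked) (use 1 in auto)
    then show ?thesis unfolding Z by (rule blocked_mid[rotated 2]) (use 1 in auto)
  next
    case 2
    obtain x y z where Z: "w = (P @ blocks (take (length u - 3) u)) @ (blocks [x, y, z] @ right_cap z) @ []" 
      "triple_ok x y z" by (rule capped_back) blast
    have lt: "length (P @ blocks (take (length u - 3) u)) = length P + 41 * (length u - 3)" by simp
    have lF: "length (blocks [x, y, z] @ right_cap z) = 160" by (cases z; simp)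
    have "closed_range 82 79 (blocks [x, y, z] @ right_cap z)" using Z(2) by (simp only: triple_ok_def)
    then have "blocked (blocks [x, y, z] @ right_cap z) (i - length (P @ blocks (take (length u - 3) u)))"
      by (rule closed_range_blocked) (use 2 i[unfolded length_capped] lt lF u(2) in auto)
    then show ?thesis unfolding Z(1) by (rule blocked_mid[rotated 2]) (use 2 i[unfolded length_capped] lt lF u(2) in auto)
  next
    case 3
    \<comment> \<open>Subtracting 1 puts the insertion point into the middle one of three blocks,
      the part certified by \<open>closed_range 41 41\<close>.\<close>
    define t where "t = (i - length P) div 41 - 1"
    have t: "41 * t + 41 \<le> i - length P" "i - length P < 41 * t + 82" using 3 unfolding t_def by linarith+
    have tm: "t + 3 \<le> length u" using t 3 u(2) by linarith
    obtain x y z Z where Z: "w = (P @ blocks (take t u)) @ blocks [x, y, z] @ Z" "triple_ok x y z"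
      by (rule capped_mid[OF tm]) blast
    have lt: "length (P @ blocks (take t u)) = length P + 41 * t" using tm by simp
    have "closed_range 41 41 (blocks [x, y, z])" using Z(2) by (simp only: triple_ok_def)
    then have "blocked (blocks [x, y, z]) (i - length (P @ blocks (take t u)))"
      by (rule closed_range_blocked) (use 3 t lt in auto)
    then show ?thesis unfolding Z(1) by (rule blocked_mid[rotated 2]) (use 3 t lt in auto)
  qed
qed

end

lemma block_La_square_free: "square_free (block La)"
proof -
  have "squarefree_test (block La)" by code_simp
  then show ?thesis by (rule squarefree_test_sound)
qed

text \<open>The morphism is iterated on \<open>block La\<close>. Since \<open>block La\<close>
  begins with \<open>abc\<close>, so does the image of every word beginning with \<open>La\<close>;
  a prefix then has the exact length.\<close>

lemma square_free_seed:
  assumes "3 \<le> n"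
  obtains u where "square_free u" "length u = n" "take 3 u = [La, Lb, Lc]"
proof -
  have "\<exists>u. square_free u \<and> k + 41 \<le> length u \<and> take 3 u = [La, Lb, Lc]" for k
  proof (induction k)
    case 0
    show ?case by (intro exI[of _ "block La"]) (use block_La_square_free in \<open>simp add: numeral_eq_Suc\<close>)
  next
    case (Suc k)
    then obtain u where u: "square_free u" "k + 41 \<le> length u" "take 3 u = [La, Lb, Lc]" by blast
    obtain v where v: "u = La # v" using u(3) by (cases u) auto
    have "take 3 (blocks u) = take 3 (block La)" by (simp add: v)
    also have "\<dots> = [La, Lb, Lc]" by (simp add: numeral_eq_Suc)
    finally show ?case
      using square_free_morph[OF u(1)] u(2) by (intro exI[of _ "blocks u"]) auto
  qed
  then obtain u where u: "square_free u" "n + 41 \<le> length u" "take 3 u = [La, Lb, Lc]" by blast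
  have "square_free (take n u)" by (rule square_free_sublist[OF _ u(1)]) (rule sublist_take)
  moreover have "take 3 (take n u) = [La, Lb, Lc]" using u(3) assms by (simp add: min_def)
  ultimately show thesis using that u(2) by auto
qed

lemma cap_stuck:
  assumes "P \<in> set left_caps" "1 \<le> m"
  shows "\<exists>w. stuck w \<and> length w = length P + 41 * m + 37"
proof -
  have P: "left_ok P" "20 \<le> length P" "length P \<le> 89"
    using assms left_caps_ok caps_length by (auto simp: list_all_iff)
  have r: "length (right_cap z) = 37" for z by (cases z) simp_all
  consider "m = 1" | "m = 2" | "3 \<le> m" using assms(2) by linarith
  then show ?thesis
  proof cases
    case 1
    have "certified (P @ blocks [La] @ right_cap La)" using P(1) by (simp only: left_ok_def)
    then show ?thesis using certified_stuck 1 by (intro exI[of _ "P @ blocks [La] @ right_cap La"]) (simp del: right_cap.simps add: r)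
  next
    case 2
    have "certified (P @ blocks [La, Lb] @ right_cap Lb)" using P(1) by (simp only: left_ok_def)
    then show ?thesis using certified_stuck 2 by (intro exI[of _ "P @ blocks [La, Lb] @ right_cap Lb"]) (simp del: right_cap.simps add: r)
  next
    case 3
    then obtain u where u: "square_free u" "length u = m" "take 3 u = [La, Lb, Lc]" by (rule square_free_seed)
    then show ?thesis using capped_stuck[OF P u(1) _ u(3)] 3
      by (intro exI[of _ "P @ blocks u @ right_cap (last u)"]) (simp del: right_cap.simps add: r)
  qed
qed

section \<open>Every remaining length is reached\<close>

lemma left_caps_lengths: "map length left_caps = [38, 42, 46, 49, 50, 51, 52, 53, 54, 55, 56,
    57, 58, 59, 60, 61, 62, 63, 64, 65, 66, 67, 69, 70, 71, 72, 73, 75, 76, 77, 78, 80, 82, 85,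
    86, 89, 43, 81, 88, 68, 74]"
  by (simp add: left_caps_def)

lemma sporadic_lengths: "map length sporadic = [25, 41, 48, 50, 63, 71, 72, 77, 79, 81, 83, 84,
    85, 87, 88, 89, 90, 91, 92, 93, 94, 95, 96, 97, 98, 99, 100, 101, 103, 104, 105, 106, 107,
    108, 109, 110, 111, 112, 113, 114, 115, 116, 118, 120, 123, 124, 127, 117, 119, 122, 126,
    102, 125]"
  by (simp add: sporadic_def)

lemma shifted_lengthD: "n \<in> (\<lambda>l. l + a) ` set (map length Ps) \<Longrightarrow> \<exists>P\<in>set Ps. n = length P + a"
  by auto

text \<open>The threshold is 167 = 89 + 41 + 37, the longest left cap with one block. From there 41
  consecutive lengths are checked, where 78, 119 and 160 stand for one, two and three blocks with
  the right cap; further blocks give the rest.\<close>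

lemma cap_lengths_cover:
  assumes "167 \<le> n" shows "\<exists>P\<in>set left_caps. \<exists>m\<ge>1. n = length P + 41 * m + 37"
  using assms
proof (induction n rule: less_induct)
  case (less n)
  show ?case
  proof (cases "n < 208")
    case True
    then have "n \<in> set [167..<208]" using less.prems by (simp only: set_upt atLeastLessThan_iff)
    moreover have "set [167..<208] \<subseteq> (\<lambda>l. l + 78) ` set (map length left_caps) \<union>
        (\<lambda>l. l + 119) ` set (map length left_caps) \<union> (\<lambda>l. l + 160) ` set (map length left_caps)"
      unfolding left_caps_lengths by (simp add: upt_conv_Cons)
    ultimately have "n \<in> (\<lambda>l. l + 78) ` set (map length left_caps) \<or>
        n \<in> (\<lambda>l. l + 119) ` set (map length left_caps) \<or> n \<in> (\<lambda>l. l + 160) ` set (map length left_caps)"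
      by blast
    then obtain P k where P: "P \<in> set left_caps" "n = length P + k" "k = 78 \<or> k = 119 \<or> k = 160"
      using shifted_lengthD by metis
    then have "\<exists>m\<ge>1. n = length P + 41 * m + 37" by (intro exI[of _ "k div 41"]) auto
    then show ?thesis using P(1) by blast
  next
    case False
    then have "n - 41 < n" "167 \<le> n - 41" by simp_all
    from less.IH[OF this] obtain P m where "P \<in> set left_caps" "1 \<le> m" "n - 41 = length P + 41 * m + 37"
      by blast
    then show ?thesis using False by (intro bexI[of _ P] exI[of _ "Suc m"]) auto
  qed
qed

lemma stuck_exists:
  assumes "n \<in> allowed \<or> 87 \<le> n" shows "\<exists>w. stuck w \<and> length w = n"
proof -
  have sp: "\<exists>w. stuck w \<and> length w = n" if "n \<in> set (map length sporadic)"
    using that sporadic_certified certified_stuck by (auto simp: list_all_iff)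
  show ?thesis
  proof (cases "167 \<le> n")
    case True
    then show ?thesis using cap_lengths_cover cap_stuck by metis
  next
    case False
    have "allowed \<subseteq> set (map length sporadic)" unfolding allowed_def sporadic_lengths by simp
    moreover have "set [87..<167] \<subseteq> set (map length sporadic) \<union> (\<lambda>l. l + 78) ` set (map length left_caps) \<union>
        (\<lambda>l. l + 119) ` set (map length left_caps)"
      unfolding left_caps_lengths sporadic_lengths by (simp add: upt_conv_Cons)
    moreover have "n \<in> allowed \<or> n \<in> set [87..<167]"
      using assms False by (auto simp only: set_upt atLeastLessThan_iff not_le)
    ultimately have "n \<in> set (map length sporadic) \<or> n \<in> (\<lambda>l. l + 78) ` set (map length left_caps) \<or>
        n \<in> (\<lambda>l. l + 119) ` set (map length left_caps)"
      by blast
    then consider "n \<in> set (map length sporadic)"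
      | P k where "P \<in> set left_caps" "n = length P + k" "k = 78 \<or> k = 119"
      using shifted_lengthD by metis
    then show ?thesis
    proof cases
      case 2
      then have "n = length P + 41 * (k div 41) + 37" "1 \<le> k div 41" by auto
      then show ?thesis using cap_stuck[OF 2(1)] by simp
    qed (rule sp)
  qed
qed

lemma extremal_iff_stuck: "extremal_square_free \<Gamma> w \<longleftrightarrow> stuck w"
proof -
  have G: "z \<in> \<Gamma>" for z by (cases z) auto
  then have "w \<in> lists \<Gamma>" unfolding in_lists_conv_set by blast
  moreover have "(\<forall>v\<in>extensions \<Gamma> w. \<not> square_free v) \<longleftrightarrow> (\<forall>u v z. w = u @ v \<longrightarrow> \<not> square_free (u @ z # v))"
    unfolding extensions_def using G by (simp del: insert_iff) blast
  ultimately show ?thesis by (simp only: extremal_square_free_def stuck_def simp_thms)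
qed

theorem theorem1:
  fixes n :: nat
  shows "(\<exists>w. extremal_square_free \<Gamma> w \<and> length w = n) \<longleftrightarrow>
    n \<in> {25, 41, 48, 50, 63, 71, 72, 77, 79, 81, 83, 84, 85} \<union> {m. m \<ge> 87}"
proof -
  have "(\<exists>w. stuck w \<and> length w = n) \<longleftrightarrow> n \<in> allowed \<or> 87 \<le> n"
  proof
    assume "\<exists>w. stuck w \<and> length w = n"
    then obtain w where w: "stuck w" "length w = n" by blast
    show "n \<in> allowed \<or> 87 \<le> n"
    proof (cases "n \<le> 86")
      case True
      then show ?thesis using stuck_length[OF all_search_runs w(1)] w(2) by blast
    qed simp
  qed (rule stuck_exists)
  then show ?thesis unfolding extremal_iff_stuck allowed_def by blast
qed

end
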